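(* Let $0<\kappa<8$. Let $f(r)$ be a positive function with $f(r)\to0$ and $r/f(r)\to0$ as $r\downarrow0$. Suppose $D$ is a simply connected domain and $w_1,w_2$ are distinct points of $\partial D$. Let $\gamma$ be an $SLE_\kappa$ path from $w_1$ to $w_2$ in $D$, with full trace $\gamma_\infty$, and let $$Y_\epsilon=\operatorname{Area}\{z\in D:\ \operatorname{dist}(z,\partial D)\ge f(\epsilon),\ \operatorname{dist}(z,\gamma_\infty)\le\epsilon\}.$$ Then $$\lim_{\epsilon\downarrow0}\epsilon^{d-2}\,\mathbb E[Y_\epsilon]=\hat c\int_D G_D(z;w_1,w_2)\,dA(z),$$ where $\hat c$ is the constant described in the context.
   Context: Set $a=2/\kappa$ and $d=1+\frac{\kappa}{8}=1+\frac1{4a}$. Let $\mathbb H$ be the upper half-plane and $\mathbb D$ the unit disk; $dA$ denotes integration with respect to area. Chordal $SLE_\kappa$ from $0$ to $\infty$ in $\mathbb H$: let $U_t$ be a standard one-dimensional Brownian motion and let $g_t$ solve the Loewner equation $\partial_t g_t(z)=\frac{a}{g_t(z)-U_t}$, $g_0(z)=z$. There is a random curve $\gamma$ from $0$ to $\infty$ in $\overline{\mathbb H}$ such that the domain of $g_t$ is the unbounded component of $\mathbb H\setminus\gamma(0,t]$; this $\gamma$ is chordal $SLE_\kappa$. Chordal $SLE_\kappa$ from $w_1$ to $w_2$ in a simply connected domain $D\neq\mathbb C$ is the image of $\gamma$ under a conformal map $F:\mathbb H\to D$ with $F(0)=w_1$, $F(\infty)=w_2$ (the law, modulo reparametrization,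 does not depend on the choice of $F$). For $z\in D$, $\Upsilon_D(z)$ is one half of the conformal radius of $D$ with respect to $z$: if $F:\mathbb D\to D$ is a conformal transformation with $F(0)=z$, then $|F'(0)|=2\Upsilon_D(z)$. Also $S_D(z;w_1,w_2)=\sin[\arg f(z)]$, where $f:D\to\mathbb H$ is a conformal transformation with $f(w_1)=0$, $f(w_2)=\infty$. The (chordal) Green's function is $G_D(z;w_1,w_2)=\Upsilon_D(z)^{d-2}\,S_D(z;w_1,w_2)^{4a-1}$. The constant $\hat c=\hat c_\kappa\in(0,\infty)$ is the constant, depending only on $\kappa$, such that for every simply connected $D$, $z\in D$, distinct $w_1,w_2\in\partial D$, and $\gamma$ a chordal $SLE_\kappa$ path from $w_1$ to $w_2$ in $D$, one has $\mathbb P\{\operatorname{dist}(z,\gamma_\infty)\le\epsilon\}\sim\hat c\,G_D(z;w_1,w_2)\,\epsilon^{2-d}$ as $\epsilon\downarrow0$. *)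

theory Defs
  imports "HOL-Probability.Probability" "HOL-Complex_Analysis.Complex_Analysis"
begin

section \<open>Conformal maps and boundary points\<close>

definition upper_half_plane :: "complex set" where
  "upper_half_plane = {z. 0 < Im z}"

definition conformal_map :: "complex set \<Rightarrow> complex set \<Rightarrow> (complex \<Rightarrow> complex) \<Rightarrow> bool" where
  "conformal_map A B F \<longleftrightarrow> F holomorphic_on A \<and> bij_betw F A B"

definition simply_connected_domain :: "complex set \<Rightarrow> bool" where
  "simply_connected_domain D \<longleftrightarrow>
     open D \<and> D \<noteq> {} \<and> D \<noteq> UNIV \<and> simply_connected D"

text \<open>
  A conformal map need not extend continuously to the boundary, and several boundary points of
  the disk or half-plane may be sent to one point of the plane.  The boundary points of
  \<open>D\<close> at which an SLE path starts and ends are therefore prime ends, represented by their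
  neighbourhood filters in \<open>D\<close>: the filter of a prime end is the image, under a Riemann map, of
  the relative neighbourhood filter of a point of the unit circle.  An ordinary boundary point
  \<open>p\<close> corresponds to the filter \<open>at p within D\<close>, and the point at infinity of the half-plane to
  the filter \<open>half_plane_infinity\<close>; see the lemmas \<open>boundary_point_filter\<close> and
  \<open>boundary_infinity_filter\<close>.
\<close>

definition prime_ends :: "complex set \<Rightarrow> complex filter set" where
  "prime_ends D = {filtermap \<phi> (at \<zeta> within ball 0 1) |\<phi> \<zeta>.
     conformal_map (ball 0 1) D \<phi> \<and> cmod \<zeta> = 1}"

definition half_plane_zero :: "complex filter" where
  "half_plane_zero = at 0 within upper_half_plane"

definition half_plane_infinity :: "complex filter" where
  "half_plane_infinity = inf at_infinity (principal upper_half_plane)"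

lemma filtermap_conformal_eq:
  assumes F: "conformal_map A D F"
    and le: "L \<le> principal A" "w \<le> principal D"
    and lim: "filterlim F w L" and lim_inv: "filterlim (inv_into A F) L w"
  shows "filtermap F L = w"
proof (rule antisym)
  show "filtermap F L \<le> w"
    using lim by (simp add: filterlim_def)
  have "eventually (\<lambda>z. z \<in> D) w"
    using le(2) by (simp add: le_principal)
  then have "eventually (\<lambda>z. F (inv_into A F z) = z) w"
    by eventually_elim (use F in \<open>auto simp: conformal_map_def bij_betw_def f_inv_into_f\<close>)
  then have "filtermap (\<lambda>z. F (inv_into A F z)) w = filtermap (\<lambda>z. z) w"
    by (simp add: filter_eq_iff eventually_filtermap) (auto elim: eventually_elim2)
  then have "w = filtermap F (filtermap (inv_into A F) w)"
    by (simp add: filtermap_filtermap filtermap_ident)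
  also have "\<dots> \<le> filtermap F L"
    using lim_inv by (intro filtermap_mono) (simp add: filterlim_def)
  finally show "w \<le> filtermap F L" .
qed

lemma within_le_principal: "at p within (D::complex set) \<le> principal D"
  by (auto simp: at_within_def intro: le_infI2)

lemma boundary_point_filter:
  assumes "conformal_map A D F" "p \<notin> D" "x \<notin> A"
    and "(F \<longlongrightarrow> p) (at x within A)" "(inv_into A F \<longlongrightarrow> x) (at p within D)"
  shows "filtermap F (at x within A) = at p within D"
proof (rule filtermap_conformal_eq[OF assms(1)])
  have bij: "bij_betw F A D"
    using assms(1) by (simp add: conformal_map_def)
  have mem: "eventually (\<lambda>z. z \<in> A) (at x within A)" "eventually (\<lambda>z. z \<in> D) (at p within D)"
    by (auto simp: eventually_at_filter)
  show "filterlim F (at p within D) (at x within A)"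
    using assms(2,4) mem(1) bij
    by (auto simp: filterlim_at bij_betw_def elim!: eventually_mono)
  show "filterlim (inv_into A F) (at x within A) (at p within D)"
    using assms(3,5) mem(2) bij
    by (auto simp: filterlim_at bij_betw_def elim!: eventually_mono intro: inv_into_into)
qed (auto intro: within_le_principal)

lemma boundary_infinity_filter:
  assumes "conformal_map upper_half_plane D F" "p \<notin> D"
    and "(F \<longlongrightarrow> p) half_plane_infinity"
    and "filterlim (inv_into upper_half_plane F) at_infinity (at p within D)"
  shows "filtermap F half_plane_infinity = at p within D"
proof (rule filtermap_conformal_eq[OF assms(1)])
  have bij: "bij_betw F upper_half_plane D"
    using assms(1) by (simp add: conformal_map_def)
  have mem: "eventually (\<lambda>z. z \<in> upper_half_plane) half_plane_infinity"
    "eventually (\<lambda>z. z \<in> D) (at p within D)"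
    by (auto simp: eventually_at_filter half_plane_infinity_def eventually_inf_principal)
  show "half_plane_infinity \<le> principal upper_half_plane"
    by (simp add: half_plane_infinity_def)
  show "filterlim F (at p within D) half_plane_infinity"
    using assms(2,3) mem(1) bij
    by (auto simp: filterlim_at bij_betw_def elim!: eventually_mono)
  have "eventually (\<lambda>z. inv_into upper_half_plane F z \<in> upper_half_plane) (at p within D)"
    using mem(2) bij
    by (auto simp: bij_betw_def elim!: eventually_mono intro: inv_into_into)
  then show "filterlim (inv_into upper_half_plane F) half_plane_infinity (at p within D)"
    using assms(4)
    by (simp add: half_plane_infinity_def filterlim_inf filterlim_principal)
qed (auto intro: within_le_principal)

section \<open>Chordal SLE\<close>

definition sle_a :: "real \<Rightarrow> real" where
  "sle_a \<kappa> = 2 / \<kappa>"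

definition sle_dim :: "real \<Rightarrow> real" where
  "sle_dim \<kappa> = 1 + \<kappa> / 8"

definition standard_brownian_motion :: "'a measure \<Rightarrow> (real \<Rightarrow> 'a \<Rightarrow> real) \<Rightarrow> bool" where
  "standard_brownian_motion M U \<longleftrightarrow>
     prob_space M \<and>
     (\<forall>t\<ge>0. U t \<in> borel_measurable M) \<and>
     (AE \<omega> in M. U 0 \<omega> = 0 \<and> continuous_on {0..} (\<lambda>t. U t \<omega>)) \<and>
     (\<forall>s t. 0 \<le> s \<and> s < t \<longrightarrow>
        distributed M lborel (\<lambda>\<omega>. U t \<omega> - U s \<omega>) (normal_density 0 (sqrt (t - s)))) \<and>
     (\<forall>(n::nat) \<tau>. 0 \<le> \<tau> 0 \<and> (\<forall>i<n. \<tau> i \<le> \<tau> (Suc i)) \<longrightarrow>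
        prob_space.indep_vars M (\<lambda>_. borel) (\<lambda>i \<omega>. U (\<tau> (Suc i)) \<omega> - U (\<tau> i) \<omega>) {..<n})"

definition loewner_solution ::
  "real \<Rightarrow> (real \<Rightarrow> real) \<Rightarrow> complex \<Rightarrow> real \<Rightarrow> (real \<Rightarrow> complex) \<Rightarrow> bool" where
  "loewner_solution a u z t g \<longleftrightarrow>
     g 0 = z \<and>
     (\<forall>s\<in>{0..t}. g s \<noteq> of_real (u s) \<and>
        (g has_vector_derivative of_real a / (g s - of_real (u s))) (at s within {0..t}))"

text \<open>The domain of \<open>g\<^sub>t\<close>: the points whose Loewner flow has not been swallowed by time \<open>t\<close>.\<close>

definition loewner_domain :: "real \<Rightarrow> (real \<Rightarrow> real) \<Rightarrow> real \<Rightarrow> complex set" where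
  "loewner_domain a u t = {z \<in> upper_half_plane. \<exists>g. loewner_solution a u z t g}"

definition chordal_SLE :: "real \<Rightarrow> 'a measure \<Rightarrow> (real \<Rightarrow> 'a \<Rightarrow> complex) \<Rightarrow> bool" where
  "chordal_SLE \<kappa> M \<gamma> \<longleftrightarrow>
     (\<forall>t\<ge>0. \<gamma> t \<in> borel_measurable M) \<and>
     (\<forall>\<omega>\<in>space M. continuous_on {0..} (\<lambda>t. \<gamma> t \<omega>) \<and> (\<forall>t\<ge>0. \<gamma> t \<omega> \<in> closure upper_half_plane)) \<and>
     (\<exists>U. standard_brownian_motion M U \<and>
        (AE \<omega> in M.
           \<gamma> 0 \<omega> = 0 \<and> filterlim (\<lambda>t. \<gamma> t \<omega>) at_infinity at_top \<and>
           (\<forall>t\<ge>0.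
              loewner_domain (sle_a \<kappa>) (\<lambda>s. U s \<omega>) t
                \<in> components (upper_half_plane - (\<lambda>s. \<gamma> s \<omega>) ` {0<..t}) \<and>
              \<not> bounded (loewner_domain (sle_a \<kappa>) (\<lambda>s. U s \<omega>) t))))"

text \<open>
  The image of a curve \<open>\<eta>\<close> in the closed half-plane under a conformal map \<open>F\<close> of the open
  half-plane.  At times when \<open>\<eta>\<close> is in the open half-plane the limit is \<open>F (\<eta> t)\<close>; at times when
  \<open>\<eta>\<close> is on the real line it is the continuous boundary value of \<open>F\<close>, if there is one.
\<close>

definition image_trace :: "(complex \<Rightarrow> complex) \<Rightarrow> (real \<Rightarrow> complex) \<Rightarrow> complex set" where
  "image_trace F \<eta> = {w. \<exists>t\<ge>0. (F \<longlongrightarrow> w) (at (\<eta> t) within upper_half_plane)}"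

text \<open>\<open>\<Gamma>\<close> is the full trace of a chordal SLE path from \<open>w1\<close> to \<open>w2\<close> in \<open>D\<close>.\<close>

definition chordal_SLE_trace ::
  "real \<Rightarrow> complex set \<Rightarrow> complex filter \<Rightarrow> complex filter \<Rightarrow> 'a measure \<Rightarrow> ('a \<Rightarrow> complex set) \<Rightarrow> bool" where
  "chordal_SLE_trace \<kappa> D w1 w2 M \<Gamma> \<longleftrightarrow>
     (\<exists>\<gamma> F. chordal_SLE \<kappa> M \<gamma> \<and>
        conformal_map upper_half_plane D F \<and>
        filtermap F half_plane_zero = w1 \<and> filtermap F half_plane_infinity = w2 \<and>
        (\<forall>\<omega>\<in>space M. \<Gamma> \<omega> = image_trace F (\<lambda>t. \<gamma> t \<omega>)))"

text \<open>\<open>dist(z, S) \<le> \<epsilon>\<close>; the first conjunct is needed because \<open>infdist z {} = 0\<close>.\<close>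

definition within_dist :: "complex \<Rightarrow> complex set \<Rightarrow> real \<Rightarrow> bool" where
  "within_dist z S \<epsilon> \<longleftrightarrow> S \<noteq> {} \<and> infdist z S \<le> \<epsilon>"

section \<open>The Green's function\<close>

text \<open>One half of the conformal radius.\<close>

definition Upsilon :: "complex set \<Rightarrow> complex \<Rightarrow> real" where
  "Upsilon D z = (THE r. \<exists>F. conformal_map (ball 0 1) D F \<and> F 0 = z \<and> cmod (deriv F 0) = 2 * r)"

definition sin_arg :: "complex set \<Rightarrow> complex filter \<Rightarrow> complex filter \<Rightarrow> complex \<Rightarrow> real" where
  "sin_arg D w1 w2 z = (THE s. \<exists>f. conformal_map D upper_half_plane f \<and>
     filtermap f w1 = half_plane_zero \<and> filtermap f w2 = half_plane_infinity \<and>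
     s = sin (Arg (f z)))"

definition SLE_Green ::
  "real \<Rightarrow> complex set \<Rightarrow> complex filter \<Rightarrow> complex filter \<Rightarrow> complex \<Rightarrow> real" where
  "SLE_Green \<kappa> D w1 w2 z =
     Upsilon D z powr (sle_dim \<kappa> - 2) * sin_arg D w1 w2 z powr (4 * sle_a \<kappa> - 1)"

text \<open>
  The characterising property of the constant \<open>c\<close> in the one-point estimate, over all domains,
  points and SLE paths.  The type argument is the type of the sample spaces, over which
  a HOL formula cannot quantify.
\<close>

definition SLE_Green_constant :: "'a itself \<Rightarrow> real \<Rightarrow> real \<Rightarrow> bool" where
  "SLE_Green_constant _ \<kappa> c \<longleftrightarrow>
     0 < c \<and>
     (\<forall>D w1 w2 z (M :: 'a measure) \<Gamma>.
        simply_connected_domain D \<and> z \<in> D \<and>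
        w1 \<in> prime_ends D \<and> w2 \<in> prime_ends D \<and> w1 \<noteq> w2 \<and>
        chordal_SLE_trace \<kappa> D w1 w2 M \<Gamma> \<longrightarrow>
        (\<lambda>\<epsilon>. measure M {\<omega> \<in> space M. within_dist z (\<Gamma> \<omega>) \<epsilon>})
          \<sim>[at_right 0] (\<lambda>\<epsilon>. c * SLE_Green \<kappa> D w1 w2 z * \<epsilon> powr (2 - sle_dim \<kappa>)))"

definition Y_area ::
  "complex set \<Rightarrow> (real \<Rightarrow> real) \<Rightarrow> complex set \<Rightarrow> real \<Rightarrow> ennreal" where
  "Y_area D f S \<epsilon> =
     emeasure lborel {z \<in> D. f \<epsilon> \<le> infdist z (frontier D) \<and> within_dist z S \<epsilon>}"

end

theory Submission
  imports Defs
begin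

text \<open>
  By Fubini the expectation is the integral over \<open>D\<close> of the hitting probabilities, and the
  defining property of \<open>chat\<close> gives the pointwise limit of the rescaled integrand.  If the integral
  of the Green's function is infinite, Fatou's lemma suffices; otherwise one needs the uniform bound
  \<open>P(dist(z, \<gamma>) \<le> \<epsilon>) \<le> C G(z) \<epsilon>\<^sup>2\<^sup>-\<^sup>d\<close> for \<open>\<epsilon>\<close> small relative to \<open>dist(z, \<partial>D)\<close>.

  To obtain it, transport \<open>z\<close> to a point \<open>\<zeta>\<close> of the half-plane.  Along the centred Loewner flow \<open>Z\<close>
  of \<open>\<zeta>\<close> half the conformal radius of the slit domain is \<open>Im \<zeta> exp (-2a \<integral> \<rho>(Z))\<close> with
  \<open>\<rho>(Z) = (Im Z)\<^sup>2 / |Z|\<^sup>4\<close>, and a curve that comes close to \<open>\<zeta>\<close> makes it small by a Koebe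
  estimate.  In the clock \<open>\<integral> \<rho>\<close> the quantity \<open>s = sin\<^sup>2 (arg Z)\<close> is a diffusion that is killed at
  \<open>0\<close> and has the eigenfunction \<open>s\<^sup>m\<close>, \<open>2m = 4a - 1\<close>.  The probability that the clock reaches \<open>r\<close> is
  bounded by \<open>C exp (-m r) s\<^sup>m\<close> by means of a supermartingale that equals \<open>exp (-c r) s\<^sup>m\<close>, up to a
  constant, while the remaining time \<open>r\<close> is at least \<open>1\<close>, and \<open>exp (n r) (1 - exp (-s / r))\<^sup>m\<close>
  afterwards; the latter has initial value \<open>1\<close> on the whole interval \<open>0 < s \<le> 1\<close>.  No stochastic
  calculus is used: the supermartingale property is verified for the Euler scheme driven by Gaussian
  increments, which converges pathwise to the flow.
\<close>

section \<open>Loewner flow\<close>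

text \<open>The eigenfunction alone is not enough: \<open>s powr m\<close> is small near s = 0, so
  its expectation says little about paths whose clock runs out at a small angle. The second
  potential is a boundary layer of width comparable to the remaining time r, and it tends to 1 as r
  tends to 0 at every fixed s > 0. A further obstacle is the discretisation: an Euler step is
  controlled by compactness only where the generator is strictly negative, whereas
  \<open>exp (- m * r) * s powr m\<close> has generator 0. Hence a rate c < m with m - c at most 1 /
  r0, which costs a factor e. Compactness also confines the scheme to boxes, which exhaust the
  half-plane only after the mesh has been sent to 0.

  The exponents match because a drop of the conformal radius by a factor x takes clock time - ln x /
  (2a), and m / (2a) = 1 - \<kappa> / 8 = 2 - d, while \<open>s powr m\<close> is the power 4a - 1
  of the sine. The flow enters only through the uniform bound, so its constants need not be sharp;
  the constant of the limit comes from \<open>SLE_Green_constant\<close>. The condition r / f(r) ->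
  0 puts every point that counts into the range of the bound.\<close>

lemma linear_ode_solution:
  fixes y c :: "real \<Rightarrow> complex"
  assumes c: "continuous_on {0..t} c" and s: "s \<in> {0..t}"
    and y: "\<And>r. r \<in> {0..t} \<Longrightarrow> (y has_vector_derivative c r * y r) (at r within {0..t})"
  shows "y s = y 0 * exp (integral {0..s} c)"
proof -
  define I where "I r = integral {0..r} c" for r
  define e where "e r = y r * exp (- I r)" for r
  have "(e has_derivative (\<lambda>h. 0)) (at r within {0..t})" if r: "r \<in> {0..t}" for r
  proof -
    have "(I has_vector_derivative c r) (at r within {0..t})"
      unfolding I_def by (rule integral_has_vector_derivative[OF c r])
    then have "((\<lambda>r. - I r) has_vector_derivative - c r) (at r within {0..t})"
      by (rule has_vector_derivative_minus)
    then have "((exp \<circ> (\<lambda>r. - I r)) has_vector_derivative - c r * exp (- I r)) (at r within {0..t})"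
      by (rule field_vector_diff_chain_within) (auto intro: DERIV_exp DERIV_subset)
    then have "((\<lambda>r. exp (- I r)) has_vector_derivative - c r * exp (- I r)) (at r within {0..t})"
      by (simp add: o_def)
    from has_vector_derivative_mult[OF y[OF r] this]
    have "(e has_vector_derivative y r * (- c r * exp (- I r)) + c r * y r * exp (- I r)) (at r within {0..t})"
      unfolding e_def .
    then have "(e has_vector_derivative 0) (at r within {0..t})"
      by (simp add: algebra_simps)
    then show ?thesis
      by (simp add: has_vector_derivative_def)
  qed
  then obtain C where "\<And>r. r \<in> {0..t} \<Longrightarrow> e r = C"
    using has_derivative_zero_constant[of "{0..t}" e] by auto
  moreover have "0 \<in> {0..t}" using s by auto
  ultimately have "e s = e 0" using s by metis
  then show ?thesis
    by (simp add: e_def I_def exp_minus field_simps)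
qed

lemma loewner_solution_continuous:
  assumes "loewner_solution a u z t g"
  shows "continuous_on {0..t} g"
  using assms
  by (force simp: loewner_solution_def continuous_on_eq_continuous_within intro: has_vector_derivative_continuous)

lemma loewner_solution_subinterval:
  assumes "loewner_solution a u z t g" "s \<le> t"
  shows "loewner_solution a u z s g"
  using assms unfolding loewner_solution_def
  by (auto intro!: has_vector_derivative_within_subset[where S = "{0..t}" and T = "{0..s}"])

text \<open>The field is a reciprocal, so a difference of two solutions solves a linear equation
  exactly and not only to first order. The formula yields uniqueness, injectivity in the starting
  point and, as the two points merge, the spatial derivative.\<close>

lemma loewner_solution_diff:
  assumes g1: "loewner_solution a u z1 t g1" and g2: "loewner_solution a u z2 t g2"
    and u: "continuous_on {0..t} u" and s: "s \<in> {0..t}"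
  shows "g1 s - g2 s = (z1 - z2) * exp (integral {0..s} (\<lambda>r. - of_real a / ((g1 r - of_real (u r)) * (g2 r - of_real (u r)))))"
proof -
  let ?c = "\<lambda>r. - of_real a / ((g1 r - of_real (u r)) * (g2 r - of_real (u r)))"
  note g = g1[unfolded loewner_solution_def] g2[unfolded loewner_solution_def]
  note [continuous_intros] = loewner_solution_continuous[OF g1] loewner_solution_continuous[OF g2]
  have c: "continuous_on {0..t} ?c"
    using g u by (intro continuous_intros) auto
  have "((\<lambda>r. g1 r - g2 r) has_vector_derivative ?c r * (g1 r - g2 r)) (at r within {0..t})"
    if r: "r \<in> {0..t}" for r
  proof -
    have "((\<lambda>r. g1 r - g2 r) has_vector_derivative
        of_real a / (g1 r - of_real (u r)) - of_real a / (g2 r - of_real (u r))) (at r within {0..t})"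
      using g r by (intro has_vector_derivative_diff) auto
    moreover have "of_real a / (g1 r - of_real (u r)) - of_real a / (g2 r - of_real (u r)) = ?c r * (g1 r - g2 r)"
    proof -
      have "g1 r - of_real (u r) \<noteq> 0" "g2 r - of_real (u r) \<noteq> 0" using g r by auto
      then show ?thesis by (simp add: divide_simps) (simp add: algebra_simps)
    qed
    ultimately show ?thesis by simp
  qed
  from linear_ode_solution[OF c s this] show ?thesis using g by simp
qed

text \<open>Im (1 / w) = - Im w / |w|^2 for every complex w, and the driving function is real, so
  the imaginary part solves a linear equation by itself. It therefore stays positive, and it
  decreases when a > 0.\<close>

lemma Im_loewner_solution:
  assumes g: "loewner_solution a u z t g" and u: "continuous_on {0..t} u" and s: "s \<in> {0..t}"
  shows "Im (g s) = Im z * exp (- a * integral {0..s} (\<lambda>r. 1 / (cmod (g r - of_real (u r)))\<^sup>2))"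
proof -
  let ?c = "\<lambda>r. - a / (cmod (g r - of_real (u r)))\<^sup>2"
  note g' = g[unfolded loewner_solution_def]
  note [continuous_intros] = loewner_solution_continuous[OF g]
  have c: "continuous_on {0..t} ?c"
    using g' u by (intro continuous_intros) auto
  have c1: "continuous_on {0..t} (\<lambda>r. 1 / (cmod (g r - of_real (u r)))\<^sup>2)"
    using g' u by (intro continuous_intros) auto
  have "((\<lambda>r. complex_of_real (Im (g r))) has_vector_derivative of_real (?c r) * of_real (Im (g r))) (at r within {0..t})"
    if r: "r \<in> {0..t}" for r
  proof -
    have "((\<lambda>r. Im (g r)) has_vector_derivative Im (of_real a / (g r - of_real (u r)))) (at r within {0..t})"
      using g' r by (intro bounded_linear.has_vector_derivative[OF bounded_linear_Im]) auto
    moreover have "Im (of_real a / (g r - of_real (u r))) = ?c r * Im (g r)"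
      by (simp add: Im_divide cmod_power2)
    ultimately have "((\<lambda>r. Im (g r)) has_vector_derivative ?c r * Im (g r)) (at r within {0..t})"
      by simp
    from bounded_linear.has_vector_derivative[OF bounded_linear_of_real this]
    show ?thesis by (simp only: of_real_mult)
  qed
  from linear_ode_solution[OF continuous_on_of_real[OF c] s this]
  have "complex_of_real (Im (g s)) = of_real (Im z) * exp (integral {0..s} (\<lambda>r. of_real (?c r)))"
    using g' by simp
  also have "integral {0..s} (\<lambda>r. complex_of_real (?c r)) = of_real (integral {0..s} ?c)"
  proof -
    have "?c integrable_on {0..s}"
      by (rule integrable_continuous_real, rule continuous_on_subset[OF c]) (use s in auto)
    from integral_unique[OF has_integral_linear[OF integrable_integral[OF this] bounded_linear_of_real]]
    show ?thesis unfolding o_def .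
  qed
  also have "integral {0..s} ?c = - a * integral {0..s} (\<lambda>r. 1 / (cmod (g r - of_real (u r)))\<^sup>2)"
    by (subst integral_mult_right[symmetric]) simp
  finally show ?thesis
    by (metis Re_complex_of_real exp_of_real of_real_mult)
qed

lemma Im_loewner_solution_pos:
  assumes "loewner_solution a u z t g" "continuous_on {0..t} u" "s \<in> {0..t}" "0 < Im z"
  shows "0 < Im (g s)"
  using Im_loewner_solution[OF assms(1-3)] assms(4) by simp

lemma Im_loewner_solution_mono:
  assumes g: "loewner_solution a u z t g" and "continuous_on {0..t} u" "s \<in> {0..t}" "0 < Im z" "0 < a"
  shows "Im (g t) \<le> Im (g s)"
proof -
  have *: "continuous_on {0..t} (\<lambda>r. 1 / (cmod (g r - of_real (u r)))\<^sup>2)"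
    using g assms(2) loewner_solution_continuous[OF g]
    by (intro continuous_intros) (auto simp: loewner_solution_def)
  have "integral {0..s} (\<lambda>r. 1 / (cmod (g r - of_real (u r)))\<^sup>2) \<le> integral {0..t} (\<lambda>r. 1 / (cmod (g r - of_real (u r)))\<^sup>2)"
    using assms(3) * by (intro integral_subset_le integrable_continuous_real)
      (auto intro: continuous_on_subset)
  then show ?thesis
    using Im_loewner_solution[OF assms(1-3)] Im_loewner_solution[OF assms(1-2), of t] assms(3-5) 
    by (auto simp: mult_left_mono)
qed

section \<open>The Loewner equation run backwards\<close>

lemma inverse_lipschitz_upper_half_plane:
  fixes w z :: complex
  assumes "y \<le> Im w" "y \<le> Im z" "0 < y"
  shows "cmod (1 / w - 1 / z) \<le> cmod (w - z) / y\<^sup>2"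
proof -
  have "w \<noteq> 0" "z \<noteq> 0" using assms by auto
  then have "1 / w - 1 / z = (z - w) / (w * z)"
    by (simp add: divide_simps)
  then have "cmod (1 / w - 1 / z) = cmod (w - z) / (cmod w * cmod z)"
    by (simp add: norm_divide norm_mult norm_minus_commute)
  also have "\<dots> \<le> cmod (w - z) / (y * y)"
    using assms abs_Im_le_cmod[of w] abs_Im_le_cmod[of z]
    by (intro divide_left_mono mult_mono) (auto intro!: mult_pos_pos)
  finally show ?thesis by (simp add: power2_eq_square)
qed

text \<open>Backwards in time the field points upwards, so a trajectory that starts at w stays at
  height at least Im w. There the field is globally Lipschitz, and Picard iteration converges on the
  whole interval; no point is swallowed.\<close>

lemma loewner_solution_backward:
  assumes u: "continuous_on {0..t} u" and w: "0 < Im w" and a: "0 < a" and t: "0 \<le> t"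
  shows "\<exists>g. loewner_solution a u (g 0) t g \<and> g t = w \<and> 0 < Im (g 0)"
proof -
  define y where "y = Im w"
  define v where "v s = u (t - s)" for s
  have v: "continuous_on {0..t} v"
    unfolding v_def by (rule continuous_on_compose2[OF u]) (auto intro!: continuous_intros)
  define \<Phi> where "\<Phi> k s = - of_real a / (k s - of_real (v s))" for k :: "real \<Rightarrow> complex" and s
  define K where "K = rec_nat (\<lambda>s. w) (\<lambda>_ k s. w + integral {0..s} (\<Phi> k))"
  have K0: "K 0 = (\<lambda>s. w)" and KS: "K (Suc n) = (\<lambda>s. w + integral {0..s} (\<Phi> (K n)))" for n
    by (simp_all add: K_def)
  have cont: "continuous_on {0..t} (\<Phi> k)" if "continuous_on {0..t} k" "\<And>s. s \<in> {0..t} \<Longrightarrow> y \<le> Im (k s)" for k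
  proof -
    have "k s \<noteq> of_real (v s)" if "s \<in> {0..t}" for s
      using \<open>s \<in> {0..t} \<Longrightarrow> y \<le> Im (k s)\<close> that w by (auto simp: y_def)
    then show ?thesis unfolding \<Phi>_def using that v by (intro continuous_intros) auto
  qed
  have Im_int: "y \<le> Im (w + integral {0..s} (\<Phi> k))" if k: "continuous_on {0..t} k" "\<And>s. s \<in> {0..t} \<Longrightarrow> y \<le> Im (k s)" and s: "s \<in> {0..t}" for k s
  proof -
    have int: "\<Phi> k integrable_on {0..s}"
      using cont[OF k] s by (intro integrable_continuous_real) (auto intro: continuous_on_subset)
    have "Im (integral {0..s} (\<Phi> k)) = integral {0..s} (\<lambda>r. Im (\<Phi> k r))"
      using int integral_linear[OF int bounded_linear_Im] by (simp add: o_def)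
    also have "\<dots> \<ge> 0"
    proof (rule integral_nonneg)
      show "(\<lambda>r. Im (\<Phi> k r)) integrable_on {0..s}"
        using integrable_linear[OF int bounded_linear_Im] by (simp add: o_def)
      show "0 \<le> Im (\<Phi> k r)" if "r \<in> {0..s}" for r
        using k(2)[of r] that s a w by (auto simp: \<Phi>_def Im_divide y_def)
    qed
    finally show ?thesis by (simp add: y_def)
  qed
  have K: "continuous_on {0..t} (K n) \<and> (\<forall>s\<in>{0..t}. y \<le> Im (K n s))" for n
  proof (induction n)
    case 0 then show ?case by (simp add: K0 y_def)
  next
    case (Suc n)
    then have c: "continuous_on {0..t} (\<Phi> (K n))" by (intro cont) auto
    then have "continuous_on {0..t} (\<lambda>s. integral {0..s} (\<Phi> (K n)))"
      by (intro indefinite_integral_continuous_1 integrable_continuous_real)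
    then show ?case using Suc Im_int[of "K n"] by (auto simp: KS intro!: continuous_intros)
  qed
  define L where "L = a / y\<^sup>2"
  have L: "0 < L" using a w by (simp add: L_def y_def)
  have lip: "cmod (\<Phi> k s - \<Phi> k' s) \<le> L * cmod (k s - k' s)" if "y \<le> Im (k s)" "y \<le> Im (k' s)" for k k' s
  proof -
    have "\<Phi> k s - \<Phi> k' s = - of_real a * (1 / (k s - of_real (v s)) - 1 / (k' s - of_real (v s)))"
      by (simp add: \<Phi>_def algebra_simps)
    then have "cmod (\<Phi> k s - \<Phi> k' s) = a * cmod (1 / (k s - of_real (v s)) - 1 / (k' s - of_real (v s)))"
      using a by (simp only: norm_mult) simp
    also have "\<dots> \<le> a * (cmod ((k s - of_real (v s)) - (k' s - of_real (v s))) / y\<^sup>2)"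
      using that w a by (intro mult_left_mono inverse_lipschitz_upper_half_plane) (auto simp: y_def)
    finally show ?thesis by (simp add: L_def)
  qed
  have "continuous_on {0..t} (\<lambda>s. cmod (K 1 s - K 0 s))"
    using K[of 1] K[of 0] by (intro continuous_intros) auto
  then have "bounded ((\<lambda>s. cmod (K 1 s - K 0 s)) ` {0..t})"
    by (intro compact_imp_bounded compact_continuous_image) auto
  then obtain M where M: "\<And>s. s \<in> {0..t} \<Longrightarrow> cmod (K 1 s - K 0 s) \<le> M"
    unfolding bounded_iff by force
  \<comment> \<open>The usual factorial bound for Picard iterates; it makes the telescoping series
    converge uniformly, however long the interval is.\<close>
  have step: "cmod (K (Suc n) s - K n s) \<le> M * (L * s) ^ n / fact n" if "s \<in> {0..t}" for n s
    using that
  proof (induction n arbitrary: s)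
    case 0 then show ?case using M by simp
  next
    case (Suc n)
    have c: "continuous_on {0..t} (\<Phi> (K m))" for m using K by (intro cont) auto
    have i: "\<Phi> (K m) integrable_on {0..s}" for m
      using Suc.prems by (intro integrable_continuous_real continuous_on_subset[OF c]) auto
    have "K (Suc m) s = w + integral {0..s} (\<Phi> (K m))" for m
      by (subst KS) (rule refl)
    then have "K (Suc (Suc n)) s - K (Suc n) s = integral {0..s} (\<lambda>r. \<Phi> (K (Suc n)) r - \<Phi> (K n) r)"
      by (simp add: integral_diff[OF i i])
    also have "cmod \<dots> \<le> integral {0..s} (\<lambda>r. M * L ^ Suc n / fact n * r ^ n)"
    proof (rule integral_norm_bound_integral)
      show "(\<lambda>r. \<Phi> (K (Suc n)) r - \<Phi> (K n) r) integrable_on {0..s}" using i by (intro integrable_diff)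
      show "(\<lambda>r. M * L ^ Suc n / fact n * r ^ n) integrable_on {0..s}"
        by (intro integrable_continuous_real continuous_intros)
      fix r assume r: "r \<in> {0..s}"
      then have r': "r \<in> {0..t}" using Suc.prems by auto
      have "cmod (\<Phi> (K (Suc n)) r - \<Phi> (K n) r) \<le> L * cmod (K (Suc n) r - K n r)"
        using K r' by (intro lip) auto
      also have "\<dots> \<le> L * (M * (L * r) ^ n / fact n)"
        using Suc.IH[OF r'] L by (intro mult_left_mono) auto
      finally show "cmod (\<Phi> (K (Suc n)) r - \<Phi> (K n) r) \<le> M * L ^ Suc n / fact n * r ^ n"
        by (simp add: power_mult_distrib mult_ac)
    qed
    also have "\<dots> = M * L ^ Suc n / fact n * (s ^ Suc n / Suc n)"
    proof -
      have "((\<lambda>r. r ^ n) has_integral (s ^ Suc n / Suc n - 0 ^ Suc n / Suc n)) {0..s}"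
        by (rule fundamental_theorem_of_calculus)
          (use Suc.prems in \<open>auto simp flip: has_real_derivative_iff_has_vector_derivative intro!: derivative_eq_intros simp del: power_Suc\<close>)
      then show ?thesis by (subst integral_mult_right) (simp add: integral_unique)
    qed
    finally show ?case by (simp add: power_mult_distrib field_simps)
  qed
  have M0: "0 \<le> M" using order_trans[OF norm_ge_zero M[of 0]] t by simp
  have "uniform_limit {0..t} (\<lambda>n s. \<Sum>i<n. K (Suc i) s - K i s) (\<lambda>s. \<Sum>i. K (Suc i) s - K i s) sequentially"
  proof (rule Weierstrass_m_test)
    fix n s assume s: "s \<in> {0..t}"
    have "M * (L * s) ^ n / fact n \<le> M * (L * t) ^ n / fact n"
      using s L M0 by (intro divide_right_mono mult_left_mono power_mono) auto
    with step[OF s, of n] show "cmod (K (Suc n) s - K n s) \<le> M * (L * t) ^ n / fact n" by linarith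
  next
    have "summable (\<lambda>n. M * (inverse (fact n) * (L * t) ^ n))"
      by (intro summable_mult summable_exp)
    then show "summable (\<lambda>n. M * (L * t) ^ n / fact n)" by (simp add: field_simps)
  qed
  then have "uniform_limit {0..t} (\<lambda>n s. w + (\<Sum>i<n. K (Suc i) s - K i s)) (\<lambda>s. w + (\<Sum>i. K (Suc i) s - K i s)) sequentially"
    by (intro uniform_limit_add uniform_limit_const)
  moreover have "w + (\<Sum>i<n. K (Suc i) s - K i s) = K n s" for n s
    by (subst sum_lessThan_telescope) (simp add: K0)
  ultimately obtain k where lim: "uniform_limit {0..t} K k sequentially" by (auto simp: fun_eq_iff)
  have kc: "continuous_on {0..t} k"
    by (rule uniform_limit_theorem[OF _ lim]) (use K in auto)
  have kl: "(\<lambda>n. K n s) \<longlonglongrightarrow> k s" if "s \<in> {0..t}" for s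
    using tendsto_uniform_limitI[OF lim that] .
  have kIm: "y \<le> Im (k s)" if "s \<in> {0..t}" for s
    using tendsto_lowerbound[OF tendsto_Im[OF kl[OF that]], of y] K that by auto
  have fix_k: "k s = w + integral {0..s} (\<Phi> k)" if s: "s \<in> {0..t}" for s
  proof -
    have "(\<lambda>n. K (Suc n) s) \<longlonglongrightarrow> w + integral {0..s} (\<Phi> k)"
    proof (rule tendstoI)
      fix e :: real assume e: "0 < e"
      define d where "d = e / (L * t + 1)"
      have d: "0 < d" using e L t by (simp add: d_def add_nonneg_pos)
      from uniform_limitD[OF lim d] show "\<forall>\<^sub>F n in sequentially. dist (K (Suc n) s) (w + integral {0..s} (\<Phi> k)) < e"
      proof eventually_elim
        case (elim n)
        have i: "\<Phi> (K n) integrable_on {0..s}" "\<Phi> k integrable_on {0..s}"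
          using cont[of "K n"] cont[OF kc kIm] K s by (auto intro!: integrable_continuous_real intro: continuous_on_subset)
        have "dist (K (Suc n) s) (w + integral {0..s} (\<Phi> k)) = cmod (integral {0..s} (\<lambda>r. \<Phi> (K n) r - \<Phi> k r))"
          using i by (simp add: KS dist_norm integral_diff)
        also have "\<dots> \<le> integral {0..s} (\<lambda>r. L * d)"
        proof (rule integral_norm_bound_integral)
          fix r assume "r \<in> {0..s}"
          then have r: "r \<in> {0..t}" using s by auto
          then have "cmod (\<Phi> (K n) r - \<Phi> k r) \<le> L * cmod (K n r - k r)"
            using K kIm by (intro lip) auto
          also have "\<dots> \<le> L * d" using elim r L by (intro mult_left_mono) (auto simp: dist_norm less_imp_le)
          finally show "cmod (\<Phi> (K n) r - \<Phi> k r) \<le> L * d" .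
        qed (use i in \<open>auto intro: integrable_diff\<close>)
        also have "\<dots> = L * s * d" using s by simp
        also have "\<dots> \<le> L * t * d" using s L d by (intro mult_right_mono mult_left_mono) auto
        also have "\<dots> < (L * t + 1) * d" using d by (simp add: algebra_simps)
        also have "\<dots> = e" using L t by (simp add: d_def add_nonneg_eq_0_iff)
        finally show ?case .
      qed
    qed
    moreover have "(\<lambda>n. K (Suc n) s) \<longlonglongrightarrow> k s" using kl[OF s] by (rule LIMSEQ_Suc)
    ultimately show ?thesis using LIMSEQ_unique by blast
  qed
  have kd: "(k has_vector_derivative \<Phi> k s) (at s within {0..t})" if s: "s \<in> {0..t}" for s
  proof -
    have "((\<lambda>s. w + integral {0..s} (\<Phi> k)) has_vector_derivative 0 + \<Phi> k s) (at s within {0..t})"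
      using cont[OF kc kIm] s by (intro has_vector_derivative_add has_vector_derivative_const integral_has_vector_derivative)
    then show ?thesis
      using has_vector_derivative_transform[OF s fix_k] by simp
  qed
  define g where "g s = k (t - s)" for s
  have "(g has_vector_derivative of_real a / (g s - of_real (u s))) (at s within {0..t})" if s: "s \<in> {0..t}" for s
  proof -
    have im: "(\<lambda>s. t - s) ` {0..t} = {0..t}" by force
    have "((\<lambda>s. t - s) has_vector_derivative -1) (at s within {0..t})"
      by (auto intro!: derivative_eq_intros)
    moreover have "(k has_vector_derivative \<Phi> k (t - s)) (at (t - s) within (\<lambda>s. t - s) ` {0..t})"
      using kd[of "t - s"] s im by simp
    ultimately have "((k \<circ> (\<lambda>s. t - s)) has_vector_derivative -1 *\<^sub>R \<Phi> k (t - s)) (at s within {0..t})"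
      by (rule vector_diff_chain_within)
    then show ?thesis using s by (simp add: g_def[abs_def] o_def \<Phi>_def v_def)
  qed
  moreover have "g s \<noteq> of_real (u s)" if "s \<in> {0..t}" for s
    using kIm[of "t - s"] that w by (auto simp: g_def y_def)
  moreover have "g t = w" using fix_k[of 0] t by (simp add: g_def)
  moreover have "0 < Im (g 0)" using kIm[of t] t w by (simp add: g_def y_def)
  ultimately show ?thesis by (intro exI[of _ g]) (auto simp: loewner_solution_def)
qed

section \<open>Radial speed and the inverse Loewner map\<close>

definition radial_speed :: "complex \<Rightarrow> real" where
  "radial_speed z = (Im z)\<^sup>2 / cmod z ^ 4"

lemma radial_speed_nonneg: "0 \<le> radial_speed z"
  by (simp add: radial_speed_def)

text \<open>The logarithm of the derivative of the inverse map is a times the integral of Re (1 /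
  Z^2), and the height loses a times the integral of 1 / |Z|^2. In height times derivative the terms
  1 / |Z|^2 cancel, and only the radial speed remains.\<close>

lemma Re_inverse_square: "Re (1 / z\<^sup>2) = 1 / (cmod z)\<^sup>2 - 2 * radial_speed z"
proof (cases "z = 0")
  case False
  then have n: "(Re z)\<^sup>2 + (Im z)\<^sup>2 \<noteq> 0" by (simp add: complex_eq_iff)
  have "1 / z\<^sup>2 = (cnj z)\<^sup>2 / of_real ((cmod z ^ 2)\<^sup>2)"
    by (subst complex_div_cnj) (simp add: norm_power)
  then have "Re (1 / z\<^sup>2) = Re ((cnj z)\<^sup>2) / (cmod z ^ 2)\<^sup>2"
    by (simp only: Re_divide_of_real)
  also have "Re ((cnj z)\<^sup>2) = (cmod z)\<^sup>2 - 2 * (Im z)\<^sup>2"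
    unfolding cmod_power2 by (simp add: power2_eq_square)
  finally show ?thesis
    using False by (simp add: radial_speed_def power_mult[symmetric] diff_divide_distrib power2_eq_square power4_eq_xxxx)
qed (simp add: radial_speed_def)

lemma norm_integral_exp_bound:
  fixes c :: "real \<Rightarrow> complex"
  assumes "continuous_on {0..s} c" "\<And>r. r \<in> {0..s} \<Longrightarrow> cmod (c r) \<le> B" "0 \<le> s"
  shows "cmod (exp (integral {0..s} c)) \<le> exp (s * B)"
proof -
  have "cmod (integral {0..s} c) \<le> integral {0..s} (\<lambda>_. B)"
    using assms by (intro integral_norm_bound_integral integrable_continuous_real) auto
  then have "Re (integral {0..s} c) \<le> s * B"
    using assms(3) complex_Re_le_cmod[of "integral {0..s} c"] by simp
  then show ?thesis by simp
qed

text \<open>The inverse map is built from the reversed flow, because that flow exists on the entire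
  half-plane. The domain of the forward flow is then simply its image, and conformality follows from
  the exact difference formula.\<close>

lemma loewner_inverse_map:
  assumes a: "0 < a" and t: "0 \<le> t" and u: "continuous_on {0..t} u"
  obtains h where "conformal_map upper_half_plane (loewner_domain a u t) h"
    and "\<And>z g. z \<in> upper_half_plane \<Longrightarrow> loewner_solution a u z t g \<Longrightarrow> h (g t) = z"
    and "\<And>z g. z \<in> upper_half_plane \<Longrightarrow> loewner_solution a u z t g \<Longrightarrow>
      Im (g t) * cmod (deriv h (g t))
        = Im z * exp (- 2 * a * integral {0..t} (\<lambda>s. radial_speed (g s - of_real (u s))))"
proof -
  \<comment> \<open>The trajectory that ends at w. The choice is harmless, since by the difference
    formula two trajectories with the same end point coincide.\<close>
  define G where "G w = (SOME g. loewner_solution a u (g 0) t g \<and> g t = w \<and> 0 < Im (g 0))" for w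
  define h where "h w = G w 0" for w
  have G: "loewner_solution a u (h w) t (G w)" "G w t = w" "0 < Im (h w)" if "0 < Im w" for w
    using someI_ex[OF loewner_solution_backward[OF u that a t]] unfolding h_def G_def by blast+
  have ImG: "Im w \<le> Im (G w s)" if "0 < Im w" "s \<in> {0..t}" for w s
    using Im_loewner_solution_mono[OF G(1)[OF that(1)] u that(2) G(3)[OF that(1)] a] G(2)[OF that(1)] by simp
  define c where "c w w' = (\<lambda>r. of_real a / ((G w' r - of_real (u r)) * (G w r - of_real (u r))))" for w w'
  define J where "J w w' s = integral {0..s} (c w w')" for w w' s
  have nz: "G w r - of_real (u r) \<noteq> 0" if "0 < Im w" "r \<in> {0..t}" for w r
    using G(1)[OF that(1)] that(2) by (auto simp: loewner_solution_def)
  have c_cont: "continuous_on {0..t} (c w w')" if "0 < Im w" "0 < Im w'" for w w'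
    unfolding c_def using nz that loewner_solution_continuous[OF G(1)] u
    by (intro continuous_intros) auto
  have diff: "G w' s - G w s = (h w' - h w) * exp (- J w w' s)"
    if "0 < Im w" "0 < Im w'" "s \<in> {0..t}" for w w' s
    using loewner_solution_diff[OF G(1)[OF that(2)] G(1)[OF that(1)] u that(3)]
    by (simp add: J_def c_def)
  \<comment> \<open>The difference quotient of \<open>h\<close> is exactly
    \<open>exp (J w w' t)\<close>, so differentiability reduces to continuity of J in w'.\<close>
  have diff0: "h w' - h w = (w' - w) * exp (J w w' t)" if "0 < Im w" "0 < Im w'" for w w'
    using diff[OF that, of t] t that G(2) by (simp add: exp_minus)
  have h_flow: "h (g t) = z" if z: "z \<in> upper_half_plane" and g: "loewner_solution a u z t g" for z g
  proof -
    have p: "0 < Im (g t)"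
      using Im_loewner_solution_pos[OF g u] t z by (simp add: upper_half_plane_def)
    from loewner_solution_diff[OF g G(1)[OF p] u, of t] t G(2)[OF p] show ?thesis by simp
  qed
  have deriv: "(h has_field_derivative exp (J w w t)) (at w)" if w: "0 < Im w" for w
  proof -
    define y where "y = Im w"
    define B where "B = 2 * a / y\<^sup>2"
    define C where "C = t * (2 * a * exp (2 * t * B) / y ^ 3)"
    have y: "0 < y" using w by (simp add: y_def)
    have B: "0 < B" using a y by (simp add: B_def)
    \<comment> \<open>Heights decrease towards the end point, so every trajectory that ends in this
      ball stays above y / 2. This gives bounds that are uniform in w'.\<close>
    have ball: "y / 2 < Im w'" if "w' \<in> ball w (y / 2)" for w'
      using that abs_Im_le_cmod[of "w - w'"] by (simp add: dist_norm y_def)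
    have bound: "cmod (J w w' t - J w w t) \<le> C * cmod (w' - w)" if w': "w' \<in> ball w (y / 2)" for w'
    proof -
      have p: "0 < Im w'" using ball[OF w'] y by simp
      have lower: "y / 2 \<le> cmod (G w' r - of_real (u r))" "y \<le> cmod (G w r - of_real (u r))"
        if "r \<in> {0..t}" for r
        using ImG[OF p that] ImG[OF w that] abs_Im_le_cmod[of "G w' r - of_real (u r)"]
          abs_Im_le_cmod[of "G w r - of_real (u r)"] ball[OF w'] by (auto simp: y_def)
      have cB: "cmod (c w w' r) \<le> B" if "r \<in> {0..t}" for r
      proof -
        have "cmod (c w w' r) \<le> a / (y / 2 * y)"
          unfolding c_def norm_divide norm_mult using lower[OF that] y a
          by (intro frac_le mult_mono) auto
        then show ?thesis by (simp add: B_def power2_eq_square mult.commute)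
      qed
      have expJ: "cmod (exp (J w w' s)) \<le> exp (t * B)" "cmod (exp (- J w w' s)) \<le> exp (t * B)" if s: "s \<in> {0..t}" for s
      proof -
        have cs: "continuous_on {0..s} (c w w')"
          by (rule continuous_on_subset[OF c_cont[OF w p]]) (use s in auto)
        have "cmod (exp (J w w' s)) \<le> exp (s * B)"
          unfolding J_def using s cs cB by (intro norm_integral_exp_bound) auto
        moreover have "cmod (exp (integral {0..s} (\<lambda>r. - c w w' r))) \<le> exp (s * B)"
          using s cs cB by (intro norm_integral_exp_bound) (auto intro!: continuous_intros)
        moreover have "exp (s * B) \<le> exp (t * B)" using s B by simp
        ultimately show "cmod (exp (J w w' s)) \<le> exp (t * B)" "cmod (exp (- J w w' s)) \<le> exp (t * B)"
          unfolding J_def by auto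
      qed
      have Gd: "cmod (G w' r - G w r) \<le> cmod (w' - w) * exp (2 * t * B)" if r: "r \<in> {0..t}" for r
      proof -
        have "cmod (G w' r - G w r) = cmod (w' - w) * (cmod (exp (J w w' t)) * cmod (exp (- J w w' r)))"
          unfolding diff[OF w p r] diff0[OF w p] by (simp add: norm_mult)
        also have "\<dots> \<le> cmod (w' - w) * (exp (t * B) * exp (t * B))"
          using expJ[OF r] expJ[of t] t by (intro mult_left_mono mult_mono) auto
        also have "exp (t * B) * exp (t * B) = exp (2 * t * B)" by (simp flip: exp_add)
        finally show ?thesis .
      qed
      have i: "c w w' integrable_on {0..t}" "c w w integrable_on {0..t}"
        using c_cont[OF w p] c_cont[OF w w] by (auto intro: integrable_continuous_real)
      then have "J w w' t - J w w t = integral {0..t} (\<lambda>r. c w w' r - c w w r)"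
        unfolding J_def by (simp add: integral_diff)
      also have "cmod \<dots> \<le> integral {0..t} (\<lambda>r. 2 * a * exp (2 * t * B) / y ^ 3 * cmod (w' - w))"
      proof (rule integral_norm_bound_integral)
        fix r assume r: "r \<in> {0..t}"
        let ?A = "G w' r - of_real (u r)" and ?B = "G w r - of_real (u r)"
        have "c w w' r - c w w r = of_real a * (G w r - G w' r) / (?A * (?B * ?B))"
          using nz[OF w r] nz[OF p r] unfolding c_def by (simp add: divide_simps) (simp add: algebra_simps)
        then have "cmod (c w w' r - c w w r) = a * cmod (G w' r - G w r) / (cmod ?A * (cmod ?B * cmod ?B))"
          using a by (simp add: norm_mult norm_divide norm_minus_commute)
        also have "\<dots> \<le> a * (cmod (w' - w) * exp (2 * t * B)) / (y / 2 * (y * y))"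
          using Gd[OF r] lower[OF r] y a by (intro frac_le mult_mono mult_nonneg_nonneg) auto
        finally show "cmod (c w w' r - c w w r) \<le> 2 * a * exp (2 * t * B) / y ^ 3 * cmod (w' - w)"
          by (simp add: power3_eq_cube field_simps)
      qed (use i in \<open>auto intro: integrable_diff\<close>)
      also have "\<dots> = C * cmod (w' - w)" using t by (simp add: C_def)
      finally show ?thesis .
    qed
    have near: "\<forall>\<^sub>F w' in at w. w' \<in> ball w (y / 2)"
      using y by (intro eventually_at_in_open') auto
    have "((\<lambda>w'. J w w' t - J w w t) \<longlongrightarrow> 0) (at w)"
    proof (rule Lim_null_comparison)
      show "\<forall>\<^sub>F w' in at w. cmod (J w w' t - J w w t) \<le> C * cmod (w' - w)"
        using near by eventually_elim (rule bound)
      show "((\<lambda>w'. C * cmod (w' - w)) \<longlongrightarrow> 0) (at w)"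
        by (auto intro!: tendsto_eq_intros)
    qed
    then have "((\<lambda>w'. exp (J w w' t)) \<longlongrightarrow> exp (J w w t)) (at w)"
      by (rule tendsto_exp[OF LIM_zero_cancel])
    moreover have "\<forall>\<^sub>F w' in at w. exp (J w w' t) = (h w' - h w) / (w' - w)"
      using near eventually_neq_at_within[of w]
    proof eventually_elim
      case (elim w')
      then show ?case using diff0[OF w, of w'] ball[of w'] y by simp
    qed
    ultimately show ?thesis
      unfolding has_field_derivative_iff by (rule Lim_transform_eventually)
  qed
  have conf: "conformal_map upper_half_plane (loewner_domain a u t) h"
    unfolding conformal_map_def
  proof
    show "h holomorphic_on upper_half_plane"
      using deriv by (auto simp: holomorphic_on_def field_differentiable_def upper_half_plane_def
        intro: has_field_derivative_at_within)
    show "bij_betw h upper_half_plane (loewner_domain a u t)"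
    proof (rule bij_betw_imageI)
      show "inj_on h upper_half_plane"
      proof (rule inj_onI)
        fix w w' assume "w \<in> upper_half_plane" "w' \<in> upper_half_plane" "h w = h w'"
        then show "w = w'" using diff0[of w w'] by (auto simp: upper_half_plane_def)
      qed
      show "h ` upper_half_plane = loewner_domain a u t"
      proof (intro equalityI subsetI)
        fix z assume "z \<in> h ` upper_half_plane"
        then show "z \<in> loewner_domain a u t"
          using G by (auto simp: upper_half_plane_def loewner_domain_def)
      next
        fix z assume "z \<in> loewner_domain a u t"
        then obtain g where z: "z \<in> upper_half_plane" and g: "loewner_solution a u z t g"
          by (auto simp: loewner_domain_def)
        have "g t \<in> upper_half_plane"
          using Im_loewner_solution_pos[OF g u] t z by (simp add: upper_half_plane_def)
        with h_flow[OF z g] show "z \<in> h ` upper_half_plane" by force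
      qed
    qed
  qed
  have "Im (g t) * cmod (deriv h (g t))
        = Im z * exp (- 2 * a * integral {0..t} (\<lambda>s. radial_speed (g s - of_real (u s))))"
    if z: "z \<in> upper_half_plane" and g: "loewner_solution a u z t g" for z g
  proof -
    let ?Z = "\<lambda>s. g s - of_real (u s)" and ?w = "g t"
    have p: "0 < Im ?w"
      using Im_loewner_solution_pos[OF g u] t z by (simp add: upper_half_plane_def)
    \<comment> \<open>The given solution and the chosen trajectory start at the same point, so their
      difference vanishes.\<close>
    have Gg: "G ?w s = g s" if "s \<in> {0..t}" for s
      using loewner_solution_diff[OF g G(1)[OF p] u that] h_flow[OF z g] by simp
    have nzg: "?Z s \<noteq> 0" if "s \<in> {0..t}" for s using nz[OF p that] Gg[OF that] by simp
    have cont: "continuous_on {0..t} (\<lambda>s. radial_speed (?Z s))" "continuous_on {0..t} (\<lambda>s. 1 / (cmod (?Z s))\<^sup>2)"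
      unfolding radial_speed_def using nzg loewner_solution_continuous[OF g] u
      by (auto intro!: continuous_intros)
    have ints: "(\<lambda>s. radial_speed (?Z s)) integrable_on {0..t}" "(\<lambda>s. 1 / (cmod (?Z s))\<^sup>2) integrable_on {0..t}"
      using cont by (auto intro: integrable_continuous_real)
    have "Re (J ?w ?w t) = integral {0..t} (\<lambda>s. Re (c ?w ?w s))"
      unfolding J_def using integral_linear[OF integrable_continuous_real[OF c_cont[OF p p]] bounded_linear_Re]
      by (simp add: o_def)
    also have "\<dots> = integral {0..t} (\<lambda>s. a * (1 / (cmod (?Z s))\<^sup>2) - 2 * a * radial_speed (?Z s))"
    proof (rule integral_cong)
      fix s assume s: "s \<in> {0..t}"
      have "c ?w ?w s = of_real a * (1 / (?Z s)\<^sup>2)"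
        using Gg[OF s] by (simp add: c_def power2_eq_square)
      moreover have "Re (of_real a * q) = a * Re q" for q by simp
      ultimately have "Re (c ?w ?w s) = a * Re (1 / (?Z s)\<^sup>2)" by (simp only:)
      then show "Re (c ?w ?w s) = a * (1 / (cmod (?Z s))\<^sup>2) - 2 * a * radial_speed (?Z s)"
        unfolding Re_inverse_square by (simp add: algebra_simps)
    qed
    also have "\<dots> = a * integral {0..t} (\<lambda>s. 1 / (cmod (?Z s))\<^sup>2) - 2 * a * integral {0..t} (\<lambda>s. radial_speed (?Z s))"
      by (intro integral_unique has_integral_diff has_integral_mult_right integrable_integral ints)
    finally have Re: "Re (J ?w ?w t) = \<dots>" .
    have "cmod (deriv h ?w) = exp (Re (J ?w ?w t))"
      using DERIV_imp_deriv[OF deriv[OF p]] by simp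
    moreover have "Im ?w = Im z * exp (- a * integral {0..t} (\<lambda>s. 1 / (cmod (?Z s))\<^sup>2))"
      using Im_loewner_solution[OF g u] t by auto
    ultimately show ?thesis unfolding Re by (simp flip: exp_add)
  qed
  with conf h_flow show ?thesis using that by blast
qed

section \<open>Conformal radius and boundary behaviour\<close>

lemma open_upper_half_plane: "open upper_half_plane"
  by (simp add: upper_half_plane_def open_halfspace_Im_gt)

lemma conformal_map_mem: "conformal_map A D F \<Longrightarrow> z \<in> A \<Longrightarrow> F z \<in> D"
  by (auto simp: conformal_map_def bij_betw_def)

lemma conformal_map_obtain:
  assumes "conformal_map A D F" "w \<in> D" obtains z where "z \<in> A" "F z = w"
  using assms by (auto simp: conformal_map_def bij_betw_def)

lemma conformal_map_eq_iff:
  "conformal_map A D F \<Longrightarrow> z \<in> A \<Longrightarrow> w \<in> A \<Longrightarrow> F z = F w \<longleftrightarrow> z = w"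
  by (auto simp: conformal_map_def bij_betw_def inj_on_def)

lemma conformal_map_differentiable:
  "conformal_map A D F \<Longrightarrow> open A \<Longrightarrow> z \<in> A \<Longrightarrow> F field_differentiable at z"
  by (auto simp: conformal_map_def holomorphic_on_imp_differentiable_at)

lemma conformal_map_compose:
  "conformal_map A B F \<Longrightarrow> conformal_map B C G \<Longrightarrow> conformal_map A C (G \<circ> F)"
  unfolding conformal_map_def
  using bij_betw_trans[of F A B G C] by (auto intro: holomorphic_on_compose_gen dest: bij_betw_imp_surj_on)

lemma conformal_map_image_open:
  assumes "conformal_map A D F" "open A" shows "open D"
  using assms open_mapping_thm3[of F A] by (simp add: conformal_map_def bij_betw_def)

lemma inv_into_conformal:
  "conformal_map A D F \<Longrightarrow> z \<in> A \<Longrightarrow> inv_into A F (F z) = z"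
  by (auto simp: conformal_map_def bij_betw_def)

lemma conformal_map_inv_into:
  assumes F: "conformal_map A D F" and A: "open A"
  shows "conformal_map D A (inv_into A F)"
  unfolding conformal_map_def
proof
  have im: "F ` A = D" "inj_on F A" using F by (auto simp: conformal_map_def bij_betw_def)
  obtain g where g: "g holomorphic_on F ` A" "\<And>z. z \<in> A \<Longrightarrow> g (F z) = z"
    using holomorphic_has_inverse[of F A] F A im unfolding conformal_map_def by metis
  show "inv_into A F holomorphic_on D"
    using g(1) unfolding im(1)
    by (rule holomorphic_transform) (use g(2) im in \<open>auto simp: inv_into_f_f\<close>)
  show "bij_betw (inv_into A F) D A"
    using F by (simp add: conformal_map_def bij_betw_inv_into)
qed

text \<open>Schwarz's lemma for the inverse of G composed with F. Together with the same inequality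
  for exchanged roles it makes the definite description in \<open>Upsilon\<close> well
  defined.\<close>

lemma conformal_map_disk_deriv_le:
  assumes F: "conformal_map (ball 0 1) D F" and G: "conformal_map (ball 0 1) D G" and eq: "F 0 = G 0"
  shows "cmod (deriv F 0) \<le> cmod (deriv G 0)"
proof -
  define \<phi> where "\<phi> = inv_into (ball 0 1) G \<circ> F"
  have \<phi>: "conformal_map (ball 0 1) (ball 0 1) \<phi>"
    unfolding \<phi>_def by (rule conformal_map_compose[OF F conformal_map_inv_into[OF G]]) simp
  have \<phi>0: "\<phi> 0 = 0" using inv_into_conformal[OF G, of 0] by (simp add: \<phi>_def eq)
  have "cmod (deriv \<phi> 0) \<le> 1"
  proof (rule Schwarz_Lemma(2)[of \<phi> 0])
    show "\<phi> holomorphic_on ball 0 1" using \<phi> by (simp add: conformal_map_def)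
    show "cmod (\<phi> z) < 1" if "cmod z < 1" for z
      using conformal_map_mem[OF \<phi>, of z] that by simp
  qed (use \<phi>0 in auto)
  moreover have "deriv F 0 = deriv G 0 * deriv \<phi> 0"
  proof -
    have "deriv (G \<circ> \<phi>) 0 = deriv G (\<phi> 0) * deriv \<phi> 0"
      using conformal_map_differentiable[OF \<phi>] conformal_map_differentiable[OF G] \<phi>0
      by (intro deriv_chain) auto
    moreover have "deriv (G \<circ> \<phi>) 0 = deriv F 0"
    proof (rule deriv_cong_ev)
      have "eventually (\<lambda>z. z \<in> ball 0 1) (nhds (0::complex))"
        by (rule eventually_nhds_in_open) auto
      then show "\<forall>\<^sub>F z in nhds 0. (G \<circ> \<phi>) z = F z"
      proof eventually_elim
        case (elim z)
        have "F z \<in> G ` ball 0 1"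
          using conformal_map_mem[OF F elim] G by (simp add: conformal_map_def bij_betw_def)
        then show ?case by (simp add: \<phi>_def f_inv_into_f)
      qed
    qed simp
    ultimately show ?thesis using \<phi>0 by simp
  qed
  ultimately show ?thesis
    using mult_left_mono[of "cmod (deriv \<phi> 0)" 1 "cmod (deriv G 0)"] by (simp add: norm_mult)
qed

lemma conformal_map_disk_deriv_eq:
  assumes "conformal_map (ball 0 1) D F" "conformal_map (ball 0 1) D G" "F 0 = G 0"
  shows "cmod (deriv F 0) = cmod (deriv G 0)"
  using conformal_map_disk_deriv_le[of D F G] conformal_map_disk_deriv_le[of D G F] assms by simp

lemma Upsilon_eqI:
  assumes "conformal_map (ball 0 1) D F" "F 0 = z"
  shows "Upsilon D z = cmod (deriv F 0) / 2"
  unfolding Upsilon_def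
proof (rule the_equality)
  fix r assume "\<exists>F. conformal_map (ball 0 1) D F \<and> F 0 = z \<and> cmod (deriv F 0) = 2 * r"
  then show "r = cmod (deriv F 0) / 2"
    using conformal_map_disk_deriv_eq[OF assms(1)] assms(2) by force
qed (use assms in \<open>auto intro!: exI[of _ F]\<close>)

text \<open>A Cayley transform normalised by 0 -> w and 1 -> infinity. Since the boundary point 1
  does not depend on w, a rotation between two such coordinates can be read off at infinity.\<close>

definition disk_to_half_plane :: "complex \<Rightarrow> complex \<Rightarrow> complex" where
  "disk_to_half_plane w \<eta> = (w - cnj w * \<eta>) / (1 - \<eta>)"

definition half_plane_to_disk :: "complex \<Rightarrow> complex \<Rightarrow> complex" where
  "half_plane_to_disk w z = (z - w) / (z - cnj w)"

lemma half_plane_to_disk_norm: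
  assumes "0 < Im w" "0 < Im z" shows "cmod (half_plane_to_disk w z) < 1"
proof -
  have "(cmod (z - w))\<^sup>2 < (cmod (z - cnj w))\<^sup>2"
    using mult_pos_pos[OF assms] unfolding cmod_power2 by (simp add: power2_eq_square algebra_simps)
  then have "cmod (z - w) < cmod (z - cnj w)" by (rule power_less_imp_less_base) simp
  then show ?thesis by (simp add: half_plane_to_disk_def norm_divide divide_less_eq)
qed

lemma Im_disk_to_half_plane:
  assumes "0 < Im w" "cmod \<eta> < 1" shows "0 < Im (disk_to_half_plane w \<eta>)"
proof -
  have "\<eta> \<noteq> 1" using assms(2) by force
  have "Im ((w - cnj w * \<eta>) * cnj (1 - \<eta>)) = Im w * (1 - (cmod \<eta>)\<^sup>2)"
    unfolding cmod_power2 by (simp add: power2_eq_square algebra_simps)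
  moreover have "(cmod \<eta>)\<^sup>2 < 1" using assms by (simp add: power_less_one_iff)
  ultimately have "0 < Im ((w - cnj w * \<eta>) * cnj (1 - \<eta>))" using assms by simp
  then show ?thesis
    unfolding disk_to_half_plane_def
    using \<open>\<eta> \<noteq> 1\<close> by (subst complex_div_cnj) (simp add: zero_less_divide_iff flip: of_real_power)
qed

lemma disk_to_half_plane_inverse:
  assumes "0 < Im w" "cmod \<eta> < 1"
  shows "half_plane_to_disk w (disk_to_half_plane w \<eta>) = \<eta>"
proof -
  have "\<eta> \<noteq> 1" using assms(2) by force
  moreover have "w \<noteq> cnj w" using assms by (auto simp: complex_eq_iff)
  ultimately have n: "\<eta> \<noteq> 1" "w \<noteq> cnj w" by auto
  have "disk_to_half_plane w \<eta> - w = (w - cnj w) * \<eta> / (1 - \<eta>)"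
    "disk_to_half_plane w \<eta> - cnj w = (w - cnj w) / (1 - \<eta>)"
    using n by (simp_all add: disk_to_half_plane_def divide_simps) (simp_all add: algebra_simps)
  then show ?thesis using n by (simp add: half_plane_to_disk_def)
qed

lemma half_plane_to_disk_inverse:
  assumes "0 < Im w" "0 < Im z"
  shows "disk_to_half_plane w (half_plane_to_disk w z) = z"
proof -
  have n: "z \<noteq> cnj w" "w \<noteq> cnj w" using assms by (auto simp: complex_eq_iff)
  have 1: "w - cnj w * half_plane_to_disk w z = (w - cnj w) * z / (z - cnj w)"
    and 2: "1 - half_plane_to_disk w z = (w - cnj w) / (z - cnj w)"
    using n by (simp_all add: half_plane_to_disk_def divide_simps) (simp_all add: algebra_simps)
  then show ?thesis unfolding disk_to_half_plane_def 1 2 using n by simp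
qed

lemma conformal_map_disk_to_half_plane:
  assumes "0 < Im w"
  shows "conformal_map (ball 0 1) upper_half_plane (disk_to_half_plane w)"
  unfolding conformal_map_def
proof
  show "disk_to_half_plane w holomorphic_on ball 0 1"
    unfolding disk_to_half_plane_def by (intro holomorphic_intros) auto
  show "bij_betw (disk_to_half_plane w) (ball 0 1) upper_half_plane"
    by (rule bij_betw_byWitness[where f' = "half_plane_to_disk w"])
      (use assms half_plane_to_disk_norm Im_disk_to_half_plane disk_to_half_plane_inverse half_plane_to_disk_inverse
        in \<open>auto simp: upper_half_plane_def\<close>)
qed

lemma conformal_map_half_plane_to_disk:
  assumes "0 < Im w"
  shows "conformal_map upper_half_plane (ball 0 1) (half_plane_to_disk w)"
  unfolding conformal_map_def
proof
  show "half_plane_to_disk w holomorphic_on upper_half_plane"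
    unfolding half_plane_to_disk_def using assms
    by (intro holomorphic_intros) (auto simp: upper_half_plane_def complex_eq_iff)
  show "bij_betw (half_plane_to_disk w) upper_half_plane (ball 0 1)"
    by (rule bij_betw_byWitness[where f' = "disk_to_half_plane w"])
      (use assms half_plane_to_disk_norm Im_disk_to_half_plane disk_to_half_plane_inverse half_plane_to_disk_inverse
        in \<open>auto simp: upper_half_plane_def\<close>)
qed

lemma disk_to_half_plane_0: "disk_to_half_plane w 0 = w"
  by (simp add: disk_to_half_plane_def)

lemma deriv_disk_to_half_plane: "deriv (disk_to_half_plane w) 0 = w - cnj w"
proof -
  have "((\<lambda>\<eta>. (w - cnj w * \<eta>) / (1 - \<eta>)) has_field_derivative w - cnj w) (at 0)"
    by (auto intro!: derivative_eq_intros)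
  then show ?thesis unfolding disk_to_half_plane_def[abs_def] by (rule DERIV_imp_deriv)
qed

text \<open>The Cayley transform at w has derivative of modulus 2 Im w at 0; the factor 2 cancels
  against the half in the definition of \<open>Upsilon\<close>.\<close>

lemma Upsilon_half_plane:
  assumes h: "conformal_map upper_half_plane D h" and w: "w \<in> upper_half_plane"
  shows "Upsilon D (h w) = Im w * cmod (deriv h w)"
proof -
  have w': "0 < Im w" using w by (simp add: upper_half_plane_def)
  note c = conformal_map_disk_to_half_plane[OF w']
  have "deriv (h \<circ> disk_to_half_plane w) 0 = deriv h w * (w - cnj w)"
    using conformal_map_differentiable[OF c, of 0] conformal_map_differentiable[OF h open_upper_half_plane w]
    by (subst deriv_chain) (auto simp: deriv_disk_to_half_plane disk_to_half_plane_0)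
  moreover have "w - cnj w = of_real (2 * Im w) * \<i>" by (simp add: complex_eq_iff)
  ultimately have "cmod (deriv (h \<circ> disk_to_half_plane w) 0) = 2 * Im w * cmod (deriv h w)"
    using w' by (simp add: norm_mult)
  then show ?thesis
    using Upsilon_eqI[OF conformal_map_compose[OF c h]] by (simp add: disk_to_half_plane_0)
qed

text \<open>The logarithm of \<open>F - p\<close> is univalent and its image contains no two points that differ by
  \<open>2\<pi>\<i>\<close>, so Bloch's theorem bounds its derivative.\<close>

lemma conformal_map_disk_deriv_bound:
  assumes F: "conformal_map (ball 0 1) D F" and p: "p \<notin> D"
  shows "cmod (deriv F 0) \<le> 48 * cmod (F 0 - p)"
proof -
  have nz: "F z - p \<noteq> 0" if "z \<in> ball 0 1" for z
    using conformal_map_mem[OF F that] p by auto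
  have holF: "F holomorphic_on ball 0 1" using F by (simp add: conformal_map_def)
  obtain g where g: "g holomorphic_on ball 0 1" "\<And>z. z \<in> ball 0 1 \<Longrightarrow> exp (g z) = F z - p"
  proof (rule holomorphic_logarithm_exists[of "ball 0 1" "\<lambda>z. F z - p" 0])
    show "(\<lambda>z. F z - p) holomorphic_on ball 0 1" using holF by (intro holomorphic_intros)
  qed (use nz in auto)
  have gd: "(g has_field_derivative deriv g 0) (at 0)"
    using holomorphic_derivI[OF g(1)] by auto
  have "((\<lambda>z. exp (g z) + p) has_field_derivative exp (g 0) * deriv g 0) (at 0)"
    by (auto intro!: derivative_eq_intros gd)
  moreover have "\<forall>\<^sub>F z in nhds 0. exp (g z) + p = F z"
    using eventually_nhds_in_open[of "ball 0 1" "0::complex"] by (auto elim!: eventually_mono simp: g(2))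
  ultimately have "(F has_field_derivative exp (g 0) * deriv g 0) (at 0)"
    using DERIV_cong_ev[of 0 0 "\<lambda>z. exp (g z) + p" F] by simp
  then have dF: "deriv F 0 = (F 0 - p) * deriv g 0"
    using DERIV_imp_deriv g(2) by simp
  \<comment> \<open>Bloch's theorem provides a disk of radius |g'(0)| / 12 in the image, and a disk
    of radius 4 > pi contains two points that differ by 2 pi i.\<close>
  have "cmod (deriv g 0) / 12 \<le> 4"
  proof (rule ccontr)
    assume "\<not> ?thesis"
    then have "4 \<le> 1 * norm (deriv g 0) / 12" by simp
    with Bloch[OF g(1) zero_less_one this] obtain b where b: "ball b 4 \<subseteq> g ` ball 0 1" by auto
    have "b + of_real pi * \<i> \<in> ball b 4" "b - of_real pi * \<i> \<in> ball b 4"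
      using pi_less_4 by (auto simp: dist_norm norm_mult)
    then have "b + of_real pi * \<i> \<in> g ` ball 0 1" "b - of_real pi * \<i> \<in> g ` ball 0 1"
      using b by blast+
    then obtain z z' where z: "z \<in> ball 0 1" "z' \<in> ball 0 1" and "b + of_real pi * \<i> = g z" "b - of_real pi * \<i> = g z'"
      by (elim imageE)
    then have gz: "g z = g z' + of_real (2 * pi) * \<i>" by (simp flip: \<open>b + of_real pi * \<i> = g z\<close> \<open>b - of_real pi * \<i> = g z'\<close>)
    then have "exp (g z) = exp (g z')" by (simp add: exp_add exp_two_pi_i')
    then have "z = z'" using g(2) z conformal_map_eq_iff[OF F] by simp
    with gz show False by simp
  qed
  then show ?thesis
    unfolding dF norm_mult using mult_left_mono[of "cmod (deriv g 0)" 48 "cmod (F 0 - p)"] by (simp add: mult.commute)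
qed

lemma Upsilon_le_dist:
  assumes h: "conformal_map upper_half_plane D h" and z: "z \<in> D" and p: "p \<notin> D"
  shows "Upsilon D z \<le> 24 * cmod (z - p)"
proof -
  obtain w where w: "w \<in> upper_half_plane" "h w = z" using h z by (rule conformal_map_obtain)
  have c: "conformal_map (ball 0 1) D (h \<circ> disk_to_half_plane w)"
    using w by (intro conformal_map_compose[OF conformal_map_disk_to_half_plane h]) (simp add: upper_half_plane_def)
  show ?thesis
    using Upsilon_eqI[OF c] conformal_map_disk_deriv_bound[OF c p] w by (simp add: disk_to_half_plane_0)
qed

lemma Upsilon_pos:
  assumes h: "conformal_map upper_half_plane D h" and z: "z \<in> D"
  shows "0 < Upsilon D z"
proof -
  obtain w where w: "w \<in> upper_half_plane" "h w = z" using h z by (rule conformal_map_obtain)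
  have "deriv h w \<noteq> 0"
    using holomorphic_injective_imp_regular[of h upper_half_plane w] h w open_upper_half_plane
    by (auto simp: conformal_map_def bij_betw_def)
  then show ?thesis using Upsilon_half_plane[OF h w(1)] w by (simp add: upper_half_plane_def)
qed

section \<open>Invariance of the angle under the choice of the uniformising map\<close>

lemma half_plane_filters_nontrivial: "half_plane_zero \<noteq> bot" "half_plane_infinity \<noteq> bot"
proof -
  show "half_plane_zero \<noteq> bot"
    unfolding half_plane_zero_def trivial_limit_within islimpt_approachable
  proof (clarsimp)
    fix e :: real assume "0 < e"
    then show "\<exists>z\<in>upper_half_plane. z \<noteq> 0 \<and> cmod z < e"
      by (intro bexI[of _ "of_real (e / 2) * \<i>"]) (auto simp: upper_half_plane_def norm_mult)
  qed
  show "half_plane_infinity \<noteq> bot"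
    unfolding half_plane_infinity_def trivial_limit_def eventually_inf_principal eventually_at_infinity
  proof (clarsimp)
    fix b :: real
    show "\<exists>x. b \<le> cmod x \<and> x \<in> upper_half_plane"
      by (intro exI[of _ "of_real (\<bar>b\<bar> + 1) * \<i>"]) (auto simp: upper_half_plane_def norm_mult)
  qed
qed

text \<open>In Cayley coordinates the map is an automorphism of the disk that fixes the centre,
  hence a rotation. Both coordinates tend to 1 at infinity, so the rotation is trivial and the map
  is affine; fixing the filter at 0 removes the translation.\<close>

lemma half_plane_automorphism:
  assumes \<psi>: "conformal_map upper_half_plane upper_half_plane \<psi>"
    and zero: "filtermap \<psi> half_plane_zero = half_plane_zero"
    and inf: "filtermap \<psi> half_plane_infinity = half_plane_infinity"
  shows "\<exists>l>0. \<forall>z\<in>upper_half_plane. \<psi> z = of_real l * z"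
proof -
  let ?H = upper_half_plane
  define w where "w = \<psi> \<i>"
  have iH: "\<i> \<in> ?H" by (simp add: upper_half_plane_def)
  have w: "0 < Im w" using conformal_map_mem[OF \<psi> iH] by (simp add: w_def upper_half_plane_def)
  define \<theta> where "\<theta> = half_plane_to_disk w \<circ> \<psi> \<circ> disk_to_half_plane \<i>"
  have \<theta>: "conformal_map (ball 0 1) (ball 0 1) \<theta>"
    unfolding \<theta>_def
    by (intro conformal_map_compose[OF conformal_map_disk_to_half_plane] conformal_map_compose[OF \<psi>]
        conformal_map_half_plane_to_disk w) simp
  have \<theta>0: "\<theta> 0 = 0" by (simp add: \<theta>_def disk_to_half_plane_0 half_plane_to_disk_def w_def)
  have id: "conformal_map (ball 0 1) (ball 0 1) (\<lambda>z. z)" by (simp add: conformal_map_def bij_betw_def)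
  \<comment> \<open>The identity is another conformal map of the disk that fixes 0, so the
    derivatives agree in modulus and the equality case of Schwarz's lemma applies.\<close>
  have "cmod (deriv \<theta> 0) = 1"
    using conformal_map_disk_deriv_eq[OF \<theta> id] \<theta>0 by simp
  then obtain \<alpha> where \<alpha>: "\<And>\<eta>. cmod \<eta> < 1 \<Longrightarrow> \<theta> \<eta> = \<alpha> * \<eta>"
    using Schwarz_Lemma(3)[of \<theta> 0] \<theta> conformal_map_mem[OF \<theta>] \<theta>0 by (auto simp: conformal_map_def)
  have eq: "half_plane_to_disk w (\<psi> z) = \<alpha> * half_plane_to_disk \<i> z" if "z \<in> ?H" for z
    using \<alpha>[of "half_plane_to_disk \<i> z"] half_plane_to_disk_norm[of \<i> z] half_plane_to_disk_inverse[of \<i> z] that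
    by (simp add: \<theta>_def upper_half_plane_def)
  have lim: "(half_plane_to_disk v \<longlongrightarrow> 1) half_plane_infinity" for v
  proof -
    have at_inf: "filterlim (\<lambda>z. - cnj v + z) at_infinity at_infinity"
      by (rule tendsto_add_filterlim_at_infinity[OF tendsto_const filterlim_ident])
    have "((\<lambda>z. 1 - (v - cnj v) / (- cnj v + z)) \<longlongrightarrow> 1 - 0) at_infinity"
      by (intro tendsto_diff tendsto_const tendsto_divide_0[OF tendsto_const at_inf])
    moreover have "\<forall>\<^sub>F z in at_infinity. 1 - (v - cnj v) / (- cnj v + z) = half_plane_to_disk v z"
      using eventually_at_infinity_pos[THEN iffD2, of "\<lambda>z. z \<noteq> cnj v"]
    proof (rule eventually_mono)
      show "\<exists>p>0. \<forall>z. p \<le> cmod z \<longrightarrow> z \<noteq> cnj v"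
        by (intro exI[of _ "cmod v + 1"]) (auto simp: add_nonneg_pos)
      show "1 - (v - cnj v) / (- cnj v + z) = half_plane_to_disk v z" if "z \<noteq> cnj v" for z
        using that by (simp add: half_plane_to_disk_def divide_simps)
    qed
    ultimately have "(half_plane_to_disk v \<longlongrightarrow> 1 - 0) at_infinity"
      by (rule Lim_transform_eventually)
    then show ?thesis
      by (auto simp: half_plane_infinity_def intro: filterlim_mono inf_le1)
  qed
  have ev: "\<forall>\<^sub>F z in half_plane_infinity. z \<in> ?H" "\<forall>\<^sub>F z in half_plane_zero. z \<in> ?H"
    by (auto simp: half_plane_infinity_def half_plane_zero_def eventually_inf_principal eventually_at_filter)
  have "((\<lambda>z. half_plane_to_disk w (\<psi> z)) \<longlongrightarrow> 1) half_plane_infinity"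
    by (rule filterlim_compose[OF lim]) (simp add: filterlim_def inf)
  moreover have "((\<lambda>z. half_plane_to_disk w (\<psi> z)) \<longlongrightarrow> \<alpha> * 1) half_plane_infinity"
    by (rule Lim_transform_eventually[OF tendsto_mult[OF tendsto_const lim[of \<i>]]])
      (use ev(1) in eventually_elim, simp add: eq)
  ultimately have "\<alpha> = 1"
    using tendsto_unique[OF half_plane_filters_nontrivial(2)] by fastforce
  have lin: "\<psi> z = of_real (Im w) * z + of_real (Re w)" if z: "z \<in> ?H" for z
  proof -
    have "\<psi> z \<in> ?H" using conformal_map_mem[OF \<psi> z] .
    then have n: "\<psi> z - cnj w \<noteq> 0" "z + \<i> \<noteq> 0"
      using w z by (auto simp: complex_eq_iff upper_half_plane_def)
    have "(\<psi> z - w) * (z + \<i>) = (\<psi> z - cnj w) * (z - \<i>)"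
      using eq[OF z] n by (simp add: half_plane_to_disk_def \<open>\<alpha> = 1\<close> frac_eq_eq)
    then have "2 * \<i> * \<psi> z = (w - cnj w) * z + \<i> * (w + cnj w)"
      by (simp add: algebra_simps)
    also have "\<dots> = 2 * \<i> * (of_real (Im w) * z + of_real (Re w))"
      by (simp add: complex_diff_cnj complex_add_cnj algebra_simps)
    finally show ?thesis by simp
  qed
  have "(\<psi> \<longlongrightarrow> 0) half_plane_zero"
  proof -
    have "((\<lambda>z. z) \<longlongrightarrow> 0) half_plane_zero" by (simp add: half_plane_zero_def)
    then show ?thesis by (rule filterlim_compose) (simp add: filterlim_def zero)
  qed
  moreover have "(\<psi> \<longlongrightarrow> of_real (Im w) * 0 + of_real (Re w)) half_plane_zero"
    by (rule Lim_transform_eventually[where f = "\<lambda>z. of_real (Im w) * z + of_real (Re w)"])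
      (use ev(2) in \<open>auto simp: half_plane_zero_def lin elim!: eventually_mono intro!: tendsto_eq_intros\<close>)
  ultimately have "of_real (Im w) * 0 + of_real (Re w) = (0::complex)"
    using tendsto_unique[OF half_plane_filters_nontrivial(1)] by blast
  then have "Re w = 0" by simp
  with lin w show ?thesis by auto
qed

text \<open>Two uniformising maps that respect both prime ends differ by a positive dilation, which
  leaves arguments unchanged. So the definite description in \<open>sin_arg\<close> is determined
  and can be evaluated through the inverse of F.\<close>

lemma sin_arg_conformal:
  assumes F: "conformal_map upper_half_plane D F"
    and w1: "filtermap F half_plane_zero = w1" and w2: "filtermap F half_plane_infinity = w2"
    and z: "z \<in> upper_half_plane"
  shows "sin_arg D w1 w2 (F z) = sin (Arg z)"
  unfolding sin_arg_def
proof (rule the_equality)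
  let ?H = upper_half_plane
  let ?G = "inv_into ?H F"
  have ev: "\<forall>\<^sub>F z in half_plane_infinity. z \<in> ?H" "\<forall>\<^sub>F z in half_plane_zero. z \<in> ?H"
    by (auto simp: half_plane_infinity_def half_plane_zero_def eventually_inf_principal eventually_at_filter)
  have inv: "filtermap ?G (filtermap F L) = L" if "\<forall>\<^sub>F z in L. z \<in> ?H" for L
  proof -
    have "\<forall>\<^sub>F z in L. ?G (F z) = z"
      using that by eventually_elim (rule inv_into_conformal[OF F])
    then have "filtermap (\<lambda>z. ?G (F z)) L = filtermap (\<lambda>z. z) L"
      by (simp add: filter_eq_iff eventually_filtermap) (auto elim: eventually_elim2)
    then show ?thesis by (simp add: filtermap_filtermap filtermap_ident)
  qed
  show "\<exists>f. conformal_map D ?H f \<and> filtermap f w1 = half_plane_zero \<and>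
      filtermap f w2 = half_plane_infinity \<and> sin (Arg z) = sin (Arg (f (F z)))"
    using conformal_map_inv_into[OF F open_upper_half_plane] inv[OF ev(1)] inv[OF ev(2)] inv_into_conformal[OF F z] w1 w2
    by (intro exI[of _ ?G]) auto
  fix s assume "\<exists>f. conformal_map D ?H f \<and> filtermap f w1 = half_plane_zero \<and>
      filtermap f w2 = half_plane_infinity \<and> s = sin (Arg (f (F z)))"
  then obtain f where f: "conformal_map D ?H f" "filtermap f w1 = half_plane_zero"
    "filtermap f w2 = half_plane_infinity" "s = sin (Arg (f (F z)))" by blast
  have "filtermap (f \<circ> F) half_plane_zero = half_plane_zero" "filtermap (f \<circ> F) half_plane_infinity = half_plane_infinity"
    using f(2,3) w1 w2 by (auto simp: filtermap_filtermap o_def)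
  then obtain l where "l > 0" "f (F z) = of_real l * z"
    using half_plane_automorphism[OF conformal_map_compose[OF F f(1)]] z by auto
  then show "s = sin (Arg z)" using f(4) by simp
qed

text \<open>Schwarz's lemma, applied to the inverse of \<open>F\<close> on the disk of radius \<open>d\<close> about \<open>F z\<close>.\<close>

lemma conformal_map_preimage_close:
  assumes F: "conformal_map upper_half_plane D F"
    and z: "z \<in> upper_half_plane" and z': "z' \<in> upper_half_plane"
    and d: "ball (F z) d \<subseteq> D" and e: "cmod (F z' - F z) \<le> e" "2 * e \<le> d" "0 < d"
  shows "cmod (z' - z) \<le> 4 * (e / d) * Im z"
proof -
  have Im: "0 < Im z" "0 < Im z'" using z z' by (auto simp: upper_half_plane_def)
  note G = conformal_map_inv_into[OF F open_upper_half_plane]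
  define \<phi> where "\<phi> \<eta> = half_plane_to_disk z (inv_into upper_half_plane F (F z + of_real d * \<eta>))" for \<eta>
  have GC: "conformal_map D (ball 0 1) (half_plane_to_disk z \<circ> inv_into upper_half_plane F)"
    by (rule conformal_map_compose[OF G conformal_map_half_plane_to_disk[OF Im(1)]])
  have mem: "F z + of_real d * \<eta> \<in> D" if "cmod \<eta> < 1" for \<eta>
    using d e that by (intro subsetD[OF d]) (auto simp: dist_norm norm_mult)
  define \<eta> where "\<eta> = (F z' - F z) / of_real d"
  have n\<eta>: "cmod \<eta> \<le> e / d" using e by (simp add: \<eta>_def norm_divide divide_right_mono)
  have ed: "e / d \<le> 1 / 2" using e by (simp add: field_simps)
  have "cmod (\<phi> \<eta>) \<le> cmod \<eta>"
  proof (rule Schwarz_Lemma(1))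
    have "(half_plane_to_disk z \<circ> inv_into upper_half_plane F) \<circ> (\<lambda>\<eta>. F z + of_real d * \<eta>) holomorphic_on ball 0 1"
      by (rule holomorphic_on_compose_gen[where t = D])
        (use GC mem in \<open>auto simp: conformal_map_def intro!: holomorphic_intros\<close>)
    then show "\<phi> holomorphic_on ball 0 1" by (simp add: \<phi>_def[abs_def] o_def)
    show "\<phi> 0 = 0" by (simp add: \<phi>_def inv_into_conformal[OF F z] half_plane_to_disk_def)
    show "cmod (\<phi> z) < 1" if "cmod z < 1" for z
      using conformal_map_mem[OF GC mem[OF that]] by (simp add: \<phi>_def)
    show "cmod \<eta> < 1" using n\<eta> ed by linarith
  qed
  moreover have "\<phi> \<eta> = half_plane_to_disk z z'"
    using e by (simp add: \<phi>_def \<eta>_def inv_into_conformal[OF F z'])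
  ultimately have "cmod (half_plane_to_disk z z') \<le> e / d" using n\<eta> by simp
  moreover have "0 < cmod (z' - cnj z)" using Im by (auto simp: complex_eq_iff)
  ultimately have 1: "cmod (z' - z) \<le> e / d * cmod (z' - cnj z)"
    by (simp add: half_plane_to_disk_def norm_divide pos_divide_le_eq)
  have "cmod (z' - cnj z) \<le> cmod (z' - z) + 2 * Im z"
  proof -
    have eq: "z' - cnj z = (z' - z) + of_real (2 * Im z) * \<i>" by (simp add: complex_eq_iff)
    have "cmod (of_real (2 * Im z) * \<i>) = 2 * Im z" using Im by (simp add: norm_mult)
    then show ?thesis unfolding eq using norm_triangle_ineq[of "z' - z" "of_real (2 * Im z) * \<i>"] by linarith
  qed
  moreover have "0 \<le> e / d" using e norm_ge_zero[of "F z' - F z"] by (intro divide_nonneg_pos) linarith+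
  ultimately have "cmod (z' - z) \<le> e / d * cmod (z' - z) + e / d * (2 * Im z)"
    using 1 mult_left_mono[of "cmod (z' - cnj z)" "cmod (z' - z) + 2 * Im z" "e / d"] by (simp add: distrib_left)
  \<comment> \<open>As e / d is at most 1 / 2, the first term is absorbed into the left-hand side,
    which turns the factor 2 into 4.\<close>
  also have "\<dots> \<le> 1 / 2 * cmod (z' - z) + e / d * (2 * Im z)"
    using ed by (intro add_right_mono mult_right_mono) auto
  finally show ?thesis by (simp add: field_simps)
qed

text \<open>The inverse map is continuous on the open image, so only interior points contribute there.\<close>

lemma image_trace_inter_domain:
  assumes F: "conformal_map upper_half_plane D F" and w: "w \<in> D"
    and \<eta>: "\<And>t. 0 \<le> t \<Longrightarrow> \<eta> t \<in> closure upper_half_plane"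
  shows "w \<in> image_trace F \<eta> \<longleftrightarrow> (\<exists>t\<ge>0. \<eta> t \<in> upper_half_plane \<and> F (\<eta> t) = w)"
proof
  let ?H = upper_half_plane
  assume "w \<in> image_trace F \<eta>"
  then obtain t where t: "0 \<le> t" "(F \<longlongrightarrow> w) (at (\<eta> t) within ?H)" by (auto simp: image_trace_def)
  have nb: "at (\<eta> t) within ?H \<noteq> bot"
  proof (cases "\<eta> t \<in> ?H")
    case True show ?thesis unfolding at_within_open[OF True open_upper_half_plane] by simp
  next
    case False
    moreover have "\<eta> t \<in> closure ?H" using \<eta>[OF t(1)] .
    ultimately have "\<eta> t islimpt ?H" unfolding closure_def by blast
    then show ?thesis by (simp add: trivial_limit_within)
  qed
  have D: "open D" using conformal_map_image_open[OF F open_upper_half_plane] .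
  have "isCont (inv_into ?H F) w"
    using conformal_map_differentiable[OF conformal_map_inv_into[OF F open_upper_half_plane] D w]
    by (rule field_differentiable_imp_continuous_at)
  from isCont_tendsto_compose[OF this t(2)]
  have "((\<lambda>z. inv_into ?H F (F z)) \<longlongrightarrow> inv_into ?H F w) (at (\<eta> t) within ?H)" .
  moreover have "\<forall>\<^sub>F z in at (\<eta> t) within ?H. inv_into ?H F (F z) = z"
    by (auto simp: eventually_at_filter inv_into_conformal[OF F])
  ultimately have "((\<lambda>z. z) \<longlongrightarrow> inv_into ?H F w) (at (\<eta> t) within ?H)"
    by (rule Lim_transform_eventually)
  with nb have "inv_into ?H F w = \<eta> t" by (intro tendsto_unique[OF nb]) auto
  moreover have "inv_into ?H F w \<in> ?H" "F (inv_into ?H F w) = w"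
    using conformal_map_mem[OF conformal_map_inv_into[OF F open_upper_half_plane] w] w F
    by (auto simp: conformal_map_def bij_betw_def f_inv_into_f)
  ultimately show "\<exists>t\<ge>0. \<eta> t \<in> ?H \<and> F (\<eta> t) = w" using t(1) by auto
next
  assume "\<exists>t\<ge>0. \<eta> t \<in> upper_half_plane \<and> F (\<eta> t) = w"
  then obtain t where t: "0 \<le> t" "\<eta> t \<in> upper_half_plane" "F (\<eta> t) = w" by blast
  have "isCont F (\<eta> t)"
    using conformal_map_differentiable[OF F open_upper_half_plane t(2)]
    by (rule field_differentiable_imp_continuous_at)
  then have "(F \<longlongrightarrow> w) (at (\<eta> t) within upper_half_plane)"
    using t(3) by (auto simp: continuous_at intro: tendsto_within_subset)
  with t(1) show "w \<in> image_trace F \<eta>" by (auto simp: image_trace_def)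
qed

section \<open>Curves approaching a point of the half-plane\<close>

lemma radial_speed_continuous:
  assumes g: "loewner_solution a u z t g" and u: "continuous_on {0..t} u"
  shows "continuous_on {0..t} (\<lambda>s. radial_speed (g s - of_real (u s)))"
  unfolding radial_speed_def using g loewner_solution_continuous[OF g] u
  by (intro continuous_intros) (auto simp: loewner_solution_def)

lemma Upsilon_loewner_domain:
  assumes a: "0 < a" and t: "0 \<le> t" and u: "continuous_on {0..t} u"
    and z: "z \<in> upper_half_plane" and g: "loewner_solution a u z t g"
  shows "Upsilon (loewner_domain a u t) z
    = Im z * exp (- 2 * a * integral {0..t} (\<lambda>s. radial_speed (g s - of_real (u s))))"
proof -
  obtain h where h: "conformal_map upper_half_plane (loewner_domain a u t) h" "h (g t) = z"
    "Im (g t) * cmod (deriv h (g t)) = Im z * exp (- 2 * a * integral {0..t} (\<lambda>s. radial_speed (g s - of_real (u s))))"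
    using loewner_inverse_map[OF a t u] z g by metis
  have "g t \<in> upper_half_plane"
    using Im_loewner_solution_pos[OF g u] t z by (simp add: upper_half_plane_def)
  from Upsilon_half_plane[OF h(1) this] h(2,3) show ?thesis by simp
qed

lemma loewner_domain_antimono:
  "s \<le> t \<Longrightarrow> loewner_domain a u t \<subseteq> loewner_domain a u s"
  by (auto simp: loewner_domain_def intro: loewner_solution_subinterval)

text \<open>Half the conformal radius is strictly decreasing in time.\<close>

lemma loewner_domain_neq:
  assumes a: "0 < a" and st: "0 \<le> s" "s < t" and u: "continuous_on {0..t} u"
  shows "loewner_domain a u s \<noteq> loewner_domain a u t"
proof
  assume eq: "loewner_domain a u s = loewner_domain a u t"
  obtain h where h: "conformal_map upper_half_plane (loewner_domain a u t) h"
    using loewner_inverse_map[OF a _ u] st by fastforce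
  have "h \<i> \<in> loewner_domain a u t"
    using conformal_map_mem[OF h] by (simp add: upper_half_plane_def)
  then obtain g where z: "h \<i> \<in> upper_half_plane" and g: "loewner_solution a u (h \<i>) t g"
    by (auto simp: loewner_domain_def)
  define \<rho> where "\<rho> r = radial_speed (g r - of_real (u r))" for r
  have us: "continuous_on {0..s} u" using u st by (auto elim: continuous_on_subset)
  have c: "continuous_on {0..t} \<rho>" unfolding \<rho>_def[abs_def] by (rule radial_speed_continuous[OF g u])
  have "Im (h \<i>) * exp (- 2 * a * integral {0..s} \<rho>) = Im (h \<i>) * exp (- 2 * a * integral {0..t} \<rho>)"
    using Upsilon_loewner_domain[OF a _ u z g] Upsilon_loewner_domain[OF a _ us z loewner_solution_subinterval[OF g]]
      st eq by (auto simp: \<rho>_def[abs_def])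
  then have "integral {0..s} \<rho> = integral {0..t} \<rho>"
    using z a by (simp add: upper_half_plane_def)
  moreover have "integral {0..s} \<rho> + integral {s..t} \<rho> = integral {0..t} \<rho>"
    using st by (intro Henstock_Kurzweil_Integration.integral_combine integrable_continuous_real c) auto
  ultimately have "integral {s..t} \<rho> = 0" by simp
  moreover have "continuous_on {s..t} \<rho>" using c st by (auto elim: continuous_on_subset)
  moreover have "0 \<le> \<rho> r" for r by (simp add: \<rho>_def radial_speed_nonneg)
  ultimately have "\<rho> s = 0" using integral_eq_0_iff[of s t \<rho>] st by auto
  moreover have "0 < Im (g s)"
    using Im_loewner_solution_pos[OF g u] st z by (simp add: upper_half_plane_def)
  moreover have "g s \<noteq> of_real (u s)" using g st by (auto simp: loewner_solution_def)
  ultimately show False by (simp add: \<rho>_def radial_speed_def)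
qed

text \<open>If the disk about \<open>z\<close> were cut off before the curve first enters it, the unbounded component
  would stay the same while the curve moves in the component that was cut off, which is excluded by
  the strict monotonicity of the Loewner domains.\<close>

lemma curve_approach_loewner:
  assumes a: "0 < a" and u: "continuous_on {0..} u"
    and \<gamma>: "continuous_on {0..} \<gamma>" and \<gamma>0: "\<gamma> 0 = 0"
    and comp: "\<And>t. 0 \<le> t \<Longrightarrow> loewner_domain a u t \<in> components (upper_half_plane - \<gamma> ` {0<..t})"
    and z: "z \<in> upper_half_plane" and r: "0 < r" "r < Im z"
    and hit: "0 \<le> t0" "cmod (\<gamma> t0 - z) \<le> r"
  shows "\<exists>t\<ge>0. \<exists>g. loewner_solution a u z t g \<and>
    Im z * exp (- 2 * a * integral {0..t} (\<lambda>s. radial_speed (g s - of_real (u s)))) \<le> 48 * r"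
proof -
  let ?H = upper_half_plane and ?B = "cball z r"
  define Ht where "Ht t = loewner_domain a u t" for t
  have BH: "?B \<subseteq> ?H"
  proof
    fix w assume "w \<in> ?B"
    then show "w \<in> ?H" using abs_Im_le_cmod[of "z - w"] r by (auto simp: upper_half_plane_def dist_norm)
  qed
  have "\<exists>\<tau>\<in>{0..t0} \<inter> \<gamma> -` ?B. \<forall>s\<in>{0..t0} \<inter> \<gamma> -` ?B. \<tau> \<le> s"
  proof (rule compact_attains_inf)
    have "continuous_on {0..t0} \<gamma>" using \<gamma> by (auto elim: continuous_on_subset)
    then have "closed ({0..t0} \<inter> \<gamma> -` ?B)" by (intro continuous_closed_preimage) auto
    then show "compact ({0..t0} \<inter> \<gamma> -` ?B)"
      by (metis compact_Icc compact_Int_closed inf.left_idem)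
    show "{0..t0} \<inter> \<gamma> -` ?B \<noteq> {}" using hit by (auto simp: dist_norm norm_minus_commute)
  qed
  then obtain \<tau> where \<tau>: "0 \<le> \<tau>" "\<tau> \<le> t0" "\<gamma> \<tau> \<in> ?B" and first: "\<And>s. 0 \<le> s \<Longrightarrow> s < \<tau> \<Longrightarrow> \<gamma> s \<notin> ?B"
    by force
  have "0 \<notin> ?B" using BH unfolding upper_half_plane_def by (metis less_irrefl mem_Collect_eq subsetD zero_complex.sel(2))
  then have \<tau>0: "0 < \<tau>" using \<tau> \<gamma>0 by (cases "\<tau> = 0") auto
  have cont: "\<exists>d>0. \<forall>s\<ge>0. \<bar>s - \<tau>\<bar> < d \<longrightarrow> cmod (\<gamma> s - \<gamma> \<tau>) < e" if "0 < e" for e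
    using \<gamma> \<tau>(1) that by (force simp: continuous_on_iff dist_norm)
  show ?thesis
  proof (cases "\<forall>t. 0 \<le> t \<and> t < \<tau> \<longrightarrow> ?B \<subseteq> Ht t")
    case True
    obtain d where d: "0 < d" "\<And>s. 0 \<le> s \<Longrightarrow> \<bar>s - \<tau>\<bar> < d \<Longrightarrow> cmod (\<gamma> s - \<gamma> \<tau>) < r"
      using cont[OF r(1)] by blast
    \<comment> \<open>Shortly before the first visit the disk still lies in the Loewner domain,
      while the tip of the curve, at distance at most 2 r from z, does not; this gives 48 = 24 * 2.
      The time must be positive because only points of \<open>{0<..t}\<close> are removed.\<close>
    define t where "t = max (\<tau> / 2) (\<tau> - d / 2)"
    have t: "0 < t" "t < \<tau>" "\<bar>t - \<tau>\<bar> < d" using d \<tau>0 by (auto simp: t_def max_def)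
    have "cmod (\<gamma> t - \<gamma> \<tau>) < r" using d t by auto
    moreover have "cmod (\<gamma> \<tau> - z) \<le> r" using \<tau> by (simp add: dist_norm norm_minus_commute)
    ultimately have p: "cmod (z - \<gamma> t) \<le> 2 * r"
      using norm_triangle_ineq[of "\<gamma> t - \<gamma> \<tau>" "\<gamma> \<tau> - z"] by (simp add: norm_minus_commute)
    have "?B \<subseteq> Ht t" using True t(1,2) by simp
    moreover have "z \<in> ?B" using r by simp
    ultimately have zt: "z \<in> Ht t" by blast
    then obtain g where g: "loewner_solution a u z t g" by (auto simp: Ht_def loewner_domain_def)
    have "\<gamma> t \<notin> Ht t" using in_components_subset[OF comp[of t]] t by (auto simp: Ht_def)
    moreover have ut: "continuous_on {0..t} u" using u by (auto elim: continuous_on_subset)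
    moreover obtain h where "conformal_map ?H (Ht t) h"
      using loewner_inverse_map[OF a _ ut] t unfolding Ht_def by fastforce
    ultimately have "Upsilon (Ht t) z \<le> 24 * cmod (z - \<gamma> t)" using Upsilon_le_dist zt by blast
    then show ?thesis
      using Upsilon_loewner_domain[OF a _ ut z g] t p g unfolding Ht_def by (intro exI[of _ t] conjI exI[of _ g]) auto
  next
    case False
    then obtain t where t: "0 \<le> t" "t < \<tau>" and nB: "\<not> ?B \<subseteq> Ht t" by blast
    let ?U = "?H - \<gamma> ` {0<..t}"
    define V where "V = connected_component_set ?U z"
    have BU: "?B \<subseteq> ?U" using BH first t by fastforce
    then have BV: "?B \<subseteq> V" unfolding V_def using r by (intro connected_component_maximal) auto
    have "z \<in> ?B" using r by simp
    then have V: "V \<in> components ?U" unfolding V_def using BU by (intro componentsI) blast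
    have "Ht t \<inter> V = {}"
      using components_nonoverlap[OF comp[OF t(1)] V] nB BV by (auto simp: Ht_def)
    \<comment> \<open>Adding time 0 removes nothing, as the curve starts on the real line, and it
      makes the removed set compact and its complement open.\<close>
    have "?U = ?H - \<gamma> ` {0..t}"
    proof -
      have "{0..t} = insert 0 {0<..t}" using t by auto
      then show ?thesis using \<gamma>0 by (auto simp: upper_half_plane_def)
    qed
    moreover have "compact (\<gamma> ` {0..t})"
      using \<gamma> by (intro compact_continuous_image) (auto elim: continuous_on_subset)
    ultimately have "open ?U" using open_upper_half_plane by (simp add: compact_imp_closed open_Diff)
    then have "open V" using V open_components by blast
    moreover have "\<gamma> \<tau> \<in> V" using \<tau> BV by auto
    ultimately obtain e where e: "0 < e" "ball (\<gamma> \<tau>) e \<subseteq> V" using open_contains_ball by blast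
    obtain d where d: "0 < d" "\<And>s. 0 \<le> s \<Longrightarrow> \<bar>s - \<tau>\<bar> < d \<Longrightarrow> cmod (\<gamma> s - \<gamma> \<tau>) < e"
      using cont[OF e(1)] by blast
    define s where "s = max t (\<tau> - d / 2)"
    have s: "t \<le> s" "s < \<tau>" "0 \<le> s" using d t by (auto simp: s_def)
    have inV: "\<gamma> r \<in> V" if "s \<le> r" "r \<le> \<tau>" for r
    proof -
      have "\<bar>r - \<tau>\<bar> < d" using that d by (auto simp: s_def)
      then show ?thesis using d(2)[of r] that s e by (auto simp: dist_norm norm_minus_commute)
    qed
    have "Ht s \<inter> V = {}" using \<open>Ht t \<inter> V = {}\<close> loewner_domain_antimono[OF s(1), of a u] by (auto simp: Ht_def)
    have "Ht s \<subseteq> ?H - \<gamma> ` {0<..\<tau>}"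
    proof
      fix x assume x: "x \<in> Ht s"
      then have xs: "x \<in> ?H - \<gamma> ` {0<..s}"
        using in_components_subset[OF comp[OF s(3)]] unfolding Ht_def by blast
      have "x \<noteq> \<gamma> r" if "r \<in> {0<..\<tau>}" for r
      proof (cases "r \<le> s")
        case True
        then have "r \<in> {0<..s}" using that by simp
        then show ?thesis using xs by blast
      next
        case False
        then have "\<gamma> r \<in> V" using inV that by simp
        then show ?thesis using x \<open>Ht s \<inter> V = {}\<close> by blast
      qed
      then show "x \<in> ?H - \<gamma> ` {0<..\<tau>}" using xs by blast
    qed
    moreover have sub: "Ht \<tau> \<subseteq> Ht s" unfolding Ht_def using s by (intro loewner_domain_antimono) simp
    moreover have "Ht \<tau> \<noteq> {}" using in_components_nonempty[OF comp[OF \<tau>(1)]] by (simp add: Ht_def)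
    moreover have "connected (Ht s)" using in_components_connected[OF comp[OF s(3)]] by (simp add: Ht_def)
    ultimately have "Ht s \<subseteq> Ht \<tau>"
      unfolding Ht_def by (intro components_maximal[OF comp[OF \<tau>(1)]]) blast+
    with sub have "loewner_domain a u s = loewner_domain a u \<tau>" by (auto simp: Ht_def)
    moreover have "continuous_on {0..\<tau>} u" using u by (auto elim: continuous_on_subset)
    ultimately show ?thesis using loewner_domain_neq[OF a s(3) s(2)] by blast
  qed
qed

section \<open>A supermartingale for the Euler scheme\<close>

lemma mvt_segment:
  fixes f f' :: "real \<Rightarrow> real"
  assumes "\<And>t. t \<in> closed_segment u v \<Longrightarrow> (f has_real_derivative f' t) (at t)"
  shows "\<exists>t\<in>closed_segment u v. f v - f u = f' t * (v - u)"
proof (cases u v rule: linorder_cases)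
  case less
  then obtain t where "u < t" "t < v" "f v - f u = (v - u) * f' t"
    using MVT2[of u v f f'] assms by (auto simp: closed_segment_eq_real_ivl)
  then show ?thesis by (auto simp: closed_segment_eq_real_ivl algebra_simps intro!: bexI[of _ t])
next
  case equal then show ?thesis by (auto intro!: bexI[of _ u])
next
  case greater
  then obtain t where "v < t" "t < u" "f u - f v = (u - v) * f' t"
    using MVT2[of v u f f'] assms by (auto simp: closed_segment_eq_real_ivl)
  then show ?thesis by (auto simp: closed_segment_eq_real_ivl algebra_simps intro!: bexI[of _ t])
qed

lemma taylor2_segment:
  fixes f f' f'' :: "real \<Rightarrow> real"
  assumes 1: "\<And>t. t \<in> closed_segment u v \<Longrightarrow> (f has_real_derivative f' t) (at t)"
    and 2: "\<And>t. t \<in> closed_segment u v \<Longrightarrow> (f' has_real_derivative f'' t) (at t)"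
  shows "\<exists>t\<in>closed_segment u v. f v - f u - f' u * (v - u) = f'' t / 2 * (v - u)\<^sup>2"
proof (cases "u = v")
  case False
  define df where "df m = (if m = 0 then f else if m = 1 then f' else f'')" for m :: nat
  have "\<exists>t. (if v < u then v < t \<and> t < u else u < t \<and> t < v) \<and>
    f v = (\<Sum>m<2. (df m u / fact m) * (v - u) ^ m) + (df 2 t / fact 2) * (v - u) ^ 2"
  proof (rule Taylor)
    show "\<forall>m t. m < 2 \<and> min u v \<le> t \<and> t \<le> max u v \<longrightarrow> DERIV (df m) t :> df (Suc m) t"
      using 1 2 by (auto simp: df_def closed_segment_eq_real_ivl less_Suc_eq numeral_2_eq_2 min_def max_def split: if_splits)
  qed (use False in \<open>auto simp: df_def\<close>)
  then obtain t where t: "if v < u then v < t \<and> t < u else u < t \<and> t < v"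
    "f v = (\<Sum>m<2. (df m u / fact m) * (v - u) ^ m) + (df 2 t / fact 2) * (v - u) ^ 2" by blast
  have "(\<Sum>m<2. (df m u / fact m) * (v - u) ^ m) = f u + f' u * (v - u)"
    by (simp add: numeral_2_eq_2 df_def)
  with t show ?thesis
    by (intro bexI[of _ t]) (auto simp: df_def closed_segment_eq_real_ivl split: if_splits)
qed (auto intro!: bexI[of _ u])

lemma closed_segment_real_props:
  fixes u v t :: real
  assumes "t \<in> closed_segment u v"
  shows "\<bar>t - u\<bar> \<le> \<bar>v - u\<bar>" "0 < u \<Longrightarrow> 0 < v \<Longrightarrow> 0 < t"
  using assms by (auto simp: closed_segment_eq_real_ivl split: if_splits)

lemma abs_sum4_le:
  fixes a b c d :: real
  assumes "\<bar>a\<bar> \<le> a'" "\<bar>b\<bar> \<le> b'" "\<bar>c\<bar> \<le> c'" "\<bar>d\<bar> \<le> d'"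
  shows "\<bar>a + b + c + d\<bar> \<le> a' + b' + c' + d'"
  using assms by linarith

text \<open>Noise acts on x only, with size \<open>sqrt h\<close>, so two derivatives are required
  in x but one in y and in r, whose increments have order h. The derivatives are parameters so that
  the generator can be written down explicitly.\<close>

locale heat_function =
  fixes F Fx Fxx Fy Fr :: "real \<times> real \<times> real \<Rightarrow> real"
  assumes dx: "\<And>x y r. 0 < y \<Longrightarrow> 0 < r \<Longrightarrow> ((\<lambda>x. F (x, y, r)) has_real_derivative Fx (x, y, r)) (at x)"
    and dxx: "\<And>x y r. 0 < y \<Longrightarrow> 0 < r \<Longrightarrow> ((\<lambda>x. Fx (x, y, r)) has_real_derivative Fxx (x, y, r)) (at x)"
    and dy: "\<And>x y r. 0 < y \<Longrightarrow> 0 < r \<Longrightarrow> ((\<lambda>y. F (x, y, r)) has_real_derivative Fy (x, y, r)) (at y)"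
    and dr: "\<And>x y r. 0 < y \<Longrightarrow> 0 < r \<Longrightarrow> ((\<lambda>r. F (x, y, r)) has_real_derivative Fr (x, y, r)) (at r)"
    and cont: "continuous_on (UNIV \<times> {0<..} \<times> {0<..}) Fx" "continuous_on (UNIV \<times> {0<..} \<times> {0<..}) Fxx"
      "continuous_on (UNIV \<times> {0<..} \<times> {0<..}) Fy" "continuous_on (UNIV \<times> {0<..} \<times> {0<..}) Fr"
begin

text \<open>The step is made one coordinate at a time: noise, then r, then y, then the drift of x.
  The noise needs a second-order expansion; once its linear term is subtracted, every contribution
  has order h and survives division by h.\<close>

lemma increment:
  assumes "0 < y" "0 < r" "0 < h" "0 < y + h * B" "0 < r + h * C"
  shows "\<exists>\<xi>1 \<xi>2 \<zeta> \<rho>. \<bar>\<xi>1 - x\<bar> \<le> sqrt h * \<bar>n\<bar> + h * \<bar>A\<bar> \<and> \<bar>\<xi>2 - x\<bar> \<le> sqrt h * \<bar>n\<bar> \<and>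
    \<bar>\<zeta> - y\<bar> \<le> h * \<bar>B\<bar> \<and> \<bar>\<rho> - r\<bar> \<le> h * \<bar>C\<bar> \<and> 0 < \<zeta> \<and> 0 < \<rho> \<and>
    (F (x + h * A + sqrt h * n, y + h * B, r + h * C) - F (x, y, r) - sqrt h * n * Fx (x, y, r)) / h
      = A * Fx (\<xi>1, y + h * B, r + h * C) + B * Fy (x + sqrt h * n, \<zeta>, r + h * C)
        + C * Fr (x + sqrt h * n, y, \<rho>) + n\<^sup>2 / 2 * Fxx (\<xi>2, y, r)"
proof -
  let ?x = "x + sqrt h * n" and ?y = "y + h * B" and ?r = "r + h * C"
  obtain \<xi>1 where \<xi>1: "\<xi>1 \<in> closed_segment ?x (x + h * A + sqrt h * n)"
    "F (x + h * A + sqrt h * n, ?y, ?r) - F (?x, ?y, ?r) = Fx (\<xi>1, ?y, ?r) * (x + h * A + sqrt h * n - ?x)"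
    using mvt_segment[of ?x "x + h * A + sqrt h * n" "\<lambda>x. F (x, ?y, ?r)" "\<lambda>x. Fx (x, ?y, ?r)"] dx assms by blast
  obtain \<zeta> where \<zeta>: "\<zeta> \<in> closed_segment y ?y"
    "F (?x, ?y, ?r) - F (?x, y, ?r) = Fy (?x, \<zeta>, ?r) * (?y - y)"
    using mvt_segment[of y ?y "\<lambda>y. F (?x, y, ?r)" "\<lambda>y. Fy (?x, y, ?r)"] dy assms closed_segment_real_props(2) by blast
  obtain \<rho> where \<rho>: "\<rho> \<in> closed_segment r ?r"
    "F (?x, y, ?r) - F (?x, y, r) = Fr (?x, y, \<rho>) * (?r - r)"
    using mvt_segment[of r ?r "\<lambda>r. F (?x, y, r)" "\<lambda>r. Fr (?x, y, r)"] dr assms closed_segment_real_props(2) by blast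
  obtain \<xi>2 where \<xi>2: "\<xi>2 \<in> closed_segment x ?x"
    "F (?x, y, r) - F (x, y, r) - Fx (x, y, r) * (?x - x) = Fxx (\<xi>2, y, r) / 2 * (?x - x)\<^sup>2"
    using taylor2_segment[of x ?x "\<lambda>x. F (x, y, r)" "\<lambda>x. Fx (x, y, r)" "\<lambda>x. Fxx (x, y, r)"] dx dxx assms by blast
  have sq: "(?x - x)\<^sup>2 = h * n\<^sup>2" using assms by (simp add: power_mult_distrib)
  have eqs: "x + h * A + sqrt h * n - ?x = h * A" "?y - y = h * B" "?r - r = h * C" "?x - x = sqrt h * n" by simp_all
  have "F (x + h * A + sqrt h * n, ?y, ?r) - F (x, y, r) - sqrt h * n * Fx (x, y, r)
      = Fx (\<xi>1, ?y, ?r) * (h * A) + Fy (?x, \<zeta>, ?r) * (h * B) + Fr (?x, y, \<rho>) * (h * C) + Fxx (\<xi>2, y, r) / 2 * (h * n\<^sup>2)"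
    using \<xi>1(2) \<zeta>(2) \<rho>(2) \<xi>2(2) mult.commute[of "sqrt h * n" "Fx (x, y, r)"] unfolding sq unfolding eqs by linarith
  also have "\<dots> = h * (A * Fx (\<xi>1, ?y, ?r) + B * Fy (?x, \<zeta>, ?r) + C * Fr (?x, y, \<rho>) + n\<^sup>2 / 2 * Fxx (\<xi>2, y, r))"
    by (simp add: algebra_simps)
  finally have quot: "(F (x + h * A + sqrt h * n, ?y, ?r) - F (x, y, r) - sqrt h * n * Fx (x, y, r)) / h
      = A * Fx (\<xi>1, ?y, ?r) + B * Fy (?x, \<zeta>, ?r) + C * Fr (?x, y, \<rho>) + n\<^sup>2 / 2 * Fxx (\<xi>2, y, r)"
    using assms(3) by simp
  have \<xi>1': "\<bar>\<xi>1 - x\<bar> \<le> sqrt h * \<bar>n\<bar> + h * \<bar>A\<bar>"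
  proof -
    have "\<bar>\<xi>1 - ?x\<bar> \<le> \<bar>h * A\<bar>" using closed_segment_real_props(1)[OF \<xi>1(1)] by simp
    moreover have "\<bar>?x - x\<bar> = sqrt h * \<bar>n\<bar>" using assms by (simp add: abs_mult)
    moreover have "\<bar>h * A\<bar> = h * \<bar>A\<bar>" using assms by (simp add: abs_mult)
    ultimately show ?thesis by linarith
  qed
  have others: "\<bar>\<xi>2 - x\<bar> \<le> sqrt h * \<bar>n\<bar>" "\<bar>\<zeta> - y\<bar> \<le> h * \<bar>B\<bar>" "\<bar>\<rho> - r\<bar> \<le> h * \<bar>C\<bar>"
    using closed_segment_real_props(1)[OF \<xi>2(1)] closed_segment_real_props(1)[OF \<zeta>(1)]
      closed_segment_real_props(1)[OF \<rho>(1)] assms by (auto simp: abs_mult)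
  have pos: "0 < \<zeta>" "0 < \<rho>"
    using closed_segment_real_props(2)[OF \<zeta>(1)] closed_segment_real_props(2)[OF \<rho>(1)] assms by auto
  show ?thesis
    by (rule exI[of _ \<xi>1], rule exI[of _ \<xi>2], rule exI[of _ \<zeta>], rule exI[of _ \<rho>], intro conjI; fact)
qed

text \<open>By compactness a sequence of counterexamples with \<open>h \<rightarrow> 0\<close> has a limit point in \<open>K\<close>; there
  the difference quotients converge to the generator applied to \<open>F\<close>, which is negative.\<close>

lemma gaussian_step:
  fixes A B C :: "real \<times> real \<times> real \<Rightarrow> real"
  assumes K: "compact K" "K \<subseteq> UNIV \<times> {0<..} \<times> {0<..r1}"
    and drift: "continuous_on K A" "continuous_on K B" "continuous_on K C" "\<And>p. p \<in> K \<Longrightarrow> C p \<le> 0"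
    and bound: "\<And>x y r. 0 < y \<Longrightarrow> 0 < r \<Longrightarrow> r \<le> r1 \<Longrightarrow> \<bar>F (x, y, r)\<bar> \<le> M"
    and strict: "\<And>p. p \<in> K \<Longrightarrow> A p * Fx p + B p * Fy p + C p * Fr p + Fxx p / 2 < 0"
  shows "\<exists>h0>0. \<forall>h\<in>{0<..h0}. \<forall>(x, y, r)\<in>K.
    integrable lborel (\<lambda>n. std_normal_density n * F (x + h * A (x, y, r) + sqrt h * n, y + h * B (x, y, r), r + h * C (x, y, r))) \<and>
    (\<integral>n. std_normal_density n * F (x + h * A (x, y, r) + sqrt h * n, y + h * B (x, y, r), r + h * C (x, y, r)) \<partial>lborel)
      \<le> F (x, y, r)"
proof (rule ccontr)
  let ?\<Omega> = "UNIV \<times> {0<..} \<times> {0<..} :: (real \<times> real \<times> real) set"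
  define N where "N h p n = F (fst p + h * A p + sqrt h * n, fst (snd p) + h * B p, snd (snd p) + h * C p)" for h p n
  define good where "good h p \<longleftrightarrow> integrable lborel (\<lambda>n. std_normal_density n * N h p n) \<and>
    (\<integral>n. std_normal_density n * N h p n \<partial>lborel) \<le> F p" for h p
  assume "\<not> ?thesis"
  then have "\<not> (\<exists>h0>0. \<forall>h\<in>{0<..h0}. \<forall>p\<in>K. good h p)"
    by (simp add: good_def N_def case_prod_beta)
  then have "\<exists>h p. h \<in> {0<..1 / real (Suc k)} \<and> p \<in> K \<and> \<not> good h p" for k
    by (metis divide_pos_pos of_nat_0_less_iff zero_less_Suc zero_less_one)
  then obtain h0 p0 where h0: "\<And>k. h0 k \<in> {0<..1 / real (Suc k)}" and p0: "\<And>k. p0 k \<in> K" "\<And>k. \<not> good (h0 k) (p0 k)"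
    by metis
  obtain l s where l: "l \<in> K" and s: "strict_mono s" "(p0 \<circ> s) \<longlonglongrightarrow> l"
    using K(1) p0(1) unfolding compact_def by blast
  have h0lim: "h0 \<longlonglongrightarrow> 0"
  proof (rule real_tendsto_sandwich[OF _ _ tendsto_const LIMSEQ_inverse_real_of_nat])
    show "\<forall>\<^sub>F n in sequentially. 0 \<le> h0 n" using h0 by (intro always_eventually) (auto intro: less_imp_le)
    show "\<forall>\<^sub>F n in sequentially. h0 n \<le> inverse (real (Suc n))"
      using h0 by (intro always_eventually) (simp add: inverse_eq_divide)
  qed
  define h p where "h k = h0 (s k)" and "p k = p0 (s k)" for k
  define x y r where "x k = fst (p k)" and "y k = fst (snd (p k))" and "r k = snd (snd (p k))" for k
  obtain lx ly lr where l_eq: "l = (lx, ly, lr)" by (cases l)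
  have lpos: "0 < ly" "0 < lr" using K(2) l by (auto simp: l_eq)
  have p_eq: "p k = (x k, y k, r k)" for k by (simp add: x_def y_def r_def)
  have pK: "p k \<in> K" for k by (simp add: p_def p0)
  have pos: "0 < y k" "0 < r k" "r k \<le> r1" for k using K(2) pK[of k] by (auto simp: p_eq)
  have hpos: "0 < h k" for k using h0[of "s k"] by (simp add: h_def)
  have plim: "p \<longlonglongrightarrow> l" using s(2) by (simp add: p_def[abs_def] o_def)
  have hlim: "h \<longlonglongrightarrow> 0" using LIMSEQ_subseq_LIMSEQ[OF h0lim s(1)] by (simp add: h_def[abs_def] o_def)
  have xlim: "x \<longlonglongrightarrow> lx" and ylim: "y \<longlonglongrightarrow> ly" and rlim: "r \<longlonglongrightarrow> lr"
    using tendsto_fst[OF plim] tendsto_fst[OF tendsto_snd[OF plim]] tendsto_snd[OF tendsto_snd[OF plim]]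
    by (simp_all add: x_def[abs_def] y_def[abs_def] r_def[abs_def] l_eq)
  have Alim: "(\<lambda>k. A (p k)) \<longlonglongrightarrow> A l" and Blim: "(\<lambda>k. B (p k)) \<longlonglongrightarrow> B l" and Clim: "(\<lambda>k. C (p k)) \<longlonglongrightarrow> C l"
    using pK by (intro continuous_on_tendsto_compose[OF drift(1) plim l] continuous_on_tendsto_compose[OF drift(2) plim l]
        continuous_on_tendsto_compose[OF drift(3) plim l] always_eventually allI; simp)+
  have hBlim: "(\<lambda>k. h k * \<bar>A (p k)\<bar>) \<longlonglongrightarrow> 0" "(\<lambda>k. h k * \<bar>B (p k)\<bar>) \<longlonglongrightarrow> 0" "(\<lambda>k. h k * \<bar>C (p k)\<bar>) \<longlonglongrightarrow> 0"
    using tendsto_mult[OF hlim tendsto_rabs[OF Alim]] tendsto_mult[OF hlim tendsto_rabs[OF Blim]]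
      tendsto_mult[OF hlim tendsto_rabs[OF Clim]] by simp_all
  \<comment> \<open>A compact neighbourhood of the limit point on which the derivatives are bounded.
    The radius 3 in x leaves 1 for the distance to the limit, 1 for the noise and 1 for the
    drift.\<close>
  define K' where "K' = {lx - 3..lx + 3} \<times> {ly / 2..2 * ly} \<times> {lr / 2..2 * lr}"
  have K': "compact K'" "K' \<subseteq> ?\<Omega>"
    unfolding K'_def using lpos by (auto intro!: compact_Times)
  have "\<exists>b. \<forall>q\<in>K'. \<bar>G q\<bar> \<le> b" if "continuous_on ?\<Omega> G" for G :: "real \<times> real \<times> real \<Rightarrow> real"
    using compact_imp_bounded[OF compact_continuous_image[OF continuous_on_subset[OF that K'(2)] K'(1)]]
    by (auto simp: bounded_iff)
  then obtain b1 b2 b3 b4 where b: "\<And>q. q \<in> K' \<Longrightarrow> \<bar>Fx q\<bar> \<le> b1" "\<And>q. q \<in> K' \<Longrightarrow> \<bar>Fxx q\<bar> \<le> b2"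
    "\<And>q. q \<in> K' \<Longrightarrow> \<bar>Fy q\<bar> \<le> b3" "\<And>q. q \<in> K' \<Longrightarrow> \<bar>Fr q\<bar> \<le> b4"
    using cont by metis
  define Bd where "Bd = Max {b1, b2, b3, b4}"
  have Bd: "\<bar>Fx q\<bar> \<le> Bd" "\<bar>Fxx q\<bar> \<le> Bd" "\<bar>Fy q\<bar> \<le> Bd" "\<bar>Fr q\<bar> \<le> Bd" if "q \<in> K'" for q
    using b[OF that] by (auto simp: Bd_def)
  have lK': "l \<in> K'" using lpos by (auto simp: l_eq K'_def)
  then have Bd0: "0 \<le> Bd" using order_trans[OF abs_ge_zero Bd(1)] by blast
  have M0: "0 \<le> M" using order_trans[OF abs_ge_zero bound[OF pos[of 0]]] .
  have "\<forall>\<^sub>F k in sequentially. \<bar>x k - lx\<bar> < 1 \<and> \<bar>y k - ly\<bar> < ly / 4 \<and> \<bar>r k - lr\<bar> < lr / 4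
      \<and> h k * \<bar>A (p k)\<bar> < 1 \<and> h k * \<bar>B (p k)\<bar> < ly / 4 \<and> h k * \<bar>C (p k)\<bar> < lr / 4
      \<and> \<bar>A (p k)\<bar> < \<bar>A l\<bar> + 1 \<and> \<bar>B (p k)\<bar> < \<bar>B l\<bar> + 1 \<and> \<bar>C (p k)\<bar> < \<bar>C l\<bar> + 1"
    using lpos tendstoD[OF xlim, of 1] tendstoD[OF ylim, of "ly / 4"] tendstoD[OF rlim, of "lr / 4"]
      order_tendstoD(2)[OF hBlim(1), of 1] order_tendstoD(2)[OF hBlim(2), of "ly / 4"] order_tendstoD(2)[OF hBlim(3), of "lr / 4"]
      order_tendstoD(2)[OF tendsto_rabs[OF Alim], of "\<bar>A l\<bar> + 1"] order_tendstoD(2)[OF tendsto_rabs[OF Blim], of "\<bar>B l\<bar> + 1"]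
      order_tendstoD(2)[OF tendsto_rabs[OF Clim], of "\<bar>C l\<bar> + 1"]
    by (simp add: dist_real_def eventually_conj_iff)
  then obtain k0 where k0: "\<And>k. k0 \<le> k \<Longrightarrow> \<bar>x k - lx\<bar> < 1 \<and> \<bar>y k - ly\<bar> < ly / 4 \<and> \<bar>r k - lr\<bar> < lr / 4
      \<and> h k * \<bar>A (p k)\<bar> < 1 \<and> h k * \<bar>B (p k)\<bar> < ly / 4 \<and> h k * \<bar>C (p k)\<bar> < lr / 4
      \<and> \<bar>A (p k)\<bar> < \<bar>A l\<bar> + 1 \<and> \<bar>B (p k)\<bar> < \<bar>B l\<bar> + 1 \<and> \<bar>C (p k)\<bar> < \<bar>C l\<bar> + 1"
    unfolding eventually_sequentially by blast
  have hB: "\<bar>h k * B (p k)\<bar> = h k * \<bar>B (p k)\<bar>" "\<bar>h k * C (p k)\<bar> = h k * \<bar>C (p k)\<bar>" for k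
    using hpos[of k] by (simp_all add: abs_mult)
  \<comment> \<open>The sign condition on C keeps the remaining time at most r1, the range in which
    F is bounded.\<close>
  have pos': "0 < y k + h k * B (p k)" "0 < r k + h k * C (p k)" "r k + h k * C (p k) \<le> r1" if "k0 \<le> k" for k
  proof -
    have "\<bar>y k - ly\<bar> < ly / 4" "\<bar>h k * B (p k)\<bar> < ly / 4" using k0[OF that] hB[of k] by auto
    then show "0 < y k + h k * B (p k)" using lpos(1) unfolding abs_less_iff by linarith
    have "\<bar>r k - lr\<bar> < lr / 4" "\<bar>h k * C (p k)\<bar> < lr / 4" using k0[OF that] hB[of k] by auto
    then show "0 < r k + h k * C (p k)" using lpos(2) unfolding abs_less_iff by linarith
    have "h k * C (p k) \<le> 0" using hpos[of k] drift(4)[OF pK[of k]] by (simp add: mult_nonneg_nonpos)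
    then show "r k + h k * C (p k) \<le> r1" using pos(3)[of k] by linarith
  qed
  \<comment> \<open>The linear noise term is subtracted because its quotient by h would blow up like
    1 / \<open>sqrt h\<close>; it does not affect the Gaussian mean.\<close>
  define Q where "Q k n = (N (h k) (p k) n - F (p k) - sqrt (h k) * n * Fx (p k)) / h k" for k n
  have N_eq: "N (h k) (p k) n = F (x k + h k * A (p k) + sqrt (h k) * n, y k + h k * B (p k), r k + h k * C (p k))" for k n
    by (simp add: N_def p_eq)
  have N_le: "\<bar>N (h k) (p k) n\<bar> \<le> M" if "k0 \<le> k" for k n
    unfolding N_eq using pos'[OF that] by (intro bound)
  define P where "P k n \<xi>1 \<xi>2 \<zeta> \<rho> \<longleftrightarrow> \<bar>\<xi>1 - x k\<bar> \<le> sqrt (h k) * \<bar>n\<bar> + h k * \<bar>A (p k)\<bar> \<and> \<bar>\<xi>2 - x k\<bar> \<le> sqrt (h k) * \<bar>n\<bar> \<and>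
    \<bar>\<zeta> - y k\<bar> \<le> h k * \<bar>B (p k)\<bar> \<and> \<bar>\<rho> - r k\<bar> \<le> h k * \<bar>C (p k)\<bar> \<and> 0 < \<zeta> \<and> 0 < \<rho> \<and>
    Q k n = A (p k) * Fx (\<xi>1, y k + h k * B (p k), r k + h k * C (p k)) + B (p k) * Fy (x k + sqrt (h k) * n, \<zeta>, r k + h k * C (p k))
        + C (p k) * Fr (x k + sqrt (h k) * n, y k, \<rho>) + n\<^sup>2 / 2 * Fxx (\<xi>2, y k, r k)" for k n \<xi>1 \<xi>2 \<zeta> \<rho>
  have "\<exists>\<xi>1 \<xi>2 \<zeta> \<rho>. P k n \<xi>1 \<xi>2 \<zeta> \<rho>" if "k0 \<le> k" for k n
    unfolding P_def Q_def N_eq using increment[OF pos(1)[of k] pos(2)[of k] hpos pos'(1,2)[OF that], of "x k" n] by (simp add: p_eq)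
  then obtain \<xi>1 \<xi>2 \<zeta> \<rho> where P: "\<And>k n. k0 \<le> k \<Longrightarrow> P k n (\<xi>1 k n) (\<xi>2 k n) (\<zeta> k n) (\<rho> k n)"
    by metis
  have pts: "\<bar>\<xi>1 k n - x k\<bar> \<le> sqrt (h k) * \<bar>n\<bar> + h k * \<bar>A (p k)\<bar>"
    "\<bar>\<xi>2 k n - x k\<bar> \<le> sqrt (h k) * \<bar>n\<bar>"
    "\<bar>\<zeta> k n - y k\<bar> \<le> h k * \<bar>B (p k)\<bar>" "\<bar>\<rho> k n - r k\<bar> \<le> h k * \<bar>C (p k)\<bar>" "0 < \<zeta> k n" "0 < \<rho> k n"
    and Q_eq: "Q k n = A (p k) * Fx (\<xi>1 k n, y k + h k * B (p k), r k + h k * C (p k))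
        + B (p k) * Fy (x k + sqrt (h k) * n, \<zeta> k n, r k + h k * C (p k))
        + C (p k) * Fr (x k + sqrt (h k) * n, y k, \<rho> k n) + n\<^sup>2 / 2 * Fxx (\<xi>2 k n, y k, r k)"
    if "k0 \<le> k" for k n
    using P[OF that, of n] unfolding P_def by blast+
  define D where "D = (\<bar>A l\<bar> + 1) * Bd + (\<bar>B l\<bar> + 1) * Bd + (\<bar>C l\<bar> + 1) * Bd + Bd + 2 * M"
  \<comment> \<open>The dominating function. Noise of size at most 1 keeps all intermediate points
    in K'. For larger noise 1 / h is at most n^2, so the mere boundedness of F suffices.\<close>
  have Q_bound: "\<bar>Q k n\<bar> \<le> D * (1 + n\<^sup>2)" if k: "k0 \<le> k" for k n
  proof (cases "sqrt (h k) * \<bar>n\<bar> \<le> 1")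
    case True
    note k0' = k0[OF k]
    have "\<bar>y k - ly\<bar> < ly / 4" "\<bar>h k * B (p k)\<bar> < ly / 4" "\<bar>\<zeta> k n - y k\<bar> < ly / 4"
      using k0' hB(1)[of k] pts(3)[OF k, of n] by auto
    then have yk: "y k + h k * B (p k) \<in> {ly / 2..2 * ly}" "y k \<in> {ly / 2..2 * ly}" "\<zeta> k n \<in> {ly / 2..2 * ly}"
      unfolding abs_less_iff atLeastAtMost_iff using lpos(1) by linarith+
    have "\<bar>r k - lr\<bar> < lr / 4" "\<bar>h k * C (p k)\<bar> < lr / 4" "\<bar>\<rho> k n - r k\<bar> < lr / 4"
      using k0' hB(2)[of k] pts(4)[OF k, of n] by auto
    then have rk: "r k + h k * C (p k) \<in> {lr / 2..2 * lr}" "r k \<in> {lr / 2..2 * lr}" "\<rho> k n \<in> {lr / 2..2 * lr}"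
      unfolding abs_less_iff atLeastAtMost_iff using lpos(2) by linarith+
    have "\<bar>sqrt (h k) * n\<bar> \<le> 1" using True hpos[of k] by (simp add: abs_mult)
    moreover have "\<bar>x k - lx\<bar> < 1" "\<bar>\<xi>1 k n - x k\<bar> \<le> 2" "\<bar>\<xi>2 k n - x k\<bar> \<le> 1"
      using k0' pts(1)[OF k, of n] pts(2)[OF k, of n] True by auto
    ultimately have xk: "\<xi>1 k n \<in> {lx - 3..lx + 3}" "x k + sqrt (h k) * n \<in> {lx - 3..lx + 3}" "\<xi>2 k n \<in> {lx - 3..lx + 3}"
      unfolding abs_less_iff abs_le_iff atLeastAtMost_iff by linarith+
    have mem: "(\<xi>1 k n, y k + h k * B (p k), r k + h k * C (p k)) \<in> K'"
      "(x k + sqrt (h k) * n, \<zeta> k n, r k + h k * C (p k)) \<in> K'"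
      "(x k + sqrt (h k) * n, y k, \<rho> k n) \<in> K'" "(\<xi>2 k n, y k, r k) \<in> K'"
      using xk yk rk unfolding K'_def by blast+
    have dr_le: "\<bar>A (p k)\<bar> \<le> \<bar>A l\<bar> + 1" "\<bar>B (p k)\<bar> \<le> \<bar>B l\<bar> + 1" "\<bar>C (p k)\<bar> \<le> \<bar>C l\<bar> + 1"
      using k0' by auto
    have prod_le: "\<bar>c * G\<bar> \<le> c' * Bd" if "\<bar>c\<bar> \<le> c'" "\<bar>G\<bar> \<le> Bd" for c c' G
      unfolding abs_mult using that Bd0 by (intro mult_mono) auto
    have "\<bar>n\<^sup>2 / 2\<bar> \<le> n\<^sup>2 / 2" by simp
    note terms = prod_le[OF dr_le(1) Bd(1)[OF mem(1)]] prod_le[OF dr_le(2) Bd(3)[OF mem(2)]]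
      prod_le[OF dr_le(3) Bd(4)[OF mem(3)]] prod_le[OF this Bd(2)[OF mem(4)]]
    have "\<bar>Q k n\<bar> \<le> (\<bar>A l\<bar> + 1) * Bd + (\<bar>B l\<bar> + 1) * Bd + (\<bar>C l\<bar> + 1) * Bd + n\<^sup>2 / 2 * Bd"
      unfolding Q_eq[OF k] using terms by (rule abs_sum4_le)
    also have "\<dots> \<le> D + D * n\<^sup>2"
    proof (rule add_mono)
      show "(\<bar>A l\<bar> + 1) * Bd + (\<bar>B l\<bar> + 1) * Bd + (\<bar>C l\<bar> + 1) * Bd \<le> D"
        using Bd0 M0 by (simp add: D_def)
      have "Bd \<le> D" using Bd0 M0 by (simp add: D_def)
      then have "n\<^sup>2 / 2 * Bd \<le> n\<^sup>2 * D" using Bd0 by (intro mult_mono) auto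
      then show "n\<^sup>2 / 2 * Bd \<le> D * n\<^sup>2" by (simp add: mult.commute)
    qed
    finally show ?thesis by (simp add: algebra_simps)
  next
    case False
    let ?h = "h k"
    have n1: "1 \<le> sqrt ?h * \<bar>n\<bar>" using False by simp
    then have "1 \<le> (sqrt ?h * \<bar>n\<bar>)\<^sup>2" by (rule one_le_power)
    then have hn: "1 / ?h \<le> n\<^sup>2" using hpos[of k] by (simp add: power_mult_distrib field_simps)
    have "sqrt ?h * \<bar>n\<bar> \<le> (sqrt ?h * \<bar>n\<bar>)\<^sup>2" using n1 by (rule self_le_power) simp
    then have hn2: "sqrt ?h * \<bar>n\<bar> / ?h \<le> n\<^sup>2" using hpos[of k] by (simp add: power_mult_distrib field_simps)
    have "\<bar>x k - lx\<bar> < 1" "\<bar>y k - ly\<bar> < ly / 4" "\<bar>r k - lr\<bar> < lr / 4" using k0[OF k] by auto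
    then have "p k \<in> K'"
      using lpos unfolding p_eq K'_def mem_Times_iff fst_conv snd_conv atLeastAtMost_iff abs_less_iff by linarith
    note Bp = Bd(1)[OF this]
    have "\<bar>Q k n\<bar> \<le> (\<bar>N ?h (p k) n\<bar> + \<bar>F (p k)\<bar> + \<bar>sqrt ?h * n * Fx (p k)\<bar>) / ?h"
      unfolding Q_def abs_divide using hpos[of k] by (intro frac_le) auto
    also have "\<dots> \<le> (M + M + sqrt ?h * \<bar>n\<bar> * Bd) / ?h"
      using N_le[OF k, of n] bound[OF pos[of k], of "x k"] Bp hpos[of k]
      by (intro divide_right_mono add_mono) (auto simp: p_eq abs_mult intro!: mult_left_mono)
    also have "\<dots> = 2 * M * (1 / ?h) + Bd * (sqrt ?h * \<bar>n\<bar> / ?h)"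
      by (simp add: add_divide_distrib mult.commute)
    also have "\<dots> \<le> 2 * M * n\<^sup>2 + Bd * n\<^sup>2"
      using hn hn2 M0 Bd0 by (intro add_mono mult_left_mono) auto
    also have "\<dots> = (2 * M + Bd) * n\<^sup>2" by (simp add: algebra_simps)
    also have "\<dots> \<le> D * (1 + n\<^sup>2)"
      using M0 Bd0 by (intro mult_mono) (auto simp: D_def)
    finally show ?thesis .
  qed
  define Q' where "Q' n = A l * Fx l + B l * Fy l + C l * Fr l + n\<^sup>2 / 2 * Fxx l" for n :: real
  have Q_lim: "(\<lambda>k. Q (k + k0) n) \<longlonglongrightarrow> Q' n" for n
  proof -
    have sh: "(\<lambda>k. sqrt (h k) * n) \<longlonglongrightarrow> 0" "(\<lambda>k. sqrt (h k) * \<bar>n\<bar>) \<longlonglongrightarrow> 0"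
      using tendsto_mult_right[OF tendsto_real_sqrt[OF hlim], of n] tendsto_mult_right[OF tendsto_real_sqrt[OF hlim], of "\<bar>n\<bar>"] by simp_all
    have approach: "X \<longlonglongrightarrow> c" if "\<And>k. k0 \<le> k \<Longrightarrow> \<bar>X k - Y k\<bar> \<le> e k" "e \<longlonglongrightarrow> 0" "Y \<longlonglongrightarrow> c" for X Y e :: "nat \<Rightarrow> real" and c
    proof -
      have "(\<lambda>k. X k - Y k) \<longlonglongrightarrow> 0"
        by (rule Lim_null_comparison[OF _ that(2)]) (use that(1) in \<open>auto simp: eventually_sequentially\<close>)
      from tendsto_add[OF this that(3)] show ?thesis by simp
    qed
    have \<xi>1: "(\<lambda>k. \<xi>1 k n) \<longlonglongrightarrow> lx" and \<xi>2: "(\<lambda>k. \<xi>2 k n) \<longlonglongrightarrow> lx"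
      and \<zeta>: "(\<lambda>k. \<zeta> k n) \<longlonglongrightarrow> ly" and \<rho>: "(\<lambda>k. \<rho> k n) \<longlonglongrightarrow> lr"
      using approach[OF pts(1)[of _ n] _ xlim] approach[OF pts(2)[of _ n] sh(2) xlim] approach[OF pts(3)[of _ n] hBlim(2) ylim]
        approach[OF pts(4)[of _ n] hBlim(3) rlim] tendsto_add[OF sh(2) hBlim(1)] by simp_all
    have xs: "(\<lambda>k. x k + sqrt (h k) * n) \<longlonglongrightarrow> lx" using tendsto_add[OF xlim sh(1)] by simp
    have yB: "(\<lambda>k. y k + h k * B (p k)) \<longlonglongrightarrow> ly" and rC: "(\<lambda>k. r k + h k * C (p k)) \<longlonglongrightarrow> lr"
      using tendsto_add[OF ylim tendsto_mult[OF hlim Blim]] tendsto_add[OF rlim tendsto_mult[OF hlim Clim]] by simp_all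
    have comp: "(\<lambda>k. G (X k, Y k, Z k)) \<longlonglongrightarrow> G l" if "continuous_on ?\<Omega> G" "X \<longlonglongrightarrow> lx" "Y \<longlonglongrightarrow> ly" "Z \<longlonglongrightarrow> lr"
      "\<And>k. k0 \<le> k \<Longrightarrow> 0 < Y k \<and> 0 < Z k" for G :: "real \<times> real \<times> real \<Rightarrow> real" and X Y Z
    proof (rule continuous_on_tendsto_compose[OF that(1)])
      show "(\<lambda>k. (X k, Y k, Z k)) \<longlonglongrightarrow> l" unfolding l_eq by (intro tendsto_Pair that)
      show "l \<in> ?\<Omega>" using lpos by (simp add: l_eq)
      show "\<forall>\<^sub>F k in sequentially. (X k, Y k, Z k) \<in> ?\<Omega>"
        using that(5) by (auto simp: eventually_sequentially)
    qed
    have "(\<lambda>k. A (p k) * Fx (\<xi>1 k n, y k + h k * B (p k), r k + h k * C (p k))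
        + B (p k) * Fy (x k + sqrt (h k) * n, \<zeta> k n, r k + h k * C (p k))
        + C (p k) * Fr (x k + sqrt (h k) * n, y k, \<rho> k n) + n\<^sup>2 / 2 * Fxx (\<xi>2 k n, y k, r k)) \<longlonglongrightarrow> Q' n"
      unfolding Q'_def using pts pos pos'
      by (intro tendsto_add tendsto_mult Alim Blim Clim tendsto_const comp cont \<xi>1 \<xi>2 \<zeta> \<rho> xs yB rC xlim ylim rlim) auto
    then have "(\<lambda>k. Q k n) \<longlonglongrightarrow> Q' n"
      by (rule Lim_transform_eventually) (unfold eventually_sequentially, intro exI[of _ k0] allI impI Q_eq[symmetric])
    then show ?thesis by (rule LIMSEQ_ignore_initial_segment)
  qed
  have F_meas: "(\<lambda>x. F (x, y, r)) \<in> borel_measurable borel" if "0 < y" "0 < r" for y r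
    using dx[OF that] by (intro borel_measurable_continuous_onI continuous_at_imp_continuous_on ballI DERIV_isCont) blast
  have N_meas: "N (h k) (p k) \<in> borel_measurable borel" if "k0 \<le> k" for k
  proof -
    have "(\<lambda>n. F (x k + h k * A (p k) + sqrt (h k) * n, y k + h k * B (p k), r k + h k * C (p k))) \<in> borel_measurable borel"
      by (rule measurable_compose[OF _ F_meas]) (use pos'[OF that] in auto)
    then show ?thesis unfolding N_eq[symmetric] .
  qed
  have dens: "integrable lborel std_normal_density" "integrable lborel (\<lambda>n. std_normal_density n * n)"
    "integrable lborel (\<lambda>n. std_normal_density n * n\<^sup>2)"
    using integrable_std_normal_moment[of 0] integrable_std_normal_moment[of 1] integrable_std_normal_moment[of 2] by simp_all
  have dens_int: "(\<integral>n. std_normal_density n \<partial>lborel) = 1" "(\<integral>n. std_normal_density n * n \<partial>lborel) = 0"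
    "(\<integral>n. std_normal_density n * n\<^sup>2 \<partial>lborel) = 1"
    using integral_std_normal_moment_even[of 0] integral_std_normal_moment_odd[of 0] integral_std_normal_moment_even[of 1] by simp_all
  have N_int: "integrable lborel (\<lambda>n. std_normal_density n * N (h k) (p k) n)" if "k0 \<le> k" for k
  proof (rule Bochner_Integration.integrable_bound[OF integrable_mult_left[OF dens(1), of M]])
    show "(\<lambda>n. std_normal_density n * N (h k) (p k) n) \<in> borel_measurable lborel" using N_meas[OF that] by measurable
    show "AE n in lborel. norm (std_normal_density n * N (h k) (p k) n) \<le> norm (std_normal_density n * M)"
      using N_le[OF that] M0 by (auto simp: abs_mult intro!: mult_left_mono)
  qed
  \<comment> \<open>Integrability holds anyway by \<open>N_int\<close>, so a counterexample must
    violate the inequality itself, and its mean quotient is positive.\<close>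
  have Q_nonneg: "0 \<le> (\<integral>n. std_normal_density n * Q k n \<partial>lborel)" if "k0 \<le> k" for k
  proof -
    have "std_normal_density n * Q k n = (std_normal_density n * N (h k) (p k) n - std_normal_density n * F (p k)
        - sqrt (h k) * Fx (p k) * (std_normal_density n * n)) / h k" for n
      by (simp add: Q_def algebra_simps)
    then have "(\<integral>n. std_normal_density n * Q k n \<partial>lborel)
      = ((\<integral>n. std_normal_density n * N (h k) (p k) n \<partial>lborel) - F (p k)) / h k"
      using N_int[OF that] dens dens_int by simp
    moreover have "\<not> good (h k) (p k)" using p0 by (simp add: h_def p_def)
    ultimately show ?thesis using N_int[OF that] hpos[of k] by (simp add: good_def)
  qed
  have "(\<lambda>k. \<integral>n. std_normal_density n * Q (k + k0) n \<partial>lborel) \<longlonglongrightarrow> (\<integral>n. std_normal_density n * Q' n \<partial>lborel)"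
  proof (rule integral_dominated_convergence[where w = "\<lambda>n. std_normal_density n * (D * (1 + n\<^sup>2))"])
    show "(\<lambda>n. std_normal_density n * Q' n) \<in> borel_measurable lborel" unfolding Q'_def by measurable
    show "(\<lambda>n. std_normal_density n * Q (k + k0) n) \<in> borel_measurable lborel" for k
      unfolding Q_def using N_meas[of "k + k0"] by measurable
    have "integrable lborel (\<lambda>n. D * (std_normal_density n + std_normal_density n * n\<^sup>2))"
      using dens by simp
    then show "integrable lborel (\<lambda>n. std_normal_density n * (D * (1 + n\<^sup>2)))" by (simp add: algebra_simps)
    show "AE n in lborel. (\<lambda>k. std_normal_density n * Q (k + k0) n) \<longlonglongrightarrow> std_normal_density n * Q' n"
      using Q_lim by (auto intro!: tendsto_intros)
    show "AE n in lborel. norm (std_normal_density n * Q (k + k0) n) \<le> std_normal_density n * (D * (1 + n\<^sup>2))" for k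
      using Q_bound[of "k + k0"] by (auto simp: abs_mult intro!: mult_left_mono)
  qed
  then have "0 \<le> (\<integral>n. std_normal_density n * Q' n \<partial>lborel)"
    by (rule LIMSEQ_le_const) (use Q_nonneg in auto)
  also have "(\<integral>n. std_normal_density n * Q' n \<partial>lborel) = A l * Fx l + B l * Fy l + C l * Fr l + Fxx l / 2"
  proof -
    have "std_normal_density n * Q' n = (A l * Fx l + B l * Fy l + C l * Fr l) * std_normal_density n
        + Fxx l / 2 * (std_normal_density n * n\<^sup>2)" for n
      by (simp add: Q'_def algebra_simps)
    then show ?thesis using dens dens_int by simp
  qed
  also have "\<dots> < 0" using strict[OF l] .
  finally show False by simp
qed

end

lemma mult_exp_plus_one_ge:
  fixes t :: real assumes "0 \<le> t" shows "2 * (exp t - 1) \<le> t * (exp t + 1)"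
proof -
  \<comment> \<open>This is tanh (t / 2) \<le> t / 2 with denominators cleared.\<close>
  have "(\<lambda>t. t * (exp t + 1) - 2 * (exp t - 1)) 0 \<le> (\<lambda>t. t * (exp t + 1) - 2 * (exp t - 1)) t"
  proof (rule DERIV_nonneg_imp_nondecreasing[OF assms])
    fix x :: real assume "0 \<le> x"
    have "((\<lambda>t. t * (exp t + 1) - 2 * (exp t - 1)) has_real_derivative (exp x * (exp (-x) - (1 - x)))) (at x)"
      by (auto intro!: derivative_eq_intros simp: algebra_simps simp flip: exp_add)
    moreover have "0 \<le> exp x * (exp (-x) - (1 - x))"
      using exp_ge_add_one_self[of "-x"] by simp
    ultimately show "\<exists>y. ((\<lambda>t. t * (exp t + 1) - 2 * (exp t - 1)) has_real_derivative y) (at x) \<and> 0 \<le> y" by blast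
  qed
  then show ?thesis by simp
qed

text \<open>The right-hand side is the square of 2 sinh (t / 2).\<close>

lemma square_le_exp_expression:
  fixes t :: real assumes "0 \<le> t" shows "t\<^sup>2 \<le> (1 - exp (- t))\<^sup>2 / exp (- t)"
proof -
  have "t / 2 \<le> (exp (t / 2) - inverse (exp (t / 2))) / 2"
    using real_le_x_sinh[of "t / 2"] assms by simp
  then have "t \<le> exp (t / 2) - exp (- (t / 2))" by (simp add: exp_minus)
  then have "t\<^sup>2 \<le> (exp (t / 2) - exp (- (t / 2)))\<^sup>2" using assms by (intro power_mono)
  also have "\<dots> = (1 - exp (- t))\<^sup>2 / exp (- t)"
  proof -
    have "exp (t / 2) = 1 / exp (- (t / 2))" by (simp add: exp_minus inverse_eq_divide)
    moreover have "exp (- (t / 2)) = exp (- t) / exp (- (t / 2))" by (simp flip: exp_diff)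
    ultimately have "exp (t / 2) - exp (- (t / 2)) = (1 - exp (- t)) / exp (- (t / 2))"
      by (metis diff_divide_distrib)
    moreover have "(exp (- (t / 2)))\<^sup>2 = exp (- t)" by (simp add: power2_eq_square flip: exp_add)
    ultimately show ?thesis by (simp add: power_divide)
  qed
  finally show ?thesis .
qed

text \<open>With \<open>E = exp (-t)\<close> and \<open>g = 1 - E\<close>, this is the generator applied to
  \<open>exp (n r) * g powr m\<close>, up to a positive factor.\<close>

lemma layer_inequality:
  fixes s t r m n :: real
  assumes s: "0 < s" "s \<le> 1" and r: "0 < r" and m: "0 < m" and n: "2 * m * (1 + m) < n" and t: "t = s / r"
  defines "E \<equiv> exp (- t)"
  defines "g \<equiv> 1 - E"
  shows "2 * t * (1 - s) * (m * E - 1) + (2 * (1 - m) - (3 - 2 * m) * s) * g + g * t - n * r / m * (g\<^sup>2 / E) < 0"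
proof -
  have t0: "0 < t" using s r t by simp
  have E: "0 < E" "E < 1" using t0 by (auto simp: E_def)
  have g: "0 < g" "g \<le> t" using E exp_ge_add_one_self[of "-t"] by (auto simp: g_def E_def)
  have "t * E \<le> g"
  proof -
    have "(1 + t) * E \<le> exp t * E" using exp_ge_add_one_self[of t] E by (intro mult_right_mono) auto
    then show ?thesis by (simp add: g_def E_def algebra_simps flip: exp_add)
  qed
  moreover have "2 * g \<le> t * (1 + E)"
  proof -
    have "2 * (exp t - 1) * E \<le> t * (exp t + 1) * E"
      using mult_exp_plus_one_ge[of t] t0 E by (intro mult_right_mono) auto
    then have "2 * (exp t * E - E) \<le> t * (exp t * E + E)" by (simp add: algebra_simps)
    moreover have "exp t * E = 1" by (simp add: E_def flip: exp_add)
    ultimately show ?thesis by (simp add: g_def)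
  qed
  \<comment> \<open>The terms without a factor s, where t counts as independent of s. They are
    nonpositive for every t by the tanh inequality, so only terms carrying s need compensation from
    the term with n.\<close>
  ultimately have P: "2 * t * (m * E - 1) + 2 * (1 - m) * g + t * g \<le> 0"
  proof -
    assume 1: "t * E \<le> g" and 2: "2 * g \<le> t * (1 + E)"
    have "2 * t * (m * E - 1) + 2 * (1 - m) * g + t * g = 2 * m * (t * E - g) + (2 * g - t * (1 + E)) + t * (E + g - 1)"
      by (simp add: algebra_simps)
    moreover have "2 * m * (t * E - g) \<le> 0" using 1 m by (simp add: mult_nonneg_nonpos)
    ultimately show ?thesis using 2 by (simp add: g_def)
  qed
  have sq: "t\<^sup>2 \<le> g\<^sup>2 / E" using square_le_exp_expression[of t] t0 by (simp add: g_def E_def)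
  have "n * r / m * (g\<^sup>2 / E) \<ge> n * r / m * t\<^sup>2"
  proof (rule mult_left_mono[OF sq])
    have "0 \<le> 2 * m * (1 + m)" using m by simp
    then have "0 < n" using n by linarith
    then show "0 \<le> n * r / m" using r m by simp
  qed
  \<comment> \<open>Since s = r t, the compensating term is at least s t n / m, which has the same
    form s t as the error.\<close>
  moreover have "n * r / m * t\<^sup>2 = s * t * (n / m)" using r by (simp add: t power2_eq_square mult_ac)
  ultimately have A: "s * t * (n / m) \<le> n * r / m * (g\<^sup>2 / E)" by (simp only:)
  have "2 * t + 2 * m * g - 3 * g - 2 * t * (m * E) \<le> 2 * t + 2 * m * t"
  proof -
    have "2 * m * g \<le> 2 * m * t" using g m by simp
    moreover have "0 \<le> 2 * t * (m * E)" using t0 m E by simp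
    ultimately show ?thesis using g by linarith
  qed
  then have "s * (2 * t + 2 * m * g - 3 * g - 2 * t * (m * E)) \<le> s * (2 * t + 2 * m * t)"
    using s by (intro mult_left_mono) auto
  also have "\<dots> = s * t * (2 + 2 * m)" by (simp add: algebra_simps)
  \<comment> \<open>The error is at most s t (2 + 2 m); the hypothesis on n says precisely that n /
    m is larger.\<close>
  also have "\<dots> < s * t * (n / m)"
    using n m s t0 by (intro mult_strict_left_mono) (auto simp: field_simps)
  finally have B: "s * (2 * t + 2 * m * g - 3 * g - 2 * t * (m * E)) < s * t * (n / m)" .
  have "2 * t * (1 - s) * (m * E - 1) + (2 * (1 - m) - (3 - 2 * m) * s) * g + g * t
      = (2 * t * (m * E - 1) + 2 * (1 - m) * g + t * g) + s * (2 * t + 2 * m * g - 3 * g - 2 * t * (m * E))"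
    by (simp add: algebra_simps)
  then show ?thesis using P A B by linarith
qed

section \<open>Reduction of the generator to the angle and the remaining time\<close>

definition sin_sq :: "real \<Rightarrow> real \<Rightarrow> real" where
  "sin_sq x y = y\<^sup>2 / (x\<^sup>2 + y\<^sup>2)"

lemma sin_sq_pos: "0 < y \<Longrightarrow> 0 < sin_sq x y"
  by (simp add: sin_sq_def add_nonneg_pos)

lemma sin_sq_le_1: "sin_sq x y \<le> 1"
  unfolding sin_sq_def by (cases "x\<^sup>2 + y\<^sup>2 = 0") (auto intro!: divide_le_eq_1_pos[THEN iffD2] simp: sum_power2_gt_zero_iff)

text \<open>Regularity is demanded for s > 0 and r > 0 only. Both edges are excluded: powers of s
  may be singular at 0, and the boundary layer has no continuous extension to s = r = 0.\<close>

locale angular_function =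
  fixes \<Psi> \<Psi>s \<Psi>ss \<Psi>r :: "real \<times> real \<Rightarrow> real"
  assumes ds: "\<And>s r. 0 < s \<Longrightarrow> 0 < r \<Longrightarrow> ((\<lambda>s. \<Psi> (s, r)) has_real_derivative \<Psi>s (s, r)) (at s)"
    and dss: "\<And>s r. 0 < s \<Longrightarrow> 0 < r \<Longrightarrow> ((\<lambda>s. \<Psi>s (s, r)) has_real_derivative \<Psi>ss (s, r)) (at s)"
    and dr: "\<And>s r. 0 < s \<Longrightarrow> 0 < r \<Longrightarrow> ((\<lambda>r. \<Psi> (s, r)) has_real_derivative \<Psi>r (s, r)) (at r)"
    and cont: "continuous_on ({0<..} \<times> {0<..}) \<Psi>s" "continuous_on ({0<..} \<times> {0<..}) \<Psi>ss"
      "continuous_on ({0<..} \<times> {0<..}) \<Psi>r"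
begin

abbreviation "q x y \<equiv> x\<^sup>2 + y\<^sup>2 :: real"

lemma q_pos: "0 < y \<Longrightarrow> 0 < q x y" by (simp add: add_nonneg_pos)

lemma heat: "heat_function (\<lambda>(x, y, r). \<Psi> (sin_sq x y, r))
   (\<lambda>(x, y, r). \<Psi>s (sin_sq x y, r) * (- 2 * x * y\<^sup>2 / (q x y)\<^sup>2))
   (\<lambda>(x, y, r). \<Psi>ss (sin_sq x y, r) * (- 2 * x * y\<^sup>2 / (q x y)\<^sup>2)\<^sup>2
      + \<Psi>s (sin_sq x y, r) * (8 * x\<^sup>2 * y\<^sup>2 / q x y ^ 3 - 2 * y\<^sup>2 / (q x y)\<^sup>2))
   (\<lambda>(x, y, r). \<Psi>s (sin_sq x y, r) * (2 * y * x\<^sup>2 / (q x y)\<^sup>2))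
   (\<lambda>(x, y, r). \<Psi>r (sin_sq x y, r))"
proof
  fix x y r :: real assume y: "0 < y" and r: "0 < r"
  note qp = q_pos[OF y, of x] and sp = sin_sq_pos[OF y, of x]
  have sx: "((\<lambda>x. sin_sq x y) has_real_derivative - 2 * x * y\<^sup>2 / (q x y)\<^sup>2) (at x)"
    unfolding sin_sq_def using qp by (auto intro!: derivative_eq_intros simp: power2_eq_square)
  have sxx: "((\<lambda>x. - 2 * x * y\<^sup>2 / (q x y)\<^sup>2) has_real_derivative 8 * x\<^sup>2 * y\<^sup>2 / q x y ^ 3 - 2 * y\<^sup>2 / (q x y)\<^sup>2) (at x)"
  proof -
    have iv: "((\<lambda>x. inverse (q x y)) has_real_derivative - (2 * x * (inverse (q x y))\<^sup>2)) (at x)"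
      by (rule derivative_eq_intros refl less_imp_neq[OF qp, symmetric])+ (simp add: power2_eq_square)
    have "((\<lambda>x. - 2 * x * y\<^sup>2 * (inverse (q x y))\<^sup>2) has_real_derivative
        8 * x\<^sup>2 * y\<^sup>2 * (inverse (q x y)) ^ 3 - 2 * y\<^sup>2 * (inverse (q x y))\<^sup>2) (at x)"
      by (rule derivative_eq_intros refl iv)+ (simp add: power2_eq_square power3_eq_cube)
    then show ?thesis by (simp only: divide_inverse power_inverse)
  qed
  have sy: "((\<lambda>y. sin_sq x y) has_real_derivative 2 * y * x\<^sup>2 / (q x y)\<^sup>2) (at y)"
    unfolding sin_sq_def using qp by (auto intro!: derivative_eq_intros) (simp add: field_simps power2_eq_square)
  show "((\<lambda>x. case (x, y, r) of (x, y, r) \<Rightarrow> \<Psi> (sin_sq x y, r)) has_real_derivative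
      (case (x, y, r) of (x, y, r) \<Rightarrow> \<Psi>s (sin_sq x y, r) * (- 2 * x * y\<^sup>2 / (q x y)\<^sup>2))) (at x)"
    using DERIV_chain2[OF ds[OF sp r] sx] by simp
  show "((\<lambda>y. case (x, y, r) of (x, y, r) \<Rightarrow> \<Psi> (sin_sq x y, r)) has_real_derivative
      (case (x, y, r) of (x, y, r) \<Rightarrow> \<Psi>s (sin_sq x y, r) * (2 * y * x\<^sup>2 / (q x y)\<^sup>2))) (at y)"
    using DERIV_chain2[OF ds[OF sp r] sy] by simp
  show "((\<lambda>r. case (x, y, r) of (x, y, r) \<Rightarrow> \<Psi> (sin_sq x y, r)) has_real_derivative
      (case (x, y, r) of (x, y, r) \<Rightarrow> \<Psi>r (sin_sq x y, r))) (at r)"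
    using dr[OF sp r] by simp
  show "((\<lambda>x. case (x, y, r) of (x, y, r) \<Rightarrow> \<Psi>s (sin_sq x y, r) * (- 2 * x * y\<^sup>2 / (q x y)\<^sup>2)) has_real_derivative
      (case (x, y, r) of (x, y, r) \<Rightarrow> \<Psi>ss (sin_sq x y, r) * (- 2 * x * y\<^sup>2 / (q x y)\<^sup>2)\<^sup>2
        + \<Psi>s (sin_sq x y, r) * (8 * x\<^sup>2 * y\<^sup>2 / q x y ^ 3 - 2 * y\<^sup>2 / (q x y)\<^sup>2))) (at x)"
    unfolding prod.case by (rule DERIV_cong[OF DERIV_mult[OF DERIV_chain2[OF dss[OF sp r] sx] sxx]]) (simp add: power2_eq_square algebra_simps)
next
  let ?\<Omega> = "UNIV \<times> {0<..} \<times> {0<..} :: (real \<times> real \<times> real) set"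
  have qn: "(fst p)\<^sup>2 + (fst (snd p))\<^sup>2 \<noteq> 0" if "p \<in> ?\<Omega>" for p :: "real \<times> real \<times> real"
    using that q_pos[of "fst (snd p)" "fst p"] by (auto simp: mem_Times_iff)
  have s: "continuous_on ?\<Omega> (\<lambda>p. (sin_sq (fst p) (fst (snd p)), snd (snd p)))"
    unfolding sin_sq_def using qn by (intro continuous_intros) auto
  have G: "continuous_on ?\<Omega> (\<lambda>p. G (sin_sq (fst p) (fst (snd p)), snd (snd p)))"
    if "continuous_on ({0<..} \<times> {0<..}) G" for G :: "real \<times> real \<Rightarrow> real"
    by (rule continuous_on_compose2[OF that s]) (auto intro: sin_sq_pos)
  show "continuous_on ?\<Omega> (\<lambda>(x, y, r). \<Psi>s (sin_sq x y, r) * (- 2 * x * y\<^sup>2 / (q x y)\<^sup>2))"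
    unfolding case_prod_beta using qn by (intro continuous_intros G cont) auto
  show "continuous_on ?\<Omega> (\<lambda>(x, y, r). \<Psi>ss (sin_sq x y, r) * (- 2 * x * y\<^sup>2 / (q x y)\<^sup>2)\<^sup>2
      + \<Psi>s (sin_sq x y, r) * (8 * x\<^sup>2 * y\<^sup>2 / q x y ^ 3 - 2 * y\<^sup>2 / (q x y)\<^sup>2))"
    unfolding case_prod_beta using qn by (intro continuous_intros G cont) auto
  show "continuous_on ?\<Omega> (\<lambda>(x, y, r). \<Psi>s (sin_sq x y, r) * (2 * y * x\<^sup>2 / (q x y)\<^sup>2))"
    unfolding case_prod_beta using qn by (intro continuous_intros G cont) auto
  show "continuous_on ?\<Omega> (\<lambda>(x, y, r). \<Psi>r (sin_sq x y, r))"
    unfolding case_prod_beta by (intro G cont)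
qed

text \<open>On functions of the angle and r the generator of the centred flow is the radial speed
  y^2 / (x^2 + y^2)^2 times a one-dimensional operator. The positive factor is the change of time to
  the clock, so the sign condition involves s and r alone.\<close>

lemma gaussian_step_angular:
  assumes K: "0 < \<delta>" "0 < \<eta>"
    and a: "4 * a = 1 + 2 * m"
    and bound: "\<And>s r. 0 < s \<Longrightarrow> s \<le> 1 \<Longrightarrow> 0 < r \<Longrightarrow> r \<le> r1 \<Longrightarrow> \<bar>\<Psi> (s, r)\<bar> \<le> M"
    and gen: "\<And>s r. 0 < s \<Longrightarrow> s \<le> 1 \<Longrightarrow> 0 < r \<Longrightarrow>
      2 * s * (1 - s) * \<Psi>ss (s, r) + (2 * (1 - m) - (3 - 2 * m) * s) * \<Psi>s (s, r) - \<Psi>r (s, r) < 0"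
  shows "\<exists>h0>0. \<forall>h\<in>{0<..h0}. \<forall>x y r. \<bar>x\<bar> \<le> X \<longrightarrow> \<delta> \<le> y \<longrightarrow> y \<le> Y \<longrightarrow> \<eta> \<le> r \<longrightarrow> r \<le> r1 \<longrightarrow>
    integrable lborel (\<lambda>n. std_normal_density n *
      \<Psi> (sin_sq (x + h * (a * x / q x y) + sqrt h * n) (y + h * (- a * y / q x y)), r + h * (- y\<^sup>2 / (q x y)\<^sup>2))) \<and>
    (\<integral>n. std_normal_density n *
      \<Psi> (sin_sq (x + h * (a * x / q x y) + sqrt h * n) (y + h * (- a * y / q x y)), r + h * (- y\<^sup>2 / (q x y)\<^sup>2)) \<partial>lborel)
      \<le> \<Psi> (sin_sq x y, r)"
proof -
  define K where "K = {-X..X} \<times> {\<delta>..Y} \<times> {\<eta>..r1}"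
  interpret heat_function "\<lambda>(x, y, r). \<Psi> (sin_sq x y, r)"
   "\<lambda>(x, y, r). \<Psi>s (sin_sq x y, r) * (- 2 * x * y\<^sup>2 / (q x y)\<^sup>2)"
   "\<lambda>(x, y, r). \<Psi>ss (sin_sq x y, r) * (- 2 * x * y\<^sup>2 / (q x y)\<^sup>2)\<^sup>2
      + \<Psi>s (sin_sq x y, r) * (8 * x\<^sup>2 * y\<^sup>2 / q x y ^ 3 - 2 * y\<^sup>2 / (q x y)\<^sup>2)"
   "\<lambda>(x, y, r). \<Psi>s (sin_sq x y, r) * (2 * y * x\<^sup>2 / (q x y)\<^sup>2)"
   "\<lambda>(x, y, r). \<Psi>r (sin_sq x y, r)" by (rule heat)
  have qn: "(fst p)\<^sup>2 + (fst (snd p))\<^sup>2 \<noteq> 0" if "p \<in> K" for p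
    using that q_pos[of "fst (snd p)" "fst p"] K by (auto simp: K_def mem_Times_iff)
  have "\<exists>h0>0. \<forall>h\<in>{0<..h0}. \<forall>(x, y, r)\<in>K.
    integrable lborel (\<lambda>n. std_normal_density n * (\<lambda>(x, y, r). \<Psi> (sin_sq x y, r))
      (x + h * (\<lambda>(x, y, r). a * x / q x y) (x, y, r) + sqrt h * n, y + h * (\<lambda>(x, y, r). - a * y / q x y) (x, y, r),
       r + h * (\<lambda>(x, y, r). - y\<^sup>2 / (q x y)\<^sup>2) (x, y, r))) \<and>
    (\<integral>n. std_normal_density n * (\<lambda>(x, y, r). \<Psi> (sin_sq x y, r))
      (x + h * (\<lambda>(x, y, r). a * x / q x y) (x, y, r) + sqrt h * n, y + h * (\<lambda>(x, y, r). - a * y / q x y) (x, y, r),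
       r + h * (\<lambda>(x, y, r). - y\<^sup>2 / (q x y)\<^sup>2) (x, y, r)) \<partial>lborel)
      \<le> (\<lambda>(x, y, r). \<Psi> (sin_sq x y, r)) (x, y, r)"
  proof (rule gaussian_step[where ?r1.0 = r1 and M = M])
    show "compact K" unfolding K_def by (intro compact_Times) auto
    show "K \<subseteq> UNIV \<times> {0<..} \<times> {0<..r1}" using K by (auto simp: K_def)
    show "continuous_on K (\<lambda>(x, y, r). a * x / q x y)" "continuous_on K (\<lambda>(x, y, r). - a * y / q x y)"
      "continuous_on K (\<lambda>(x, y, r). - y\<^sup>2 / (q x y)\<^sup>2)"
      unfolding case_prod_beta by (intro continuous_intros ballI power_not_zero qn; assumption)+
    show "(\<lambda>(x, y, r). - y\<^sup>2 / (q x y)\<^sup>2) p \<le> 0" for p by (auto simp: case_prod_beta)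
    show "\<bar>(\<lambda>(x, y, r). \<Psi> (sin_sq x y, r)) (x, y, r)\<bar> \<le> M" if "0 < y" "0 < r" "r \<le> r1" for x y r
      using bound[OF sin_sq_pos[OF that(1)] sin_sq_le_1 that(2,3)] by simp
  next
    fix p assume p: "p \<in> K"
    obtain x y r where p_eq: "p = (x, y, r)" by (cases p)
    have y: "0 < y" and r: "0 < r" using p K by (auto simp: p_eq K_def)
    note qp = q_pos[OF y, of x]
    let ?s = "sin_sq x y"
    have "1 - c / Q = (Q - c) / Q" if "0 < Q" for c Q :: real using that by (simp add: field_simps)
    from this[OF qp, of "y\<^sup>2"] have s1: "1 - ?s = x\<^sup>2 / q x y"
      by (simp only: sin_sq_def add_diff_cancel_right')
    let ?g = "2 * ?s * (1 - ?s) * \<Psi>ss (?s, r) + (2 * (1 - m) - (3 - 2 * m) * ?s) * \<Psi>s (?s, r) - \<Psi>r (?s, r)"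
    have 1: "(- 2 * x * y\<^sup>2 / (q x y)\<^sup>2)\<^sup>2 / 2 = y\<^sup>2 / (q x y)\<^sup>2 * (2 * ?s * (1 - ?s))"
    proof -
      have "(- 2 * x * y\<^sup>2 / Q\<^sup>2)\<^sup>2 / 2 = y\<^sup>2 / Q\<^sup>2 * (2 * (y\<^sup>2 / Q) * (x\<^sup>2 / Q))" for Q
        unfolding divide_inverse power2_eq_square by simp
      then show ?thesis unfolding s1 unfolding sin_sq_def by blast
    qed
    have 2: "a * x / q x y * (- 2 * x * y\<^sup>2 / (q x y)\<^sup>2) + - a * y / q x y * (2 * y * x\<^sup>2 / (q x y)\<^sup>2)
        + (8 * x\<^sup>2 * y\<^sup>2 / q x y ^ 3 - 2 * y\<^sup>2 / (q x y)\<^sup>2) / 2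
      = y\<^sup>2 / (q x y)\<^sup>2 * (2 * (1 - m) - (3 - 2 * m) * ?s)"
    proof -
      \<comment> \<open>The only place where a and m have to match: with 4 a = 1 + 2 m the drift
        coefficient becomes an expression in 1 - s = x^2 / (x^2 + y^2).\<close>
      have "2 * (1 - m) - (3 - 2 * m) * ?s = 4 * (1 - ?s) - 4 * a * (1 - ?s) - 1"
        unfolding a by (simp add: algebra_simps)
      also have "\<dots> = 4 * (x\<^sup>2 / q x y) - 4 * a * (x\<^sup>2 / q x y) - 1" unfolding s1 ..
      finally have gen: "2 * (1 - m) - (3 - 2 * m) * ?s = 4 * (x\<^sup>2 / q x y) - 4 * a * (x\<^sup>2 / q x y) - 1" .
      have "a * x / Q * (- 2 * x * y\<^sup>2 / Q\<^sup>2) + - a * y / Q * (2 * y * x\<^sup>2 / Q\<^sup>2)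
        + (8 * x\<^sup>2 * y\<^sup>2 / Q ^ 3 - 2 * y\<^sup>2 / Q\<^sup>2) / 2 = y\<^sup>2 / Q\<^sup>2 * (4 * (x\<^sup>2 / Q) - 4 * a * (x\<^sup>2 / Q) - 1)"
        for Q
        unfolding divide_inverse power2_eq_square power3_eq_cube inverse_mult_distrib by (simp add: algebra_simps)
      then show ?thesis unfolding gen by blast
    qed
    have distrib: "A * (P * D) + B * (P * D') + C + (S * T + P * U) / 2 = S * (T / 2) + P * (A * D + B * D' + U / 2) + C"
      for A B C D D' P S T U :: real
      by (simp add: algebra_simps add_divide_distrib)
    have "a * x / q x y * (\<Psi>s (?s, r) * (- 2 * x * y\<^sup>2 / (q x y)\<^sup>2))
        + - a * y / q x y * (\<Psi>s (?s, r) * (2 * y * x\<^sup>2 / (q x y)\<^sup>2))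
        + - y\<^sup>2 / (q x y)\<^sup>2 * \<Psi>r (?s, r)
        + (\<Psi>ss (?s, r) * (- 2 * x * y\<^sup>2 / (q x y)\<^sup>2)\<^sup>2
      + \<Psi>s (?s, r) * (8 * x\<^sup>2 * y\<^sup>2 / q x y ^ 3 - 2 * y\<^sup>2 / (q x y)\<^sup>2)) / 2
      = \<Psi>ss (?s, r) * ((- 2 * x * y\<^sup>2 / (q x y)\<^sup>2)\<^sup>2 / 2)
        + \<Psi>s (?s, r) * (a * x / q x y * (- 2 * x * y\<^sup>2 / (q x y)\<^sup>2) + - a * y / q x y * (2 * y * x\<^sup>2 / (q x y)\<^sup>2)
        + (8 * x\<^sup>2 * y\<^sup>2 / q x y ^ 3 - 2 * y\<^sup>2 / (q x y)\<^sup>2) / 2) + - y\<^sup>2 / (q x y)\<^sup>2 * \<Psi>r (?s, r)"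
      by (rule distrib)
    also have "\<dots> = y\<^sup>2 / (q x y)\<^sup>2 * ?g"
    proof -
      have "S * (c * X) + P * (c * Y) + - c * R = c * (X * S + Y * P - R)" for c X Y S P R :: real
        by (simp add: algebra_simps)
      then show ?thesis unfolding 1 2 minus_divide_left[symmetric] .
    qed
    also have "\<dots> < 0"
      using gen[OF sin_sq_pos[OF y] sin_sq_le_1 r] y qp by (intro mult_pos_neg) auto
    finally show "(\<lambda>(x, y, r). a * x / q x y) p * (\<lambda>(x, y, r). \<Psi>s (sin_sq x y, r) * (- 2 * x * y\<^sup>2 / (q x y)\<^sup>2)) p
       + (\<lambda>(x, y, r). - a * y / q x y) p * (\<lambda>(x, y, r). \<Psi>s (sin_sq x y, r) * (2 * y * x\<^sup>2 / (q x y)\<^sup>2)) p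
       + (\<lambda>(x, y, r). - y\<^sup>2 / (q x y)\<^sup>2) p * (\<lambda>(x, y, r). \<Psi>r (sin_sq x y, r)) p
       + (\<lambda>(x, y, r). \<Psi>ss (sin_sq x y, r) * (- 2 * x * y\<^sup>2 / (q x y)\<^sup>2)\<^sup>2
      + \<Psi>s (sin_sq x y, r) * (8 * x\<^sup>2 * y\<^sup>2 / q x y ^ 3 - 2 * y\<^sup>2 / (q x y)\<^sup>2)) p / 2 < 0"
      unfolding p_eq prod.case .
  qed
  then show ?thesis by (auto simp: K_def abs_le_iff)
qed

end

section \<open>The two potentials and the signs of their generators\<close>

definition far_potential :: "real \<Rightarrow> real \<Rightarrow> real \<times> real \<Rightarrow> real" where
  "far_potential m c = (\<lambda>(s, r). exp (- c * r) * s powr m)"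

text \<open>A boundary layer: comparable to (s / r) powr m while s is small against r, so that it
  matches the eigenfunction, and tending to 1 as r tends to 0 with s fixed. The growth factor with
  rate n pays for the lower-order terms.\<close>

definition near_potential :: "real \<Rightarrow> real \<Rightarrow> real \<times> real \<Rightarrow> real" where
  "near_potential m n = (\<lambda>(s, r). exp (n * r) * (1 - exp (- s / r)) powr m)"

lemma far_potential_angular:
  "angular_function (far_potential m c)
    (\<lambda>(s, r). exp (- c * r) * (m * s powr (m - 1)))
    (\<lambda>(s, r). exp (- c * r) * (m * ((m - 1) * s powr (m - 2))))
    (\<lambda>(s, r). - c * (exp (- c * r) * s powr m))"
proof
  fix s r :: real assume s: "0 < s" and r: "0 < r"
  show "((\<lambda>s. far_potential m c (s, r)) has_real_derivative (case (s, r) of (s, r) \<Rightarrow> exp (- c * r) * (m * s powr (m - 1)))) (at s)"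
    unfolding far_potential_def prod.case using s by (auto intro!: derivative_eq_intros)
  show "((\<lambda>s. case (s, r) of (s, r) \<Rightarrow> exp (- c * r) * (m * s powr (m - 1))) has_real_derivative
      (case (s, r) of (s, r) \<Rightarrow> exp (- c * r) * (m * ((m - 1) * s powr (m - 2))))) (at s)"
    unfolding prod.case using s by (auto intro!: derivative_eq_intros)
  show "((\<lambda>r. far_potential m c (s, r)) has_real_derivative (case (s, r) of (s, r) \<Rightarrow> - c * (exp (- c * r) * s powr m))) (at r)"
    unfolding far_potential_def prod.case by (auto intro!: derivative_eq_intros)
qed (auto simp: case_prod_beta intro!: continuous_intros)

lemma near_potential_angular:
  "angular_function (near_potential m n)
    (\<lambda>(s, r). exp (n * r) * (m * (1 - exp (- s / r)) powr (m - 1) * (exp (- s / r) / r)))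
    (\<lambda>(s, r). exp (n * r) * (m * ((m - 1) * (1 - exp (- s / r)) powr (m - 2) * (exp (- s / r) / r) * (exp (- s / r) / r)
        - (1 - exp (- s / r)) powr (m - 1) * (exp (- s / r) / r / r))))
    (\<lambda>(s, r). n * (exp (n * r) * (1 - exp (- s / r)) powr m)
        + exp (n * r) * (m * (1 - exp (- s / r)) powr (m - 1) * - (exp (- s / r) * (s / r\<^sup>2))))"
proof
  fix s r :: real assume s: "0 < s" and r: "0 < r"
  have g: "0 < 1 - exp (- s / r)" using s r by simp
  have Es: "((\<lambda>s. exp (- s / r)) has_real_derivative - (exp (- s / r) / r)) (at s)"
    using r by (auto intro!: derivative_eq_intros)
  have Er: "((\<lambda>r. exp (- s / r)) has_real_derivative exp (- s / r) * (s / r\<^sup>2)) (at r)"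
    using r by (auto intro!: derivative_eq_intros simp: power2_eq_square)
  have P: "((\<lambda>x. (1 - E x) powr k) has_real_derivative k * (1 - E x) powr (k - 1) * - D) (at x)"
    if "(E has_real_derivative D) (at x)" "0 < 1 - E x" for E D x k
    using that by (auto intro!: derivative_eq_intros)
  show "((\<lambda>s. near_potential m n (s, r)) has_real_derivative
      (case (s, r) of (s, r) \<Rightarrow> exp (n * r) * (m * (1 - exp (- s / r)) powr (m - 1) * (exp (- s / r) / r)))) (at s)"
    unfolding near_potential_def prod.case using DERIV_cmult[OF P[OF Es g, of m], of "exp (n * r)"] by simp
  have D: "((\<lambda>s. (1 - exp (- s / r)) powr (m - 1) * (exp (- s / r) / r)) has_real_derivative
     ((m - 1) * (1 - exp (- s / r)) powr (m - 2) * (exp (- s / r) / r) * (exp (- s / r) / r)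
        - (1 - exp (- s / r)) powr (m - 1) * (exp (- s / r) / r / r))) (at s)"
    by (rule DERIV_cong[OF DERIV_mult[OF P[OF Es g, of "m - 1"] DERIV_cdivide[OF Es, of r]]]) simp
  show "((\<lambda>s. case (s, r) of (s, r) \<Rightarrow> exp (n * r) * (m * (1 - exp (- s / r)) powr (m - 1) * (exp (- s / r) / r))) has_real_derivative
      (case (s, r) of (s, r) \<Rightarrow> exp (n * r) * (m * ((m - 1) * (1 - exp (- s / r)) powr (m - 2) * (exp (- s / r) / r) * (exp (- s / r) / r)
        - (1 - exp (- s / r)) powr (m - 1) * (exp (- s / r) / r / r))))) (at s)"
    unfolding prod.case using DERIV_cmult[OF DERIV_cmult[OF D, of m], of "exp (n * r)"] by (simp only: mult.assoc)
  have R: "((\<lambda>r. exp (n * r)) has_real_derivative n * exp (n * r)) (at r)"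
    by (auto intro!: derivative_eq_intros)
  show "((\<lambda>r. near_potential m n (s, r)) has_real_derivative
      (case (s, r) of (s, r) \<Rightarrow> n * (exp (n * r) * (1 - exp (- s / r)) powr m)
        + exp (n * r) * (m * (1 - exp (- s / r)) powr (m - 1) * - (exp (- s / r) * (s / r\<^sup>2))))) (at r)"
    unfolding near_potential_def prod.case
    by (rule DERIV_cong[OF DERIV_mult[OF R P[OF Er g, of m]]]) simp
qed (auto simp: case_prod_beta intro!: continuous_intros)

text \<open>The angular operator multiplies \<open>s powr m\<close> by - m, and the decreasing clock
  contributes c, so the whole expression is c - m times the potential.\<close>

lemma far_potential_generator:
  fixes s r m c :: real
  assumes s: "0 < s" and c: "c < m"
  shows "2 * s * (1 - s) * (exp (- c * r) * (m * ((m - 1) * s powr (m - 2))))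
    + (2 * (1 - m) - (3 - 2 * m) * s) * (exp (- c * r) * (m * s powr (m - 1)))
    - - c * (exp (- c * r) * s powr m) < 0"
proof -
  have 1: "s powr (m - 1) = s * s powr (m - 2)"
    using powr_add[of s 1 "m - 2"] s by simp
  have 2: "s powr m = s * s * s powr (m - 2)"
    using powr_add[of s 2 "m - 2"] s by (simp add: power2_eq_square)
  have "2 * s * (1 - s) * (exp (- c * r) * (m * ((m - 1) * s powr (m - 2))))
    + (2 * (1 - m) - (3 - 2 * m) * s) * (exp (- c * r) * (m * s powr (m - 1)))
    - - c * (exp (- c * r) * s powr m) = (c - m) * (exp (- c * r) * s powr m)"
    unfolding 1 2 by (simp add: algebra_simps)
  also have "\<dots> < 0" using s c by (intro mult_neg_pos) auto
  finally show ?thesis .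
qed

text \<open>In the variable t = s / r the positive factor exp (n r) g powr (m - 2) * (m E / r)
  splits off, and what is left is the expression of \<open>layer_inequality\<close>.\<close>

lemma near_potential_generator:
  fixes s r m n :: real
  assumes s: "0 < s" "s \<le> 1" and r: "0 < r" and m: "0 < m" and n: "2 * m * (1 + m) < n"
  shows "2 * s * (1 - s) * (exp (n * r) * (m * ((m - 1) * (1 - exp (- s / r)) powr (m - 2) * (exp (- s / r) / r) * (exp (- s / r) / r)
        - (1 - exp (- s / r)) powr (m - 1) * (exp (- s / r) / r / r))))
    + (2 * (1 - m) - (3 - 2 * m) * s) * (exp (n * r) * (m * (1 - exp (- s / r)) powr (m - 1) * (exp (- s / r) / r)))
    - (n * (exp (n * r) * (1 - exp (- s / r)) powr m)
        + exp (n * r) * (m * (1 - exp (- s / r)) powr (m - 1) * - (exp (- s / r) * (s / r\<^sup>2)))) < 0" (is "?L < 0")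
proof -
  define t where "t = s / r"
  define E where "E = exp (- t)"
  define g where "g = 1 - E"
  have E_eq: "exp (- s / r) = E" by (simp only: E_def t_def minus_divide_left)
  have E: "0 < E" by (simp add: E_def)
  have g: "0 < g" using s r by (simp add: g_def E_def t_def)
  have 1: "g powr (m - 1) = g * g powr (m - 2)" using powr_add[of g 1 "m - 2"] g by simp
  have 2: "g powr m = g\<^sup>2 * g powr (m - 2)" using powr_add[of g 2 "m - 2"] g by simp
  have mE: "m * E - 1 = (m - 1) * E - g" by (simp add: g_def algebra_simps)
  have cancel: "n * r / m * (g\<^sup>2 / E) * (m * E / r) = n * g\<^sup>2" using m E r by simp
  have "?L = exp (n * r) * g powr (m - 2) * (2 * s * (1 - s) * (m * (((m - 1) * E - g) * (E / r / r)))
      + (2 * (1 - m) - (3 - 2 * m) * s) * (m * g * (E / r)) - n * g\<^sup>2 + m * g * (E * (s / r\<^sup>2)))"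
  proof -
    have t1: "S * (e * (m * ((m - 1) * G * F * F - g * G * H))) = e * G * (S * (m * (((m - 1) * E - g) * H)))"
      if "F * F = E * H" for S e G F H :: real
    proof -
      have "(m - 1) * G * F * F = (m - 1) * G * (E * H)" by (simp only: mult.assoc that)
      then show ?thesis by (simp add: left_diff_distrib right_diff_distrib mult_ac)
    qed
    have t2: "Q * (e * (m * (g * G) * F)) = e * G * (Q * (m * g * F))" for Q e G F :: real by (simp add: mult_ac)
    have t3: "n * (e * (g\<^sup>2 * G)) + e * (m * (g * G) * - W) = e * G * (n * g\<^sup>2 - m * g * W)" for e G W :: real
      by (simp add: right_diff_distrib mult_ac)
    have "E / r * (E / r) = E * (E / r / r)" by simp
    then show ?thesis
      unfolding E_eq g_def[symmetric] 1 2 t1[OF \<open>E / r * (E / r) = E * (E / r / r)\<close>] t2 t3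
      by (simp only: right_diff_distrib[symmetric] distrib_left[symmetric]) simp
  qed
  also have "2 * s * (1 - s) * (m * (((m - 1) * E - g) * (E / r / r)))
      + (2 * (1 - m) - (3 - 2 * m) * s) * (m * g * (E / r)) - n * g\<^sup>2 + m * g * (E * (s / r\<^sup>2))
    = (2 * t * (1 - s) * (m * E - 1) + (2 * (1 - m) - (3 - 2 * m) * s) * g + g * t - n * r / m * (g\<^sup>2 / E)) * (m * E / r)"
  proof -
    have a: "2 * s * v * (m * (D * (E / r / r))) = 2 * (s / r) * v * D * (m * E / r)" for v D :: real
      by simp
    have b: "K * (m * g * (E / r)) = K * g * (m * E / r)" for K :: real
      by simp
    have c: "m * g * (E * (s / r\<^sup>2)) = g * (s / r) * (m * E / r)"
      by (simp add: power2_eq_square)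
    show ?thesis unfolding a b c mE t_def unfolding cancel[symmetric] by (simp only: distrib_right left_diff_distrib)
  qed
  also have "exp (n * r) * g powr (m - 2) *
    ((2 * t * (1 - s) * (m * E - 1) + (2 * (1 - m) - (3 - 2 * m) * s) * g + g * t - n * r / m * (g\<^sup>2 / E)) * (m * E / r)) < 0"
    using layer_inequality[OF s r m n t_def] g m E r unfolding E_def[symmetric] g_def[symmetric]
    by (intro mult_pos_neg mult_neg_pos mult_pos_pos divide_pos_pos) auto
  finally show ?thesis .
qed

section \<open>Potentials along one Euler step\<close>

definition euler_step :: "real \<Rightarrow> real \<Rightarrow> complex \<times> real \<Rightarrow> real \<Rightarrow> complex \<times> real" where
  "euler_step a h p \<xi> = (fst p + of_real (a * h) / fst p - of_real \<xi>, snd p - h * radial_speed (fst p))"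

definition on_angle :: "(real \<times> real \<Rightarrow> real) \<Rightarrow> complex \<times> real \<Rightarrow> real" where
  "on_angle \<Psi> p = \<Psi> (sin_sq (Re (fst p)) (Im (fst p)), snd p)"

lemma euler_step_coordinates:
  "euler_step a h (z, r) \<xi> =
    (Complex (Re z + h * (a * Re z / ((Re z)\<^sup>2 + (Im z)\<^sup>2)) - \<xi>) (Im z + h * (- a * Im z / ((Re z)\<^sup>2 + (Im z)\<^sup>2))),
     r + h * (- (Im z)\<^sup>2 / ((Re z)\<^sup>2 + (Im z)\<^sup>2)\<^sup>2))"
proof -
  have "radial_speed z = (Im z)\<^sup>2 / ((Re z)\<^sup>2 + (Im z)\<^sup>2)\<^sup>2"
    unfolding radial_speed_def cmod_power2[symmetric] by (simp flip: power_mult)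
  then show ?thesis
    by (simp add: euler_step_def complex_eq_iff Re_divide Im_divide algebra_simps)
qed

text \<open>The substitution \<xi> = - \<open>sqrt h\<close> n turns the Gaussian of variance h into
  the standard one. The sign appears because the state is g - U, so increments of the driving
  function are subtracted.\<close>

lemma (in angular_function) nn_integral_euler_step:
  assumes K: "0 < \<delta>" "0 < \<eta>"
    and a: "4 * a = 1 + 2 * m"
    and bound: "\<And>s r. 0 < s \<Longrightarrow> s \<le> 1 \<Longrightarrow> 0 < r \<Longrightarrow> r \<le> r1 \<Longrightarrow> \<Psi> (s, r) \<le> M"
    and nonneg: "\<And>p. 0 \<le> \<Psi> p"
    and gen: "\<And>s r. 0 < s \<Longrightarrow> s \<le> 1 \<Longrightarrow> 0 < r \<Longrightarrow>
      2 * s * (1 - s) * \<Psi>ss (s, r) + (2 * (1 - m) - (3 - 2 * m) * s) * \<Psi>s (s, r) - \<Psi>r (s, r) < 0"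
  shows "\<exists>h0>0. \<forall>h\<in>{0<..h0}. \<forall>z r. \<bar>Re z\<bar> \<le> X \<longrightarrow> \<delta> \<le> Im z \<longrightarrow> Im z \<le> Y \<longrightarrow> \<eta> \<le> r \<longrightarrow> r \<le> r1 \<longrightarrow>
    (\<integral>\<^sup>+\<xi>. ennreal (normal_density 0 (sqrt h) \<xi>) * ennreal (on_angle \<Psi> (euler_step a h (z, r) \<xi>)) \<partial>lborel)
      \<le> ennreal (on_angle \<Psi> (z, r))"
proof -
  define N where "N h x y r n = \<Psi> (sin_sq (x + h * (a * x / q x y) + sqrt h * n) (y + h * (- a * y / q x y)), r + h * (- y\<^sup>2 / (q x y)\<^sup>2))"
    for h x y r n
  have "\<exists>h0>0. \<forall>h\<in>{0<..h0}. \<forall>x y r. \<bar>x\<bar> \<le> X \<longrightarrow> \<delta> \<le> y \<longrightarrow> y \<le> Y \<longrightarrow> \<eta> \<le> r \<longrightarrow> r \<le> r1 \<longrightarrow>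
    integrable lborel (\<lambda>n. std_normal_density n * N h x y r n) \<and>
    (\<integral>n. std_normal_density n * N h x y r n \<partial>lborel) \<le> \<Psi> (sin_sq x y, r)"
    unfolding N_def using bound nonneg by (intro gaussian_step_angular[OF K a _ gen, of r1 M]) auto
  then obtain h0 where h0: "0 < h0" and step: "\<And>h x y r. 0 < h \<Longrightarrow> h \<le> h0 \<Longrightarrow> \<bar>x\<bar> \<le> X \<Longrightarrow> \<delta> \<le> y \<Longrightarrow> y \<le> Y \<Longrightarrow> \<eta> \<le> r \<Longrightarrow> r \<le> r1 \<Longrightarrow>
    integrable lborel (\<lambda>n. std_normal_density n * N h x y r n) \<and>
    (\<integral>n. std_normal_density n * N h x y r n \<partial>lborel) \<le> \<Psi> (sin_sq x y, r)"
    by (metis greaterThanAtMost_iff)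
  show ?thesis
  proof (intro exI[of _ h0] conjI h0 ballI allI impI)
    fix h z r assume h: "h \<in> {0<..h0}" and z: "\<bar>Re z\<bar> \<le> X" "\<delta> \<le> Im z" "Im z \<le> Y" "\<eta> \<le> r" "r \<le> r1"
    let ?f = "\<lambda>\<xi>. ennreal (normal_density 0 (sqrt h) \<xi> * on_angle \<Psi> (euler_step a h (z, r) \<xi>))"
    have hp: "0 < h" using h by simp
    note st = step[OF hp _ z] 
    have eq: "ennreal (sqrt h) * ?f (- sqrt h * n) = ennreal (std_normal_density n * N h (Re z) (Im z) r n)" for n
    proof -
      have "sqrt h * normal_density 0 (sqrt h) (- sqrt h * n) = std_normal_density n"
        using hp by (simp add: normal_density_def power_mult_distrib real_sqrt_mult)
      moreover have "on_angle \<Psi> (euler_step a h (z, r) (- sqrt h * n)) = N h (Re z) (Im z) r n"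
        by (simp add: on_angle_def euler_step_coordinates N_def)
      ultimately have "sqrt h * (normal_density 0 (sqrt h) (- sqrt h * n) * on_angle \<Psi> (euler_step a h (z, r) (- sqrt h * n)))
        = std_normal_density n * N h (Re z) (Im z) r n" by (simp flip: mult.assoc)
      then show ?thesis using hp by (subst ennreal_mult'[symmetric]) auto
    qed
    have m1: "(\<lambda>n. ennreal (std_normal_density n * N h (Re z) (Im z) r n)) \<in> borel_measurable borel"
      using borel_measurable_integrable[OF st[THEN conjunct1]] h by simp
    have "(\<lambda>n. ennreal (sqrt h) * ?f (- sqrt h * n)) \<in> borel_measurable borel"
      unfolding eq using m1 .
    \<comment> \<open>The potential is not assumed measurable; measurability of the integrand is
      recovered from integrability of its rescaled form.\<close>
    then have m2: "(\<lambda>\<xi>. ennreal (sqrt h) * ?f (- sqrt h * (- \<xi> / sqrt h))) \<in> borel_measurable borel"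
      by (rule measurable_compose[rotated]) simp
    have m3: "?f \<in> borel_measurable borel"
    proof -
      have [measurable]: "(\<lambda>\<xi>. ennreal (sqrt h) * ?f \<xi>) \<in> borel_measurable borel"
        using m2 hp by simp
      have "(\<lambda>\<xi>. ennreal (1 / sqrt h) * (ennreal (sqrt h) * ?f \<xi>)) \<in> borel_measurable borel"
        by measurable
      moreover have "ennreal (1 / sqrt h) * (ennreal (sqrt h) * x) = x" for x
        using hp by (simp flip: mult.assoc ennreal_mult)
      ultimately show ?thesis by simp
    qed
    have "(\<integral>\<^sup>+\<xi>. ?f \<xi> \<partial>lborel) = (\<integral>\<^sup>+n. ennreal (std_normal_density n * N h (Re z) (Im z) r n) \<partial>lborel)"
    proof -
      have "(\<integral>\<^sup>+\<xi>. ?f \<xi> \<partial>lborel) = ennreal \<bar>- sqrt h\<bar> * (\<integral>\<^sup>+n. ?f (0 + (- sqrt h) * n) \<partial>lborel)"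
        using hp m3 by (intro nn_integral_real_affine) auto
      also have "\<dots> = (\<integral>\<^sup>+n. ennreal (sqrt h) * ?f (- sqrt h * n) \<partial>lborel)"
        using hp measurable_compose[OF _ m3, of "\<lambda>n. - sqrt h * n" borel]
        by (subst nn_integral_cmult) auto
      finally show ?thesis unfolding eq .
    qed
    also have "\<dots> = ennreal (\<integral>n. std_normal_density n * N h (Re z) (Im z) r n \<partial>lborel)"
      using st h nonneg by (intro nn_integral_eq_integral) (auto simp: N_def)
    also have "\<dots> \<le> ennreal (on_angle \<Psi> (z, r))"
      using st h by (auto simp: on_angle_def intro!: ennreal_leI)
    finally show "(\<integral>\<^sup>+\<xi>. ennreal (normal_density 0 (sqrt h) \<xi>) * ennreal (on_angle \<Psi> (euler_step a h (z, r) \<xi>)) \<partial>lborel)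
      \<le> ennreal (on_angle \<Psi> (z, r))"
      using nonneg by (simp add: ennreal_mult on_angle_def)
  qed
qed

text \<open>A jump at remaining time 1 does no harm as long as a step across 1 lands below the
  continued far potential. The constant ensures this for r in [1/2, 1): 2 powr m comes from s / r
  \<le> 2 s, exp n from the growth factor, and exp m outweighs exp (- c r).\<close>

definition potential :: "real \<Rightarrow> real \<Rightarrow> real \<Rightarrow> complex \<times> real \<Rightarrow> real" where
  "potential m c n p = (if 1 \<le> snd p then exp (n + m) * 2 powr m * on_angle (far_potential m c) p
     else on_angle (near_potential m n) p)"

definition euler_box :: "real \<Rightarrow> real \<Rightarrow> real \<Rightarrow> real \<Rightarrow> real \<Rightarrow> (complex \<times> real) set" where
  "euler_box X \<delta> Y \<eta> r1 = {p. \<bar>Re (fst p)\<bar> \<le> X \<and> \<delta> \<le> Im (fst p) \<and> Im (fst p) \<le> Y \<and> \<eta> \<le> snd p \<and> snd p \<le> r1}"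

lemma far_potential_nonneg: "0 \<le> far_potential m c p"
  by (simp add: far_potential_def case_prod_beta)

lemma near_potential_nonneg: "0 \<le> near_potential m n p"
  by (simp add: near_potential_def case_prod_beta)

lemma potential_nonneg: "0 \<le> potential m c n p"
  by (simp add: potential_def on_angle_def far_potential_nonneg near_potential_nonneg)

lemma borel_measurable_pair_components:
  "(\<lambda>p::complex \<times> real. Re (fst p)) \<in> borel_measurable borel"
  "(\<lambda>p::complex \<times> real. Im (fst p)) \<in> borel_measurable borel"
  "(\<lambda>p::complex \<times> real. snd p) \<in> borel_measurable borel"
  by (intro borel_measurable_continuous_onI continuous_intros)+

lemma potential_measurable: "potential m c n \<in> borel_measurable borel"
proof -
  note [measurable] = borel_measurable_pair_components
  show ?thesis
    unfolding potential_def[abs_def] on_angle_def[abs_def] far_potential_def near_potential_def sin_sq_def prod.case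
    by measurable
qed

lemma near_le_far_potential:
  assumes m: "0 < m" and c: "c < m" and s: "0 < s" and r: "1 / 2 \<le> r" "r < 1" and n: "0 \<le> n"
  shows "near_potential m n (s, r) \<le> exp (n + m) * 2 powr m * far_potential m c (s, r)"
proof -
  have "1 - exp (- s / r) \<le> s / r" using exp_ge_add_one_self[of "- s / r"] by simp
  also have "\<dots> \<le> 2 * s" using s r by (simp add: field_simps)
  finally have "(1 - exp (- s / r)) powr m \<le> (2 * s) powr m"
    using m s r by (intro powr_mono2) auto
  also have "\<dots> = 2 powr m * s powr m" using s by (simp add: powr_mult)
  finally have "exp (n * r) * (1 - exp (- s / r)) powr m \<le> exp n * (2 powr m * s powr m)"
    using n r by (intro mult_mono) (auto intro: mult_left_le)
  also have "\<dots> \<le> exp (n + m + - c * r) * (2 powr m * s powr m)"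
  proof (intro mult_right_mono)
    have "c * r \<le> m"
    proof (cases "0 \<le> c")
      case True
      then have "c * r \<le> c * 1" using r by (intro mult_left_mono) auto
      then show ?thesis using c by simp
    next
      case False
      then have "c * r \<le> 0" using r by (intro mult_nonpos_nonneg) auto
      then show ?thesis using m by simp
    qed
    then show "exp n \<le> exp (n + m + - c * r)" by simp
  qed auto
  also have "exp (n + m + - c * r) = exp (n + m) * exp (- c * r)" by (rule exp_add)
  finally show ?thesis unfolding near_potential_def far_potential_def prod.case by (simp only: mult_ac)
qed

text \<open>The restrictions on h keep the scheme in the half-plane and let the clock lose at most
  1/2 in a step. From r \<ge> 1 it thus lands at 1/2 or above, where the two potentials are
  comparable.\<close>

lemma euler_step_bounds:
  assumes h: "0 < h" "h \<le> \<delta>\<^sup>2 / 2" "h \<le> \<delta>\<^sup>2 / (2 * a)" and \<delta>: "0 < \<delta>" "\<delta> \<le> Im z" and a: "0 < a"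
  shows "0 < Im (fst (euler_step a h (z, r) \<xi>))" "snd (euler_step a h (z, r) \<xi>) \<le> r"
    "r - h / \<delta>\<^sup>2 \<le> snd (euler_step a h (z, r) \<xi>)" "Im (fst (euler_step a h (z, r) \<xi>)) \<le> Im z"
proof -
  let ?q = "(Re z)\<^sup>2 + (Im z)\<^sup>2"
  have y: "0 < Im z" using \<delta> by simp
  have d: "\<delta>\<^sup>2 \<le> (Im z)\<^sup>2" using \<delta> by (intro power_mono) auto
  have d0: "0 < \<delta>\<^sup>2" using \<delta> by simp
  have q: "\<delta>\<^sup>2 \<le> ?q" "(Im z)\<^sup>2 \<le> ?q" "0 < ?q"
    using d d0 zero_le_power2[of "Re z"] by linarith+
  have "h * a < ?q" using h(3) a d0 q(1) by (simp add: field_simps) (use d0 q(1) in linarith)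
  then have "Im z * (h * a / ?q) < Im z * 1" using y q(3) by (intro mult_strict_left_mono) auto
  then show "0 < Im (fst (euler_step a h (z, r) \<xi>))"
    by (simp add: euler_step_coordinates mult_ac)
  show "Im (fst (euler_step a h (z, r) \<xi>)) \<le> Im z"
    using h a y q by (simp add: euler_step_coordinates)
  show "snd (euler_step a h (z, r) \<xi>) \<le> r"
    using h by (simp add: euler_step_coordinates)
  have "(Im z)\<^sup>2 / ?q\<^sup>2 \<le> ?q / ?q\<^sup>2" using q by (intro divide_right_mono) auto
  also have "\<dots> = 1 / ?q" using q by (simp add: power2_eq_square)
  also have "\<dots> \<le> 1 / \<delta>\<^sup>2" using q d0 by (intro frac_le) auto
  finally have "h * ((Im z)\<^sup>2 / ?q\<^sup>2) \<le> h * (1 / \<delta>\<^sup>2)" using h by (intro mult_left_mono) auto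
  then show "r - h / \<delta>\<^sup>2 \<le> snd (euler_step a h (z, r) \<xi>)"
    by (simp add: euler_step_coordinates)
qed

text \<open>For r \<ge> 1 the new value is below the far potential even if the step crosses 1, so
  the far estimate applies. For r < 1 the clock cannot return above 1, and only the near potential
  occurs.\<close>

lemma nn_integral_potential_step:
  assumes m: "0 < m" and a: "4 * a = 1 + 2 * m" and c: "0 \<le> c" "c < m" and n: "2 * m * (1 + m) < n"
    and \<delta>: "0 < \<delta>" and \<eta>: "0 < \<eta>"
  shows "\<exists>h0>0. \<forall>h\<in>{0<..h0}. \<forall>p\<in>euler_box X \<delta> Y \<eta> r1.
    (\<integral>\<^sup>+\<xi>. ennreal (normal_density 0 (sqrt h) \<xi>) * ennreal (potential m c n (euler_step a h p \<xi>)) \<partial>lborel)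
      \<le> ennreal (potential m c n p)"
proof -
  interpret far: angular_function "far_potential m c"
    "\<lambda>(s, r). exp (- c * r) * (m * s powr (m - 1))"
    "\<lambda>(s, r). exp (- c * r) * (m * ((m - 1) * s powr (m - 2)))"
    "\<lambda>(s, r). - c * (exp (- c * r) * s powr m)"
    by (rule far_potential_angular)
  interpret near: angular_function "near_potential m n"
    "\<lambda>(s, r). exp (n * r) * (m * (1 - exp (- s / r)) powr (m - 1) * (exp (- s / r) / r))"
    "\<lambda>(s, r). exp (n * r) * (m * ((m - 1) * (1 - exp (- s / r)) powr (m - 2) * (exp (- s / r) / r) * (exp (- s / r) / r)
        - (1 - exp (- s / r)) powr (m - 1) * (exp (- s / r) / r / r)))"
    "\<lambda>(s, r). n * (exp (n * r) * (1 - exp (- s / r)) powr m)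
        + exp (n * r) * (m * (1 - exp (- s / r)) powr (m - 1) * - (exp (- s / r) * (s / r\<^sup>2)))"
    by (rule near_potential_angular)
  have a0: "0 < a" using a m by simp
  have n0: "0 \<le> n" using n m by (meson add_nonneg_nonneg less_imp_le mult_nonneg_nonneg order_trans zero_le_numeral zero_le_one)
  have "\<exists>h0>0. \<forall>h\<in>{0<..h0}. \<forall>z r. \<bar>Re z\<bar> \<le> X \<longrightarrow> \<delta> \<le> Im z \<longrightarrow> Im z \<le> Y \<longrightarrow> \<eta> \<le> r \<longrightarrow> r \<le> r1 \<longrightarrow>
    (\<integral>\<^sup>+\<xi>. ennreal (normal_density 0 (sqrt h) \<xi>) * ennreal (on_angle (far_potential m c) (euler_step a h (z, r) \<xi>)) \<partial>lborel)
      \<le> ennreal (on_angle (far_potential m c) (z, r))"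
  proof (rule far.nn_integral_euler_step[OF \<delta> \<eta> a, of _ 1])
    show "far_potential m c (s, r) \<le> 1" if "0 < s" "s \<le> 1" "0 < r" "r \<le> r1" for s r
    proof -
      have "exp (- c * r) * s powr m \<le> 1 * 1"
        using that c m by (intro mult_mono) (auto intro: powr_le1)
      then show ?thesis by (simp add: far_potential_def)
    qed
  next
    fix s r :: real assume "0 < s" "s \<le> 1" "0 < r"
    then show "2 * s * (1 - s) * (\<lambda>(s, r). exp (- c * r) * (m * ((m - 1) * s powr (m - 2)))) (s, r)
      + (2 * (1 - m) - (3 - 2 * m) * s) * (\<lambda>(s, r). exp (- c * r) * (m * s powr (m - 1))) (s, r)
      - (\<lambda>(s, r). - c * (exp (- c * r) * s powr m)) (s, r) < 0"
      unfolding prod.case using c by (intro far_potential_generator)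
  qed (rule far_potential_nonneg)
  then obtain h1 where h1: "0 < h1" and far: "\<And>h z r. h \<in> {0<..h1} \<Longrightarrow> \<bar>Re z\<bar> \<le> X \<Longrightarrow> \<delta> \<le> Im z \<Longrightarrow> Im z \<le> Y \<Longrightarrow> \<eta> \<le> r \<Longrightarrow> r \<le> r1 \<Longrightarrow>
    (\<integral>\<^sup>+\<xi>. ennreal (normal_density 0 (sqrt h) \<xi>) * ennreal (on_angle (far_potential m c) (euler_step a h (z, r) \<xi>)) \<partial>lborel)
      \<le> ennreal (on_angle (far_potential m c) (z, r))" by blast
  have "\<exists>h0>0. \<forall>h\<in>{0<..h0}. \<forall>z r. \<bar>Re z\<bar> \<le> X \<longrightarrow> \<delta> \<le> Im z \<longrightarrow> Im z \<le> Y \<longrightarrow> \<eta> \<le> r \<longrightarrow> r \<le> r1 \<longrightarrow>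
    (\<integral>\<^sup>+\<xi>. ennreal (normal_density 0 (sqrt h) \<xi>) * ennreal (on_angle (near_potential m n) (euler_step a h (z, r) \<xi>)) \<partial>lborel)
      \<le> ennreal (on_angle (near_potential m n) (z, r))"
  proof (rule near.nn_integral_euler_step[OF \<delta> \<eta> a, of _ "exp (n * r1)"])
    show "near_potential m n (s, r) \<le> exp (n * r1)" if "0 < s" "s \<le> 1" "0 < r" "r \<le> r1" for s r
    proof -
      have "exp (n * r) * (1 - exp (- s / r)) powr m \<le> exp (n * r1) * 1"
        using that n0 m by (intro mult_mono) (auto intro!: powr_le1 mult_left_mono)
      then show ?thesis by (simp add: near_potential_def)
    qed
  next
    fix s r :: real assume "0 < s" "s \<le> 1" "0 < r"
    then show "2 * s * (1 - s) * (\<lambda>(s, r). exp (n * r) * (m * ((m - 1) * (1 - exp (- s / r)) powr (m - 2) * (exp (- s / r) / r) * (exp (- s / r) / r)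
        - (1 - exp (- s / r)) powr (m - 1) * (exp (- s / r) / r / r)))) (s, r)
      + (2 * (1 - m) - (3 - 2 * m) * s) * (\<lambda>(s, r). exp (n * r) * (m * (1 - exp (- s / r)) powr (m - 1) * (exp (- s / r) / r))) (s, r)
      - (\<lambda>(s, r). n * (exp (n * r) * (1 - exp (- s / r)) powr m)
        + exp (n * r) * (m * (1 - exp (- s / r)) powr (m - 1) * - (exp (- s / r) * (s / r\<^sup>2)))) (s, r) < 0"
      unfolding prod.case using m n by (intro near_potential_generator)
  qed (rule near_potential_nonneg)
  then obtain h2 where h2: "0 < h2" and near: "\<And>h z r. h \<in> {0<..h2} \<Longrightarrow> \<bar>Re z\<bar> \<le> X \<Longrightarrow> \<delta> \<le> Im z \<Longrightarrow> Im z \<le> Y \<Longrightarrow> \<eta> \<le> r \<Longrightarrow> r \<le> r1 \<Longrightarrow>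
    (\<integral>\<^sup>+\<xi>. ennreal (normal_density 0 (sqrt h) \<xi>) * ennreal (on_angle (near_potential m n) (euler_step a h (z, r) \<xi>)) \<partial>lborel)
      \<le> ennreal (on_angle (near_potential m n) (z, r))" by blast
  define h0 where "h0 = Min {h1, h2, \<delta>\<^sup>2 / 2, \<delta>\<^sup>2 / (2 * a)}"
  have h0: "0 < h0" "h0 \<le> h1" "h0 \<le> h2" "h0 \<le> \<delta>\<^sup>2 / 2" "h0 \<le> \<delta>\<^sup>2 / (2 * a)"
    using h1 h2 \<delta> a0 by (auto simp: h0_def)
  show ?thesis
  proof (intro exI[of _ h0] conjI h0(1) ballI)
    fix h p assume h: "h \<in> {0<..h0}" and p: "p \<in> euler_box X \<delta> Y \<eta> r1"
    obtain z r where p_eq: "p = (z, r)" by (cases p)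
    have z: "\<bar>Re z\<bar> \<le> X" "\<delta> \<le> Im z" "Im z \<le> Y" "\<eta> \<le> r" "r \<le> r1" using p by (auto simp: euler_box_def p_eq)
    have h': "0 < h" "h \<le> \<delta>\<^sup>2 / 2" "h \<le> \<delta>\<^sup>2 / (2 * a)" "h \<in> {0<..h1}" "h \<in> {0<..h2}"
      using h h0 by auto
    let ?N = "\<lambda>\<xi>. ennreal (normal_density 0 (sqrt h) \<xi>)"
    note st = euler_step_bounds[OF h'(1,2,3) \<delta> z(2) a0, of r]
    show "(\<integral>\<^sup>+\<xi>. ?N \<xi> * ennreal (potential m c n (euler_step a h p \<xi>)) \<partial>lborel) \<le> ennreal (potential m c n p)"
    proof (cases "1 \<le> r")
      case True
      let ?C = "exp (n + m) * 2 powr m"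
      have "h / \<delta>\<^sup>2 \<le> 1 / 2" using h'(2) \<delta> by (simp add: field_simps)
      then have half: "1 / 2 \<le> snd (euler_step a h p \<xi>)" for \<xi>
        using st(3)[of \<xi>] True unfolding p_eq by linarith
      have le: "potential m c n (euler_step a h p \<xi>) \<le> ?C * on_angle (far_potential m c) (euler_step a h p \<xi>)" for \<xi>
        using near_le_far_potential[OF m c(2) sin_sq_pos[OF st(1)[of \<xi>]] _ _ n0] half[of \<xi>]
        by (auto simp: potential_def on_angle_def p_eq not_le)
      have "(\<integral>\<^sup>+\<xi>. ?N \<xi> * ennreal (potential m c n (euler_step a h p \<xi>)) \<partial>lborel)
        \<le> (\<integral>\<^sup>+\<xi>. ennreal ?C * (?N \<xi> * ennreal (on_angle (far_potential m c) (euler_step a h p \<xi>))) \<partial>lborel)"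
      proof (rule nn_integral_mono)
        fix \<xi>
        have "?N \<xi> * ennreal (potential m c n (euler_step a h p \<xi>)) \<le> ?N \<xi> * ennreal (?C * on_angle (far_potential m c) (euler_step a h p \<xi>))"
          by (intro mult_left_mono ennreal_leI le) simp
        then show "?N \<xi> * ennreal (potential m c n (euler_step a h p \<xi>))
            \<le> ennreal ?C * (?N \<xi> * ennreal (on_angle (far_potential m c) (euler_step a h p \<xi>)))"
          by (simp add: ennreal_mult on_angle_def far_potential_nonneg mult_ac)
      qed
      also have "\<dots> = ennreal ?C * (\<integral>\<^sup>+\<xi>. ?N \<xi> * ennreal (on_angle (far_potential m c) (euler_step a h p \<xi>)) \<partial>lborel)"
      proof (rule nn_integral_cmult)
        note [measurable] = borel_measurable_pair_components
        have "(\<lambda>\<xi>. on_angle (far_potential m c) (euler_step a h p \<xi>)) \<in> borel_measurable lborel"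
          unfolding p_eq euler_step_coordinates on_angle_def far_potential_def sin_sq_def prod.case fst_conv snd_conv complex.sel
          by measurable
        then show "(\<lambda>\<xi>. ?N \<xi> * ennreal (on_angle (far_potential m c) (euler_step a h p \<xi>))) \<in> borel_measurable lborel"
          by measurable
      qed
      also have "\<dots> \<le> ennreal ?C * ennreal (on_angle (far_potential m c) p)"
        unfolding p_eq by (intro mult_left_mono far h' z) simp
      also have "\<dots> = ennreal (potential m c n p)"
        using True by (simp add: potential_def p_eq ennreal_mult on_angle_def far_potential_nonneg)
      finally show ?thesis .
    next
      case False
      have "\<not> 1 \<le> snd (euler_step a h p \<xi>)" for \<xi> using st(2)[of \<xi>] False unfolding p_eq by linarith
      then have "potential m c n (euler_step a h p \<xi>) = on_angle (near_potential m n) (euler_step a h p \<xi>)" for \<xi>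
        by (simp add: potential_def)
      moreover have "potential m c n p = on_angle (near_potential m n) p" using False by (simp add: potential_def p_eq)
      ultimately show ?thesis using near[OF h'(5) z] by (simp add: p_eq)
    qed
  qed
qed

text \<open>Inside a box s is bounded below, so the boundary layer is close to 1 once r is small. A
  successful chain therefore ends where the potential is at least 1/2, as needed for Markov's
  inequality.\<close>

lemma potential_ge_half:
  assumes m: "0 < m" and n: "0 \<le> n" and \<delta>: "0 < \<delta>" and X: "0 \<le> X"
  shows "\<exists>\<eta>>0. \<eta> < 1 \<and> (\<forall>z r. \<bar>Re z\<bar> \<le> X \<longrightarrow> \<delta> \<le> Im z \<longrightarrow> Im z \<le> Y \<longrightarrow> 0 < r \<longrightarrow> r < \<eta> \<longrightarrow> 1 / 2 \<le> potential m c n (z, r))"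
proof -
  \<comment> \<open>Chosen so that t powr m = 1/2; then L solves 1 - exp (- L) = t, and s / r \<ge>
    L is sufficient.\<close>
  define t where "t = (1 / 2) powr (1 / m)"
  have t: "0 < t" "t < 1" using m powr_less_mono2[of "1 / m" "1 / 2" 1] by (auto simp: t_def)
  define L where "L = - ln (1 - t)"
  have L: "0 < L" using t by (simp add: L_def)
  have expL: "exp (- L) = 1 - t" using t by (simp add: L_def)
  define s0 where "s0 = \<delta>\<^sup>2 / (X\<^sup>2 + Y\<^sup>2 + \<delta>\<^sup>2)"
  have d0: "0 < \<delta>\<^sup>2" using \<delta> by simp
  have s0: "0 < s0" using d0 by (auto simp: s0_def add_nonneg_pos intro!: divide_pos_pos)
  define \<eta> where "\<eta> = min (1 / 2) (s0 / L)"
  have \<eta>: "0 < \<eta>" "\<eta> < 1" "\<eta> \<le> s0 / L" using s0 L by (auto simp: \<eta>_def)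
  show ?thesis
  proof (intro exI[of _ \<eta>] conjI \<eta> allI impI)
    fix z r assume z: "\<bar>Re z\<bar> \<le> X" "\<delta> \<le> Im z" "Im z \<le> Y" and r: "0 < r" "r < \<eta>"
    let ?s = "sin_sq (Re z) (Im z)"
    have "(Re z)\<^sup>2 \<le> X\<^sup>2" using z X by (simp add: abs_le_square_iff[symmetric])
    moreover have "(Im z)\<^sup>2 \<le> Y\<^sup>2" "\<delta>\<^sup>2 \<le> (Im z)\<^sup>2" using z \<delta> by (auto intro!: power_mono)
    ultimately have "s0 \<le> ?s"
      unfolding s0_def sin_sq_def using d0 zero_le_power2[of "Re z"] zero_le_power2[of "Im z"]
      by (intro frac_le; linarith)
    then have "L * r \<le> ?s"
    proof -
      have "L * r \<le> L * (s0 / L)" using r \<eta> L by (intro mult_left_mono) auto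
      then show ?thesis using \<open>s0 \<le> ?s\<close> L by simp
    qed
    then have "L \<le> ?s / r" using r by (simp add: field_simps)
    then have "exp (- ?s / r) \<le> exp (- L)" by simp
    then have "t \<le> 1 - exp (- ?s / r)" using expL by simp
    then have "t powr m \<le> (1 - exp (- ?s / r)) powr m" using t m by (intro powr_mono2) auto
    moreover have "t powr m = 1 / 2" using m by (simp add: t_def powr_powr)
    moreover have "(1 - exp (- ?s / r)) powr m \<le> exp (n * r) * (1 - exp (- ?s / r)) powr m"
      using mult_right_mono[of 1 "exp (n * r)" "(1 - exp (- ?s / r)) powr m"] n r by simp
    ultimately show "1 / 2 \<le> potential m c n (z, r)"
      using r \<eta> by (simp add: potential_def on_angle_def near_potential_def)
  qed
qed

section \<open>The chain frozen on leaving a box\<close>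

primrec euler_chain :: "real \<Rightarrow> real \<Rightarrow> (complex \<times> real) set \<Rightarrow> complex \<times> real \<Rightarrow> (nat \<Rightarrow> real) \<Rightarrow> nat \<Rightarrow> complex \<times> real" where
  "euler_chain a h K p \<xi> 0 = p"
| "euler_chain a h K p \<xi> (Suc k) = (if euler_chain a h K p \<xi> k \<in> K
     then euler_step a h (euler_chain a h K p \<xi> k) (\<xi> k) else euler_chain a h K p \<xi> k)"

lemma euler_chain_cong:
  "(\<And>i. i < k \<Longrightarrow> \<xi> i = \<xi>' i) \<Longrightarrow> euler_chain a h K p \<xi> k = euler_chain a h K p \<xi>' k"
  by (induction k) auto

lemma euler_step_measurable:
  "(\<lambda>q. euler_step a h (fst q) (snd q)) \<in> borel \<Otimes>\<^sub>M borel \<rightarrow>\<^sub>M borel"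
proof -
  have [measurable]: "(\<lambda>q. Re (fst (fst q))) \<in> borel_measurable ((borel :: (complex \<times> real) measure) \<Otimes>\<^sub>M (borel :: real measure))"
    "(\<lambda>q. Im (fst (fst q))) \<in> borel_measurable ((borel :: (complex \<times> real) measure) \<Otimes>\<^sub>M (borel :: real measure))"
    "(\<lambda>q. snd (fst q)) \<in> borel_measurable ((borel :: (complex \<times> real) measure) \<Otimes>\<^sub>M (borel :: real measure))"
    by (rule measurable_compose[OF measurable_fst], rule borel_measurable_pair_components)+
  have "(\<lambda>q. Complex (Re (fst (fst q)) + h * (a * Re (fst (fst q)) / ((Re (fst (fst q)))\<^sup>2 + (Im (fst (fst q)))\<^sup>2)) - snd q)
      (Im (fst (fst q)) + h * (- a * Im (fst (fst q)) / ((Re (fst (fst q)))\<^sup>2 + (Im (fst (fst q)))\<^sup>2))))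
    \<in> borel_measurable ((borel :: (complex \<times> real) measure) \<Otimes>\<^sub>M (borel :: real measure))"
    unfolding Complex_eq by measurable
  moreover have "(\<lambda>q. snd (fst q) + h * (- (Im (fst (fst q)))\<^sup>2 / ((Re (fst (fst q)))\<^sup>2 + (Im (fst (fst q)))\<^sup>2)\<^sup>2))
    \<in> borel_measurable ((borel :: (complex \<times> real) measure) \<Otimes>\<^sub>M (borel :: real measure))"
    by measurable
  moreover have "(\<lambda>q. euler_step a h (fst q) (snd q)) = (\<lambda>q. (Complex (Re (fst (fst q)) + h * (a * Re (fst (fst q)) / ((Re (fst (fst q)))\<^sup>2 + (Im (fst (fst q)))\<^sup>2)) - snd q)
      (Im (fst (fst q)) + h * (- a * Im (fst (fst q)) / ((Re (fst (fst q)))\<^sup>2 + (Im (fst (fst q)))\<^sup>2))),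
      snd (fst q) + h * (- (Im (fst (fst q)))\<^sup>2 / ((Re (fst (fst q)))\<^sup>2 + (Im (fst (fst q)))\<^sup>2)\<^sup>2)))"
    by (simp add: fun_eq_iff euler_step_coordinates)
  ultimately show ?thesis by (simp add: borel_measurable_Pair)
qed

lemma euler_chain_measurable:
  assumes K[measurable]: "K \<in> sets borel" and "k \<le> n"
  shows "(\<lambda>\<xi>. euler_chain a h K p \<xi> k) \<in> PiM {..<n} (\<lambda>_. borel) \<rightarrow>\<^sub>M borel"
  using assms(2)
proof (induction k)
  case (Suc k)
  then have [measurable]: "(\<lambda>\<xi>. euler_chain a h K p \<xi> k) \<in> PiM {..<n} (\<lambda>_. borel) \<rightarrow>\<^sub>M borel" by simp
  have [measurable]: "(\<lambda>\<xi>. \<xi> k) \<in> PiM {..<n} (\<lambda>_. borel :: real measure) \<rightarrow>\<^sub>M borel"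
    using Suc.prems by (intro measurable_component_singleton) auto
  have "(\<lambda>\<xi>. (euler_chain a h K p \<xi> k, \<xi> k)) \<in> PiM {..<n} (\<lambda>_. borel) \<rightarrow>\<^sub>M borel \<Otimes>\<^sub>M borel"
    by measurable
  from measurable_compose[OF this euler_step_measurable[of a h]]
  have [measurable]: "(\<lambda>\<xi>. euler_step a h (euler_chain a h K p \<xi> k) (\<xi> k)) \<in> PiM {..<n} (\<lambda>_. borel) \<rightarrow>\<^sub>M borel"
    by simp
  show ?case by simp
qed simp

lemma nn_integral_distr_on:
  "X \<in> M \<rightarrow>\<^sub>M N \<Longrightarrow> f \<in> borel_measurable N \<Longrightarrow> integral\<^sup>N (distr M N X) f = (\<integral>\<^sup>+\<omega>. f (X \<omega>) \<partial>M)"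
  by (simp add: nn_integral_distr)

lemma (in prob_space) nn_integral_potential_chain:
  assumes ind: "indep_vars (\<lambda>_. borel) \<xi> {..<n}"
    and dist: "\<And>i. i < n \<Longrightarrow> distributed M lborel (\<xi> i) (normal_density 0 (sqrt h))"
    and K: "K \<in> sets borel" and V: "V \<in> borel_measurable borel"
    and step: "\<And>p. p \<in> K \<Longrightarrow> (\<integral>\<^sup>+x. ennreal (normal_density 0 (sqrt h) x) * ennreal (V (euler_step a h p x)) \<partial>lborel) \<le> ennreal (V p)"
    and k: "k \<le> n"
  shows "(\<integral>\<^sup>+\<omega>. ennreal (V (euler_chain a h K p (\<lambda>i. \<xi> i \<omega>) k)) \<partial>M) \<le> ennreal (V p)"
  using k
proof (induction k)
  case 0 then show ?case by (simp add: emeasure_space_1)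
next
  case (Suc k)
  let ?P = "PiM {..<k} (\<lambda>_. borel :: real measure)" and ?Q = "PiM {k} (\<lambda>_. borel :: real measure)"
  let ?X = "\<lambda>\<omega>. restrict (\<lambda>i. \<xi> i \<omega>) {..<k}" and ?Y = "\<lambda>\<omega>. restrict (\<lambda>i. \<xi> i \<omega>) {k}"
  define E where "E x = euler_chain a h K p x k" for x
  define T where "T x y = (if x \<in> K then euler_step a h x y else x)" for x y
  note [measurable] = K V
  have E: "E \<in> ?P \<rightarrow>\<^sub>M borel"
    unfolding E_def[abs_def] by (rule euler_chain_measurable[OF K order_refl])
  have coord: "(\<lambda>y. y k) \<in> ?Q \<rightarrow>\<^sub>M borel" by (rule measurable_component_singleton) simp
  have T: "(\<lambda>q. T (fst q) (snd q)) \<in> borel \<Otimes>\<^sub>M borel \<rightarrow>\<^sub>M borel"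
    unfolding T_def using euler_step_measurable[of a h] by measurable
  have VT: "(\<lambda>q. V (T (fst q) (snd q))) \<in> borel \<Otimes>\<^sub>M borel \<rightarrow>\<^sub>M borel"
    by (rule measurable_compose[OF T V])
  have VTE: "(\<lambda>q. V (T (E (fst q)) (snd q k))) \<in> ?P \<Otimes>\<^sub>M ?Q \<rightarrow>\<^sub>M borel"
  proof -
    have "(\<lambda>q. (E (fst q), snd q k)) \<in> ?P \<Otimes>\<^sub>M ?Q \<rightarrow>\<^sub>M borel \<Otimes>\<^sub>M borel"
      by (rule measurable_Pair[OF measurable_compose[OF measurable_fst E] measurable_compose[OF measurable_snd coord]])
    from measurable_compose[OF this VT] show ?thesis by simp
  qed
  have VE: "(\<lambda>x. V (E x)) \<in> borel_measurable ?P" by (rule measurable_compose[OF E V])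
  have "indep_var ?P ?X ?Q ?Y"
    using Suc.prems by (intro indep_var_restrict[OF ind]) auto
  then have rv: "?X \<in> M \<rightarrow>\<^sub>M ?P" "?Y \<in> M \<rightarrow>\<^sub>M ?Q"
    and prod: "distr M ?P ?X \<Otimes>\<^sub>M distr M ?Q ?Y = distr M (?P \<Otimes>\<^sub>M ?Q) (\<lambda>\<omega>. (?X \<omega>, ?Y \<omega>))"
    unfolding indep_var_distribution_eq by auto
  interpret Y: prob_space "distr M ?Q ?Y" by (rule prob_space_distr[OF rv(2)])
  have \<xi>k: "\<xi> k \<in> borel_measurable M"
    using measurable_compose[OF rv(2) coord] by simp
  have d\<xi>: "distr M borel (\<xi> k) = density lborel (\<lambda>x. ennreal (normal_density 0 (sqrt h) x))"
    using distributed_distr_eq_density[OF dist[of k]] Suc.prems by (simp cong: distr_cong)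
  have inner: "(\<integral>\<^sup>+y. ennreal (V (T x (y k))) \<partial>distr M ?Q ?Y) \<le> ennreal (V x)" for x
  proof (cases "x \<in> K")
    case True
    have m: "(\<lambda>y. V (T x y)) \<in> borel_measurable borel"
      using measurable_compose[OF measurable_Pair1' VT, of x] by simp
    have "(\<integral>\<^sup>+y. ennreal (V (T x (y k))) \<partial>distr M ?Q ?Y) = (\<integral>\<^sup>+\<omega>. ennreal (V (T x (?Y \<omega> k))) \<partial>M)"
      by (rule nn_integral_distr_on[OF rv(2) measurable_compose[OF measurable_compose[OF coord m] measurable_ennreal]])
    also have "\<dots> = (\<integral>\<^sup>+\<omega>. ennreal (V (T x (\<xi> k \<omega>))) \<partial>M)" by simp
    also have "\<dots> = (\<integral>\<^sup>+y. ennreal (V (T x y)) \<partial>distr M borel (\<xi> k))"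
      by (rule nn_integral_distr_on[OF \<xi>k measurable_compose[OF m measurable_ennreal], symmetric])
    also have "\<dots> \<le> ennreal (V x)"
      using True step[OF True] m unfolding d\<xi> by (subst nn_integral_density) (auto simp: T_def)
    finally show ?thesis .
  qed (simp add: T_def Y.emeasure_space_1[simplified])
  have EX: "E (?X \<omega>) = euler_chain a h K p (\<lambda>i. \<xi> i \<omega>) k" for \<omega>
    unfolding E_def by (rule euler_chain_cong) simp
  have "(\<integral>\<^sup>+\<omega>. ennreal (V (euler_chain a h K p (\<lambda>i. \<xi> i \<omega>) (Suc k))) \<partial>M) = (\<integral>\<^sup>+\<omega>. ennreal (V (T (E (?X \<omega>)) (?Y \<omega> k))) \<partial>M)"
    unfolding EX by (simp add: T_def)
  also have "\<dots> = (\<integral>\<^sup>+q. ennreal (V (T (E (fst q)) (snd q k))) \<partial>distr M (?P \<Otimes>\<^sub>M ?Q) (\<lambda>\<omega>. (?X \<omega>, ?Y \<omega>)))"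
    by (subst nn_integral_distr_on[OF measurable_Pair[OF rv] measurable_compose[OF VTE measurable_ennreal]]) simp
  also have "\<dots> = (\<integral>\<^sup>+x. \<integral>\<^sup>+y. ennreal (V (T (E x) (y k))) \<partial>distr M ?Q ?Y \<partial>distr M ?P ?X)"
  proof -
    have "(\<lambda>q. ennreal (V (T (E (fst q)) (snd q k)))) \<in> borel_measurable (distr M ?P ?X \<Otimes>\<^sub>M distr M ?Q ?Y)"
      using measurable_compose[OF VTE measurable_ennreal]
      by (simp only: measurable_cong_sets[OF sets_pair_measure_cong[OF sets_distr sets_distr] refl])
    from Y.nn_integral_fst[OF this] show ?thesis unfolding prod by simp
  qed
  also have "\<dots> \<le> (\<integral>\<^sup>+x. ennreal (V (E x)) \<partial>distr M ?P ?X)"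
    by (intro nn_integral_mono inner)
  also have "\<dots> = (\<integral>\<^sup>+\<omega>. ennreal (V (E (?X \<omega>))) \<partial>M)"
    by (rule nn_integral_distr_on[OF rv(1) measurable_compose[OF VE measurable_ennreal]])
  also have "\<dots> \<le> ennreal (V p)" unfolding EX using Suc by simp
  finally show ?case .
qed

section \<open>Convergence of the Euler scheme and the flow estimate\<close>

lemma radial_speed_le:
  assumes "0 < \<delta>" "\<delta> \<le> Im z" shows "radial_speed z \<le> 1 / \<delta>\<^sup>2"
proof -
  have y: "0 < Im z" "Im z \<le> cmod z" using assms abs_Im_le_cmod[of z] by auto
  have "(Im z)\<^sup>2 \<le> (cmod z)\<^sup>2" using y by (intro power_mono) auto
  then have "(Im z)\<^sup>2 / (cmod z) ^ 4 \<le> (cmod z)\<^sup>2 / (cmod z) ^ 4" by (intro divide_right_mono) auto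
  also have "\<dots> = 1 / (cmod z)\<^sup>2"
    using y by (simp add: power2_eq_square power4_eq_xxxx)
  also have "\<dots> \<le> 1 / \<delta>\<^sup>2" using assms y by (intro frac_le power_mono) auto
  finally show ?thesis by (simp add: radial_speed_def)
qed

lemma derivative_increment_bound:
  fixes f F :: "real \<Rightarrow> 'a::euclidean_space"
  assumes F: "\<And>s. s \<in> {0..T} \<Longrightarrow> (F has_vector_derivative f s) (at s within {0..T})"
    and pq: "0 \<le> p" "p \<le> q" "q \<le> T"
    and B: "\<And>s. s \<in> {p..q} \<Longrightarrow> norm (f s - v) \<le> B"
  shows "norm (F q - F p - (q - p) *\<^sub>R v) \<le> B * (q - p)"
proof -
  have "(f has_integral F q - F p) {p..q}"
    using pq by (intro fundamental_theorem_of_calculus) (auto intro!: has_vector_derivative_within_subset[OF F])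
  moreover have "((\<lambda>s. v) has_integral (q - p) *\<^sub>R v) {p..q}"
    using has_integral_const_real[of v p q] pq by simp
  ultimately have "((\<lambda>s. f s - v) has_integral F q - F p - (q - p) *\<^sub>R v) {p..q}"
    by (rule has_integral_diff)
  moreover have "0 \<le> B" using order_trans[OF norm_ge_zero B[of p]] pq by simp
  ultimately show ?thesis
    using has_integral_bound_real[of B "{}" "\<lambda>s. f s - v" "F q - F p - (q - p) *\<^sub>R v" p q] B pq by auto
qed

lemma compact_uniform_continuity:
  fixes f :: "'a::real_normed_vector \<Rightarrow> 'b::real_normed_vector"
  assumes "continuous_on S f" "compact S" "0 < e"
  shows "\<exists>d>0. \<forall>x\<in>S. \<forall>y\<in>S. norm (y - x) < d \<longrightarrow> norm (f y - f x) < e"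
  using compact_uniformly_continuous[OF assms(1,2)] assms(3)
  unfolding uniformly_continuous_on_def dist_norm by blast

definition success_region :: "real \<Rightarrow> real \<Rightarrow> real \<Rightarrow> real \<Rightarrow> (complex \<times> real) set" where
  "success_region X \<delta> Y \<eta> = {p. \<bar>Re (fst p)\<bar> \<le> X \<and> \<delta> \<le> Im (fst p) \<and> Im (fst p) \<le> Y \<and> 0 < snd p \<and> snd p < \<eta>}"

text \<open>The flow keeps a margin from the sides of the box, and for a small mesh the chain
  follows it within that margin. The chain can therefore leave the box only through its clock, and
  then it is frozen in the success region.\<close>

lemma euler_chain_success:
  assumes a: "0 < a" and T: "0 \<le> T" and u: "continuous_on {0..T} u" and u0: "u 0 = 0"
    and g: "loewner_solution a u \<zeta> T g" and \<delta>: "0 < \<delta>" and \<eta>: "0 < \<eta>" "\<eta> \<le> r0"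
    and box: "\<And>s. s \<in> {0..T} \<Longrightarrow> \<bar>Re (g s - of_real (u s))\<bar> + 1 \<le> X"
      "\<And>s. s \<in> {0..T} \<Longrightarrow> 2 * \<delta> \<le> Im (g s)" "\<And>s. s \<in> {0..T} \<Longrightarrow> Im (g s) + 1 \<le> Y"
    and r0: "r0 \<le> integral {0..T} (\<lambda>s. radial_speed (g s - of_real (u s)))"
  shows "\<exists>h0>0. \<forall>h\<in>{0<..h0}. \<exists>k. real k * h \<le> T \<and> (\<forall>n\<ge>k.
    euler_chain a h (euler_box X \<delta> Y \<eta> r0) (\<zeta>, r0) (\<lambda>i. u (real (Suc i) * h) - u (real i * h)) n \<in> success_region X \<delta> Y \<eta>)"
proof -
  define Z where "Z s = g s - of_real (u s)" for s
  define D where "D s = of_real a / Z s" for s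
  define \<rho> where "\<rho> s = radial_speed (Z s)" for s
  define P where "P t = integral {0..t} \<rho>" for t
  define Kz where "Kz = {z. \<bar>Re z\<bar> \<le> X \<and> \<delta> \<le> Im z \<and> Im z \<le> Y}"
  have ImZ: "Im (Z s) = Im (g s)" for s by (simp add: Z_def)
  have Zbox: "\<bar>Re (Z s)\<bar> + 1 \<le> X" "2 * \<delta> \<le> Im (Z s)" "Im (Z s) + 1 \<le> Y" if "s \<in> {0..T}" for s
    using box[OF that] by (auto simp: Z_def)
  have ZK: "Z s \<in> Kz" if "s \<in> {0..T}" for s using Zbox[OF that] \<delta> by (auto simp: Kz_def)
  have Z0: "Z 0 = \<zeta>" using g u0 by (simp add: Z_def loewner_solution_def)
  have Znz: "Z s \<noteq> 0" if "s \<in> {0..T}" for s using Zbox(2)[OF that] \<delta> by auto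
  have Zc: "continuous_on {0..T} Z"
    unfolding Z_def[abs_def] using loewner_solution_continuous[OF g] u by (intro continuous_intros)
  have Dc: "continuous_on {0..T} D" unfolding D_def[abs_def] using Zc Znz by (intro continuous_intros) auto
  have \<rho>c: "continuous_on {0..T} \<rho>"
    unfolding \<rho>_def[abs_def] Z_def by (rule radial_speed_continuous[OF g u])
  have gd: "(g has_vector_derivative D s) (at s within {0..T})" if "s \<in> {0..T}" for s
    using g that by (auto simp: loewner_solution_def D_def Z_def)
  have Pd: "(P has_vector_derivative \<rho> s) (at s within {0..T})" if "s \<in> {0..T}" for s
    unfolding P_def[abs_def] by (rule integral_has_vector_derivative[OF \<rho>c that])
  have Kzc: "compact Kz"
  proof -
    have "closed Kz" unfolding Kz_def
      by (intro closed_Collect_conj closed_Collect_le continuous_intros)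
    moreover have "bounded Kz"
    proof (rule boundedI)
      fix z assume "z \<in> Kz"
      then show "cmod z \<le> X + Y" using cmod_le[of z] \<delta> by (auto simp: Kz_def)
    qed
    ultimately show ?thesis by (simp add: compact_eq_bounded_closed)
  qed
  define L where "L = a / \<delta>\<^sup>2"
  have L: "0 < L" using a \<delta> by (simp add: L_def)
  \<comment> \<open>The permitted clock error per unit of time, at most \<eta> / 4 in total. T + 1
    replaces T because T may be 0.\<close>
  define \<epsilon> where "\<epsilon> = \<eta> / (4 * (T + 1))"
  have \<epsilon>: "0 < \<epsilon>" using \<eta> T by (simp add: \<epsilon>_def)
  have T\<epsilon>: "T * \<epsilon> \<le> \<eta> / 4"
  proof -
    have "T * \<epsilon> \<le> (T + 1) * \<epsilon>" using \<epsilon> by (intro mult_right_mono) auto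
    also have "\<dots> = \<eta> / 4"
    proof -
      have "T' * (\<eta> / (4 * T')) = \<eta> / 4" if "0 < T'" for T' :: real using that by simp
      from this[of "T + 1"] show ?thesis using T unfolding \<epsilon>_def by simp
    qed
    finally show ?thesis .
  qed
  have "continuous_on Kz radial_speed"
    unfolding radial_speed_def using \<delta> by (intro continuous_intros) (auto simp: Kz_def)
  then obtain d where d: "0 < d" "\<And>z w. z \<in> Kz \<Longrightarrow> w \<in> Kz \<Longrightarrow> cmod (w - z) < d \<Longrightarrow> \<bar>radial_speed w - radial_speed z\<bar> < \<epsilon>"
    using compact_uniform_continuity[OF _ Kzc \<epsilon>, of radial_speed] unfolding real_norm_def by blast
  \<comment> \<open>The admissible distance between chain and flow: d / 2 controls the speed, while
    \<delta> and 1 are the margins that the flow leaves inside the box.\<close>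
  define e0 where "e0 = Min {d / 2, \<delta>, 1}"
  have e0: "0 < e0" "e0 \<le> d / 2" "e0 \<le> \<delta>" "e0 \<le> 1" using d(1) \<delta> by (auto simp: e0_def)
  define \<omega> where "\<omega> = e0 / ((T + 1) * exp (L * T))"
  have \<omega>: "0 < \<omega>" using e0 T by (simp add: \<omega>_def add_nonneg_pos)
  have T\<omega>: "T * \<omega> * exp (L * T) \<le> e0"
  proof -
    have "T * \<omega> * exp (L * T) \<le> (T + 1) * \<omega> * exp (L * T)" using \<omega> by (intro mult_right_mono) auto
    also have "\<dots> = e0"
    proof -
      have "T' * (e0 / (T' * E)) * E = e0" if "0 < T'" "0 < E" for T' E :: real using that by simp
      from this[of "T + 1" "exp (L * T)"] show ?thesis using T unfolding \<omega>_def by simp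
    qed
    finally show ?thesis .
  qed
  obtain h1 where h1: "0 < h1" "\<And>s s'. s \<in> {0..T} \<Longrightarrow> s' \<in> {0..T} \<Longrightarrow> \<bar>s' - s\<bar> < h1 \<Longrightarrow> cmod (D s' - D s) < \<omega>"
    using compact_uniform_continuity[OF Dc compact_Icc \<omega>] unfolding real_norm_def by blast
  obtain h2 where h2: "0 < h2" "\<And>s s'. s \<in> {0..T} \<Longrightarrow> s' \<in> {0..T} \<Longrightarrow> \<bar>s' - s\<bar> < h2 \<Longrightarrow> cmod (Z s' - Z s) < d / 2"
    using compact_uniform_continuity[OF Zc compact_Icc half_gt_zero[OF d(1)]] unfolding real_norm_def by blast
  define h0 where "h0 = Min {h1 / 2, h2 / 2, \<eta> * \<delta>\<^sup>2 / 2, \<delta>\<^sup>2 / 2, \<delta>\<^sup>2 / (2 * a)}"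
  have h0: "0 < h0" "h0 \<le> h1 / 2" "h0 \<le> h2 / 2" "h0 \<le> \<eta> * \<delta>\<^sup>2 / 2" "h0 \<le> \<delta>\<^sup>2 / 2" "h0 \<le> \<delta>\<^sup>2 / (2 * a)"
    using h1(1) h2(1) \<eta> \<delta> a by (auto simp: h0_def)
  show ?thesis
  proof (intro exI[of _ h0] conjI h0(1) ballI)
    fix h assume "h \<in> {0<..h0}"
    then have h: "0 < h" "h < h1" "h < h2" "h \<le> \<eta> * \<delta>\<^sup>2 / 2" "h \<le> \<delta>\<^sup>2 / 2" "h \<le> \<delta>\<^sup>2 / (2 * a)"
      using h0 h1(1) h2(1) by auto
    have h\<delta>: "h / \<delta>\<^sup>2 \<le> \<eta> / 2" using h(4) \<delta> by (simp add: field_simps)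
    define K where "K = euler_box X \<delta> Y \<eta> r0"
    define t where "t k = real k * h" for k :: nat
    define \<xi> where "\<xi> i = u (real (Suc i) * h) - u (real i * h)" for i
    define c where "c k = euler_chain a h K (\<zeta>, r0) \<xi> k" for k
    have t_Suc: "t (Suc k) = t k + h" for k by (simp add: t_def algebra_simps)
    have t0: "0 \<le> t k" for k using h by (simp add: t_def)
    have KKz: "fst (c k) \<in> Kz" if "c k \<in> K" for k using that by (auto simp: K_def euler_box_def Kz_def)
    have c_Suc: "c (Suc k) = (fst (c k) + of_real (a * h) / fst (c k) - of_real (\<xi> k), snd (c k) - h * radial_speed (fst (c k)))"
      if "c k \<in> K" for k using that by (simp add: c_def euler_step_def)
    have err: "t k * \<omega> * (1 + h * L) ^ k \<le> e0" if "t k \<le> T" for k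
    proof -
      have "(1 + h * L) ^ k \<le> exp (h * L) ^ k"
        using exp_ge_add_one_self[of "h * L"] h L by (intro power_mono) auto
      also have "\<dots> = exp (L * t k)" by (simp add: t_def mult_ac flip: exp_of_nat_mult)
      also have "\<dots> \<le> exp (L * T)" using that L by simp
      finally have "t k * \<omega> * (1 + h * L) ^ k \<le> T * \<omega> * exp (L * T)"
        using that t0[of k] \<omega> h L T by (intro mult_mono) auto
      then show ?thesis using T\<omega> by linarith
    qed
    \<comment> \<open>A discrete Gronwall argument: the error grows by the factor 1 + h L and
      receives at most \<omega> h in every step.\<close>
    have main: "cmod (fst (c k) - Z (t k)) \<le> t k * \<omega> * (1 + h * L) ^ k \<and> \<bar>(r0 - snd (c k)) - P (t k)\<bar> \<le> t k * \<epsilon>"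
      if "t k \<le> T" "\<And>j. j < k \<Longrightarrow> c j \<in> K" for k
      using that
    proof (induction k)
      case 0 then show ?case by (simp add: c_def t_def Z0 P_def)
    next
      case (Suc k)
      have tk: "t k \<in> {0..T}" "t (Suc k) \<in> {0..T}" using Suc.prems(1) t0[of k] h by (auto simp: t_Suc)
      have IH: "cmod (fst (c k) - Z (t k)) \<le> t k * \<omega> * (1 + h * L) ^ k" "\<bar>(r0 - snd (c k)) - P (t k)\<bar> \<le> t k * \<epsilon>"
        using Suc.IH Suc.prems tk by auto
      have ck: "c k \<in> K" using Suc.prems(2) by simp
      let ?e = "cmod (fst (c k) - Z (t k))"
      have lip: "cmod (of_real (a * h) / fst (c k) - of_real (a * h) / Z (t k)) \<le> h * L * ?e"
      proof -
        have eq: "of_real (a * h) / fst (c k) - of_real (a * h) / Z (t k) = of_real (a * h) * (1 / fst (c k) - 1 / Z (t k))"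
          by (simp add: right_diff_distrib)
        have "cmod (of_real (a * h) / fst (c k) - of_real (a * h) / Z (t k)) = a * h * cmod (1 / fst (c k) - 1 / Z (t k))"
        proof -
          have "cmod (of_real (a * h)) = a * h" using a h(1) by (simp add: norm_mult)
          then show ?thesis unfolding eq norm_mult by simp
        qed
        also have "\<dots> \<le> a * h * (?e / \<delta>\<^sup>2)"
          using KKz[OF ck] ZK[OF tk(1)] a h \<delta> by (intro mult_left_mono inverse_lipschitz_upper_half_plane) (auto simp: Kz_def)
        finally show ?thesis by (simp add: L_def mult_ac)
      qed
      have inc: "cmod (g (t (Suc k)) - g (t k) - h *\<^sub>R D (t k)) \<le> \<omega> * h"
      proof -
        have "cmod (g (t (Suc k)) - g (t k) - (t (Suc k) - t k) *\<^sub>R D (t k)) \<le> \<omega> * (t (Suc k) - t k)"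
        proof (rule derivative_increment_bound[OF gd])
          fix s assume "s \<in> {t k..t (Suc k)}"
          then show "cmod (D s - D (t k)) \<le> \<omega>"
            using h1(2)[OF tk(1), of s] tk h by (auto simp: t_Suc intro: less_imp_le)
        qed (use tk h in \<open>auto simp: t_Suc\<close>)
        then show ?thesis by (simp add: t_Suc)
      qed
      \<comment> \<open>The chain uses the increments of the true driving function, so the noise
        cancels exactly, and no regularity of u beyond continuity is needed.\<close>
      have "fst (c (Suc k)) - Z (t (Suc k)) = (fst (c k) - Z (t k))
          + (of_real (a * h) / fst (c k) - of_real (a * h) / Z (t k)) + - (g (t (Suc k)) - g (t k) - h *\<^sub>R D (t k))"
        by (simp add: c_Suc[OF ck] Z_def[of "t (Suc k)"] Z_def[of "t k"] \<xi>_def t_def D_def scaleR_conv_of_real mult.commute)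
          (simp add: Z_def t_def)
      then have "cmod (fst (c (Suc k)) - Z (t (Suc k))) \<le> ?e + h * L * ?e + \<omega> * h"
        using lip inc by (metis (no_types, lifting) add_mono norm_minus_cancel norm_triangle_mono order_refl)
      also have "\<dots> = (1 + h * L) * ?e + \<omega> * h" by (simp add: algebra_simps)
      also have "\<dots> \<le> (1 + h * L) * (t k * \<omega> * (1 + h * L) ^ k) + \<omega> * h * (1 + h * L) ^ Suc k"
      proof (intro add_mono mult_left_mono IH)
        have "1 \<le> (1 + h * L) ^ Suc k" using h L by (intro one_le_power) simp
        then show "\<omega> * h \<le> \<omega> * h * (1 + h * L) ^ Suc k" using \<omega> h by simp
      qed (use h L in auto)
      also have "\<dots> = t (Suc k) * \<omega> * (1 + h * L) ^ Suc k" by (simp add: t_Suc algebra_simps)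
      finally have 1: "cmod (fst (c (Suc k)) - Z (t (Suc k))) \<le> \<dots>" .
      have "\<bar>P (t (Suc k)) - P (t k) - (t (Suc k) - t k) *\<^sub>R radial_speed (fst (c k))\<bar> \<le> \<epsilon> * (t (Suc k) - t k)"
        unfolding real_norm_def[symmetric]
      proof (rule derivative_increment_bound[OF Pd])
        fix s assume s: "s \<in> {t k..t (Suc k)}"
        have sT: "s \<in> {0..T}" using s tk by auto
        have "cmod (Z s - Z (t k)) < d / 2" using h2(2)[OF tk(1) sT] s h by (auto simp: t_Suc)
        moreover have "?e \<le> d / 2" using IH(1) err[of k] tk e0 by auto
        ultimately have "cmod (Z s - fst (c k)) < d"
          using norm_triangle_ineq4[of "Z s - Z (t k)" "fst (c k) - Z (t k)"] by simp
        from d(2)[OF KKz[OF ck] ZK[OF sT] this] show "norm (\<rho> s - radial_speed (fst (c k))) \<le> \<epsilon>"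
          by (simp add: \<rho>_def)
      qed (use tk h in \<open>auto simp: t_Suc\<close>)
      then have "\<bar>P (t (Suc k)) - P (t k) - h * radial_speed (fst (c k))\<bar> \<le> \<epsilon> * h" by (simp add: t_Suc)
      then have "\<bar>(r0 - snd (c (Suc k))) - P (t (Suc k))\<bar> \<le> t k * \<epsilon> + \<epsilon> * h"
        using IH(2) by (simp add: c_Suc[OF ck])
      also have "\<dots> = t (Suc k) * \<epsilon>" by (simp add: t_Suc algebra_simps)
      finally show ?case using 1 by simp
    qed
    have near: "fst (c k) \<in> Kz \<and> \<bar>(r0 - snd (c k)) - P (t k)\<bar> \<le> \<eta> / 4"
      if "t k \<le> T" "\<And>j. j < k \<Longrightarrow> c j \<in> K" for k
    proof -
      have tk: "t k \<in> {0..T}" using that t0 by simp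
      have e: "cmod (fst (c k) - Z (t k)) \<le> e0" using main[OF that] err[OF that(1)] by simp
      have "\<bar>Re (fst (c k)) - Re (Z (t k))\<bar> \<le> e0" "\<bar>Im (fst (c k)) - Im (Z (t k))\<bar> \<le> e0"
        using e abs_Re_le_cmod[of "fst (c k) - Z (t k)"] abs_Im_le_cmod[of "fst (c k) - Z (t k)"] by auto
      then have "fst (c k) \<in> Kz" using Zbox[OF tk] e0 by (auto simp: Kz_def)
      moreover have "t k * \<epsilon> \<le> T * \<epsilon>" using that(1) \<epsilon> by (intro mult_right_mono) auto
      ultimately show ?thesis using main[OF that] T\<epsilon> by auto
    qed
    define N where "N = nat \<lfloor>T / h\<rfloor>"
    have N: "t N \<le> T" "T - t N < h"
    proof -
      have "real N = of_int \<lfloor>T / h\<rfloor>" using T h by (simp add: N_def)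
      then have "real N \<le> T / h" "T / h < real N + 1" by linarith+
      then show "t N \<le> T" "T - t N < h" using h by (auto simp: t_def field_simps)
    qed
    \<comment> \<open>Otherwise the remaining clock at step N would be at least \<eta>, although it
      is at most \<eta> / 4 from the scheme plus \<eta> / 2 from the last incomplete step.\<close>
    have "\<exists>k\<le>N. c k \<notin> K"
    proof (rule ccontr)
      assume "\<not> ?thesis"
      then have all: "c k \<in> K" if "k \<le> N" for k using that by blast
      have "\<bar>P T - P (t N) - (T - t N) *\<^sub>R 0\<bar> \<le> 1 / \<delta>\<^sup>2 * (T - t N)"
        unfolding real_norm_def[symmetric]
      proof (rule derivative_increment_bound[OF Pd])
        fix s assume s: "s \<in> {t N..T}"
        then have "s \<in> {0..T}" using t0[of N] by auto
        then have "\<rho> s \<le> 1 / \<delta>\<^sup>2" unfolding \<rho>_def using Zbox(2)[of s] \<delta> by (intro radial_speed_le) auto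
        then show "norm (\<rho> s - 0) \<le> 1 / \<delta>\<^sup>2" using radial_speed_nonneg[of "Z s"] by (simp add: \<rho>_def)
      qed (use N t0 in auto)
      also have "\<dots> \<le> 1 / \<delta>\<^sup>2 * h" using N by (intro mult_left_mono) auto
      finally have "\<bar>P T - P (t N)\<bar> \<le> h / \<delta>\<^sup>2" by simp
      then have PT: "P T - P (t N) \<le> \<eta> / 2" using h\<delta> by linarith
      have "\<bar>(r0 - snd (c N)) - P (t N)\<bar> \<le> \<eta> / 4" using near[OF N(1)] all by auto
      moreover have "\<eta> \<le> snd (c N)" using all[of N] by (simp add: K_def euler_box_def)
      moreover have "r0 \<le> P T" using r0 by (simp add: P_def \<rho>_def[abs_def] Z_def)
      ultimately show False using PT \<eta>(1) by linarith
    qed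
    define k where "k = (LEAST k. c k \<notin> K)"
    have k: "k \<le> N" "c k \<notin> K" "\<And>j. j < k \<Longrightarrow> c j \<in> K"
    proof -
      obtain k' where k': "k' \<le> N" "c k' \<notin> K" using \<open>\<exists>k\<le>N. c k \<notin> K\<close> by blast
      show "c k \<notin> K" unfolding k_def using k'(2) by (rule LeastI)
      show "k \<le> N" unfolding k_def using Least_le[of "\<lambda>k. c k \<notin> K", OF k'(2)] k'(1) by simp
      show "c j \<in> K" if "j < k" for j using not_less_Least[of j "\<lambda>k. c k \<notin> K"] that by (auto simp: k_def)
    qed
    have tk: "t k \<le> T"
    proof -
      have "t k \<le> t N" using k(1) h by (simp add: t_def)
      then show ?thesis using N by simp
    qed
    have "c 0 \<in> K" using ZK[of 0] T \<eta> by (simp add: c_def K_def euler_box_def Z0 Kz_def)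
    then obtain j where j: "k = Suc j" using k(2) by (cases k) auto
    have cj: "c j \<in> K" using k(3) j by simp
    then have cj': "\<delta> \<le> Im (fst (c j))" "\<eta> \<le> snd (c j)" "snd (c j) \<le> r0" by (auto simp: K_def euler_box_def)
    have "h * radial_speed (fst (c j)) \<le> h * (1 / \<delta>\<^sup>2)"
      using h(1) radial_speed_le[OF \<delta> cj'(1)] by (intro mult_left_mono) auto
    moreover have "0 \<le> h * radial_speed (fst (c j))" using h radial_speed_nonneg by simp
    moreover have "h * (1 / \<delta>\<^sup>2) = h / \<delta>\<^sup>2" by simp
    moreover have "snd (c k) = snd (c j) - h * radial_speed (fst (c j))" using c_Suc[OF cj] by (simp add: j)
    \<comment> \<open>One step consumes at most \<eta> / 2 of the clock, so leaving from a value of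
      at least \<eta> does not overshoot 0.\<close>
    ultimately have sk: "0 < snd (c k)" "snd (c k) \<le> r0"
      using cj' h\<delta> \<eta> by linarith+
    have fk: "fst (c k) \<in> Kz" using near[OF tk k(3)] by simp
    have "snd (c k) < \<eta>"
      using k(2) fk sk by (auto simp: K_def euler_box_def Kz_def)
    then have S: "c k \<in> success_region X \<delta> Y \<eta>" using fk sk by (simp add: success_region_def Kz_def)
    have stay: "c n = c k" if "k \<le> n" for n
      using that by (induction rule: dec_induct) (use k(2) in \<open>auto simp: c_def\<close>)
    have fin: "\<forall>n\<ge>k. c n \<in> success_region X \<delta> Y \<eta>"
    proof (intro allI impI)
      fix n assume "k \<le> n"
      show "c n \<in> success_region X \<delta> Y \<eta>" unfolding stay[OF \<open>k \<le> n\<close>] by (rule S)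
    qed
    then show "\<exists>k. real k * h \<le> T \<and> (\<forall>n\<ge>k.
      euler_chain a h (euler_box X \<delta> Y \<eta> r0) (\<zeta>, r0) (\<lambda>i. u (real (Suc i) * h) - u (real i * h)) n \<in> success_region X \<delta> Y \<eta>)"
      using tk[unfolded t_def] fin[unfolded c_def K_def \<xi>_def[abs_def]] by (intro exI[of _ k] conjI)
  qed
qed

text \<open>Fatou's lemma for indicators. It serves twice: to let the mesh tend to 0 in a fixed box,
  and then to let the boxes exhaust the half-plane. The bound must not depend on either.\<close>

lemma emeasure_eventually_le:
  assumes B: "\<And>i::nat. B i \<in> sets M" and le: "\<forall>\<^sub>F i in sequentially. emeasure M (B i) \<le> b"
  shows "{\<omega> \<in> space M. \<forall>\<^sub>F i in sequentially. \<omega> \<in> B i} \<in> sets M" (is "?A \<in> _")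
    and "emeasure M {\<omega> \<in> space M. \<forall>\<^sub>F i in sequentially. \<omega> \<in> B i} \<le> b"
proof -
  have "?A = (\<Union>N. \<Inter>i\<in>{N..}. B i)"
    using sets.sets_into_space[OF B] by (fastforce simp: eventually_sequentially)
  then show A: "?A \<in> sets M" using B by (auto intro!: sets.countable_UN sets.countable_INT'')
  have "emeasure M ?A = (\<integral>\<^sup>+\<omega>. indicator ?A \<omega> \<partial>M)" using A by simp
  also have "\<dots> \<le> (\<integral>\<^sup>+\<omega>. liminf (\<lambda>i. indicator (B i) \<omega>) \<partial>M)"
  proof (rule nn_integral_mono)
    fix \<omega> show "indicator ?A \<omega> \<le> liminf (\<lambda>i. indicator (B i) \<omega> :: ennreal)"
    proof (cases "\<omega> \<in> ?A")
      case True
      then have "\<forall>\<^sub>F i in sequentially. 1 \<le> (indicator (B i) \<omega> :: ennreal)"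
        by (auto elim!: eventually_mono)
      then have "1 \<le> liminf (\<lambda>i. indicator (B i) \<omega> :: ennreal)" by (rule Liminf_bounded)
      then show ?thesis using True by simp
    qed simp
  qed
  also have "\<dots> \<le> liminf (\<lambda>i. \<integral>\<^sup>+\<omega>. indicator (B i) \<omega> \<partial>M)"
    using B by (intro nn_integral_liminf) auto
  also have "\<dots> \<le> b"
  proof -
    have "liminf (\<lambda>i. emeasure M (B i)) \<le> limsup (\<lambda>i. emeasure M (B i))" by (rule Liminf_le_Limsup) simp
    also have "\<dots> \<le> b" using le by (rule Limsup_bounded)
    finally show ?thesis using B by simp
  qed
  finally show "emeasure M ?A \<le> b" .
qed

lemma euler_box_sets: "euler_box X \<delta> Y \<eta> r1 \<in> sets borel"
proof -
  have "closed (euler_box X \<delta> Y \<eta> r1)" unfolding euler_box_def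
    by (intro closed_Collect_conj closed_Collect_le continuous_intros)
  then show ?thesis by simp
qed

lemma success_region_sets: "success_region X \<delta> Y \<eta> \<in> sets borel"
proof -
  note [measurable] = borel_measurable_pair_components
  have "{p \<in> space borel. \<bar>Re (fst p)\<bar> \<le> X \<and> \<delta> \<le> Im (fst p) \<and> Im (fst p) \<le> Y \<and> 0 < snd p \<and> snd p < \<eta>} \<in> sets (borel :: (complex \<times> real) measure)"
    by measurable
  then show ?thesis by (simp add: success_region_def)
qed

text \<open>Markov's inequality: on success the potential is at least 1/2, and its mean never
  exceeds the initial value. The bound depends neither on the mesh nor on the number of steps or the
  box.\<close>

lemma euler_chain_success_probability:
  assumes bm: "standard_brownian_motion M U" and m: "0 < m" and a: "4 * a = 1 + 2 * m"
    and c: "0 \<le> c" "c < m" and n: "2 * m * (1 + m) < n" and \<delta>: "0 < \<delta>" and X: "0 \<le> X" and r0: "1 \<le> r0"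
  shows "\<exists>\<eta>>0. \<eta> < 1 \<and> (\<exists>h0>0. \<forall>h N. 0 < h \<longrightarrow> h \<le> h0 \<longrightarrow>
    (let B = {\<omega> \<in> space M. euler_chain a h (euler_box X \<delta> Y \<eta> r0) (\<zeta>, r0)
        (\<lambda>i. U (real (Suc i) * h) \<omega> - U (real i * h) \<omega>) N \<in> success_region X \<delta> Y \<eta>}
     in B \<in> sets M \<and> emeasure M B \<le> ennreal (2 * potential m c n (\<zeta>, r0))))"
proof -
  interpret prob_space M using bm by (simp add: standard_brownian_motion_def)
  have n0: "0 \<le> n" using n mult_nonneg_nonneg[of "2 * m" "1 + m"] m by linarith
  obtain \<eta> where \<eta>: "0 < \<eta>" "\<eta> < 1" and half: "\<And>z r. \<bar>Re z\<bar> \<le> X \<Longrightarrow> \<delta> \<le> Im z \<Longrightarrow> Im z \<le> Y \<Longrightarrow> 0 < r \<Longrightarrow> r < \<eta> \<Longrightarrow> 1 / 2 \<le> potential m c n (z, r)"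
    using potential_ge_half[OF m n0 \<delta> X, of Y c] by blast
  obtain h0 where h0: "0 < h0" and step: "\<And>h p. h \<in> {0<..h0} \<Longrightarrow> p \<in> euler_box X \<delta> Y \<eta> r0 \<Longrightarrow>
    (\<integral>\<^sup>+\<xi>. ennreal (normal_density 0 (sqrt h) \<xi>) * ennreal (potential m c n (euler_step a h p \<xi>)) \<partial>lborel)
      \<le> ennreal (potential m c n p)"
    using nn_integral_potential_step[OF m a c n \<delta> \<eta>(1), of X Y r0] by blast
  show ?thesis
  proof (rule exI[of _ \<eta>], intro conjI \<eta>, rule exI[of _ h0], intro conjI h0 allI impI)
    fix h N assume h: "0 < h" "h \<le> h0"
    let ?K = "euler_box X \<delta> Y \<eta> r0" and ?S = "success_region X \<delta> Y \<eta>" and ?V = "potential m c n"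
    define \<xi> where "\<xi> i \<omega> = U (real (Suc i) * h) \<omega> - U (real i * h) \<omega>" for i \<omega>
    let ?c = "\<lambda>\<omega>. euler_chain a h ?K (\<zeta>, r0) (\<lambda>i. \<xi> i \<omega>) N"
    have "indep_vars (\<lambda>_. borel) (\<lambda>i \<omega>. U ((\<lambda>i. real i * h) (Suc i)) \<omega> - U ((\<lambda>i. real i * h) i) \<omega>) {..<N}"
      using bm h unfolding standard_brownian_motion_def by (elim conjE allE[of _ N] allE[of _ "\<lambda>i. real i * h"]) auto
    then have ind: "indep_vars (\<lambda>_. borel) \<xi> {..<N}" by (simp add: \<xi>_def[abs_def])
    have dist: "distributed M lborel (\<xi> i) (normal_density 0 (sqrt h))" for i
    proof -
      have "0 \<le> real i * h \<and> real i * h < real (Suc i) * h" using h by simp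
      moreover have "\<forall>s t. 0 \<le> s \<and> s < t \<longrightarrow> distributed M lborel (\<lambda>\<omega>. U t \<omega> - U s \<omega>) (normal_density 0 (sqrt (t - s)))"
        using bm by (simp add: standard_brownian_motion_def)
      ultimately have "distributed M lborel (\<lambda>\<omega>. U (real (Suc i) * h) \<omega> - U (real i * h) \<omega>)
          (normal_density 0 (sqrt (real (Suc i) * h - real i * h)))" by blast
      moreover have "real (Suc i) * h - real i * h = h" by (simp add: algebra_simps)
      ultimately show ?thesis by (simp only: \<xi>_def[abs_def])
    qed
    have exp_le: "(\<integral>\<^sup>+\<omega>. ennreal (?V (?c \<omega>)) \<partial>M) \<le> ennreal (?V (\<zeta>, r0))"
      using h by (intro nn_integral_potential_chain[OF ind dist euler_box_sets potential_measurable step]) auto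
    have \<xi>m: "\<xi> i \<in> borel_measurable M" for i
      using distributed_measurable[OF dist[of i]] by simp
    have "(\<lambda>\<omega>. \<lambda>i\<in>{..<N}. \<xi> i \<omega>) \<in> M \<rightarrow>\<^sub>M PiM {..<N} (\<lambda>_. borel)"
      using \<xi>m by (intro measurable_restrict) auto
    from measurable_compose[OF this euler_chain_measurable[OF euler_box_sets order_refl]]
    have "(\<lambda>\<omega>. euler_chain a h ?K (\<zeta>, r0) (\<lambda>i\<in>{..<N}. \<xi> i \<omega>) N) \<in> borel_measurable M" .
    moreover have "euler_chain a h ?K (\<zeta>, r0) (\<lambda>i\<in>{..<N}. \<xi> i \<omega>) N = ?c \<omega>" for \<omega>
      by (rule euler_chain_cong) simp
    ultimately have cm: "?c \<in> borel_measurable M" by simp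
    define B where "B = {\<omega> \<in> space M. ?c \<omega> \<in> ?S}"
    have B: "B \<in> sets M"
      using measurable_sets[OF cm success_region_sets] by (simp add: B_def vimage_def Int_def conj_commute)
    have "emeasure M B = (\<integral>\<^sup>+\<omega>. indicator B \<omega> \<partial>M)" using B by simp
    also have "\<dots> \<le> (\<integral>\<^sup>+\<omega>. 2 * ennreal (?V (?c \<omega>)) \<partial>M)"
    proof (rule nn_integral_mono)
      fix \<omega> show "indicator B \<omega> \<le> 2 * ennreal (?V (?c \<omega>))"
      proof (cases "\<omega> \<in> B")
        case True
        then have "1 / 2 \<le> ?V (?c \<omega>)"
          using half[of "fst (?c \<omega>)" "snd (?c \<omega>)"] by (auto simp: B_def success_region_def)
        then have "ennreal 1 \<le> ennreal (2 * ?V (?c \<omega>))" by (intro ennreal_leI) simp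
        then show ?thesis using True by (simp add: ennreal_mult potential_nonneg)
      qed simp
    qed
    also have "\<dots> = 2 * (\<integral>\<^sup>+\<omega>. ennreal (?V (?c \<omega>)) \<partial>M)"
      using measurable_compose[OF measurable_compose[OF cm potential_measurable] measurable_ennreal]
      by (intro nn_integral_cmult)
    also have "\<dots> \<le> 2 * ennreal (?V (\<zeta>, r0))" by (intro mult_left_mono exp_le) simp
    also have "\<dots> = ennreal (2 * ?V (\<zeta>, r0))" by (simp add: ennreal_mult potential_nonneg)
    finally show "let B = {\<omega> \<in> space M. euler_chain a h ?K (\<zeta>, r0)
        (\<lambda>i. U (real (Suc i) * h) \<omega> - U (real i * h) \<omega>) N \<in> ?S}
     in B \<in> sets M \<and> emeasure M B \<le> ennreal (2 * ?V (\<zeta>, r0))"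
      using B unfolding B_def \<xi>_def Let_def by blast
  qed
qed

text \<open>The event about the flow is only enclosed in a measurable set, which avoids discussing
  its own measurability. It is essential that C is uniform in the starting point and in r0.\<close>

lemma loewner_flow_estimate:
  assumes a: "1 / 4 < a" and m: "m = (4 * a - 1) / 2"
  shows "\<exists>C>0. \<forall>(M :: 'a measure) U \<zeta> r0. standard_brownian_motion M U \<longrightarrow> \<zeta> \<in> upper_half_plane \<longrightarrow> 1 \<le> r0 \<longrightarrow>
    (\<exists>A\<in>sets M. emeasure M A \<le> ennreal (C * exp (- m * r0) * sin_sq (Re \<zeta>) (Im \<zeta>) powr m) \<and>
      (\<forall>\<omega>\<in>space M. U 0 \<omega> = 0 \<longrightarrow> continuous_on {0..} (\<lambda>t. U t \<omega>) \<longrightarrow>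
        (\<exists>T\<ge>0. \<exists>g. loewner_solution a (\<lambda>t. U t \<omega>) \<zeta> T g \<and>
          r0 \<le> integral {0..T} (\<lambda>s. radial_speed (g s - of_real (U s \<omega>)))) \<longrightarrow> \<omega> \<in> A))"
proof -
  have m0: "0 < m" and a4: "4 * a = 1 + 2 * m" using a m by auto
  define n where "n = 2 * m * (1 + m) + 1"
  define C where "C = 2 * (exp (n + m) * 2 powr m * exp 1)"
  have "\<exists>A\<in>sets M. emeasure M A \<le> ennreal (C * exp (- m * r0) * sin_sq (Re \<zeta>) (Im \<zeta>) powr m) \<and>
      (\<forall>\<omega>\<in>space M. U 0 \<omega> = 0 \<longrightarrow> continuous_on {0..} (\<lambda>t. U t \<omega>) \<longrightarrow>
        (\<exists>T\<ge>0. \<exists>g. loewner_solution a (\<lambda>t. U t \<omega>) \<zeta> T g \<and>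
          r0 \<le> integral {0..T} (\<lambda>s. radial_speed (g s - of_real (U s \<omega>)))) \<longrightarrow> \<omega> \<in> A)"
    if bm: "standard_brownian_motion M U" and \<zeta>: "\<zeta> \<in> upper_half_plane" and r0: "1 \<le> r0"
    for M :: "'a measure" and U \<zeta> r0
  proof -
    \<comment> \<open>Strictly below m for the one-step estimate, yet (m - c) r0 \<le> 1, so only a
      factor e is lost; the minimum keeps c nonnegative.\<close>
    define c where "c = m - min m (1 / r0)"
    have c: "0 \<le> c" "c < m" using m0 r0 by (auto simp: c_def min_def)
    define b where "b = C * exp (- m * r0) * sin_sq (Re \<zeta>) (Im \<zeta>) powr m"
    have pot: "2 * potential m c n (\<zeta>, r0) \<le> b"
    proof -
      have "(m - c) * r0 \<le> 1" using r0 by (auto simp: c_def min_def field_simps)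
      then have "- c * r0 \<le> 1 + - m * r0" by (simp add: algebra_simps)
      then have "exp (- c * r0) \<le> exp 1 * exp (- m * r0)" unfolding exp_add[symmetric] by simp
      then have "2 * (exp (n + m) * 2 powr m * (exp (- c * r0) * sin_sq (Re \<zeta>) (Im \<zeta>) powr m))
          \<le> 2 * (exp (n + m) * 2 powr m * (exp 1 * exp (- m * r0) * sin_sq (Re \<zeta>) (Im \<zeta>) powr m))"
        by (intro mult_left_mono mult_right_mono) auto
      then show ?thesis
        using r0 by (simp add: potential_def on_angle_def far_potential_def b_def C_def mult_ac)
    qed
    \<comment> \<open>Boxes that grow in width and height while their distance to the real line
      shrinks; any given trajectory lies well inside all but finitely many of them.\<close>
    define X where "X j = real j + 1" for j :: nat
    define \<delta> where "\<delta> j = 1 / (real j + 1)" for j :: nat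
    define h where "h i = 1 / (real i + 1)" for i :: nat
    have h: "0 < h i" for i by (simp add: h_def)
    define E where "E j \<eta> h N = {\<omega> \<in> space M. euler_chain a h (euler_box (X j) (\<delta> j) (X j) \<eta> r0) (\<zeta>, r0)
        (\<lambda>i. U (real (Suc i) * h) \<omega> - U (real i * h) \<omega>) N \<in> success_region (X j) (\<delta> j) (X j) \<eta>}" for j \<eta> h N
    have "\<exists>\<eta>>0. \<eta> < 1 \<and> (\<exists>h0>0. \<forall>h N. 0 < h \<longrightarrow> h \<le> h0 \<longrightarrow>
      E j \<eta> h N \<in> sets M \<and> emeasure M (E j \<eta> h N) \<le> ennreal (2 * potential m c n (\<zeta>, r0)))" for j
    proof -
      have "2 * m * (1 + m) < n" "0 < \<delta> j" "0 \<le> X j" by (auto simp: n_def \<delta>_def X_def)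
      from euler_chain_success_probability[OF bm m0 a4 c this r0, of "X j" \<zeta>]
      show ?thesis unfolding E_def Let_def .
    qed
    then obtain \<eta> h0 where \<eta>: "\<And>j. 0 < \<eta> j" "\<And>j. \<eta> j < 1" and h0: "\<And>j. 0 < h0 j"
      and prob: "\<And>j h N. 0 < h \<Longrightarrow> h \<le> h0 j \<Longrightarrow>
        E j (\<eta> j) h N \<in> sets M \<and> emeasure M (E j (\<eta> j) h N) \<le> ennreal (2 * potential m c n (\<zeta>, r0))"
      by metis
    define B where "B j i = (if h i \<le> h0 j then E j (\<eta> j) (h i) (Suc i * Suc i) else {})" for j i
    have B: "B j i \<in> sets M" "emeasure M (B j i) \<le> ennreal b" for j i
      using prob[OF h[of i], of j "Suc i * Suc i"] order_trans[OF _ ennreal_leI[OF pot]] unfolding B_def by auto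
    define Aj where "Aj j = {\<omega> \<in> space M. \<forall>\<^sub>F i in sequentially. \<omega> \<in> B j i}" for j
    have Aj: "Aj j \<in> sets M" "emeasure M (Aj j) \<le> ennreal b" for j
      using emeasure_eventually_le[of "B j" M "ennreal b"] B unfolding Aj_def by auto
    define A where "A = {\<omega> \<in> space M. \<forall>\<^sub>F j in sequentially. \<omega> \<in> Aj j}"
    have A: "A \<in> sets M" "emeasure M A \<le> ennreal b"
      using emeasure_eventually_le[of Aj M "ennreal b"] Aj unfolding A_def by auto
    have h_lim: "h \<longlonglongrightarrow> 0"
      using LIMSEQ_inverse_real_of_nat by (simp add: h_def[abs_def] inverse_eq_divide add.commute)
    have mem: "\<omega> \<in> A" if \<omega>: "\<omega> \<in> space M" and U0: "U 0 \<omega> = 0" and Uc: "continuous_on {0..} (\<lambda>t. U t \<omega>)"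
      and T: "0 \<le> T" and g: "loewner_solution a (\<lambda>t. U t \<omega>) \<zeta> T g"
      and r: "r0 \<le> integral {0..T} (\<lambda>s. radial_speed (g s - of_real (U s \<omega>)))" for \<omega> T g
    proof -
      have UT: "continuous_on {0..T} (\<lambda>t. U t \<omega>)" using Uc by (auto elim: continuous_on_subset)
      have a0: "0 < a" using a by simp
      have "continuous_on {0..T} (\<lambda>s. g s - of_real (U s \<omega>))"
        using loewner_solution_continuous[OF g] UT by (intro continuous_intros)
      then have "bounded ((\<lambda>s. g s - of_real (U s \<omega>)) ` {0..T})"
        by (intro compact_imp_bounded compact_continuous_image) auto
      then obtain bz where bz: "\<And>s. s \<in> {0..T} \<Longrightarrow> cmod (g s - of_real (U s \<omega>)) \<le> bz"
        unfolding bounded_iff by blast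
      have \<zeta>0: "0 < Im \<zeta>" using \<zeta> by (simp add: upper_half_plane_def)
      define y where "y = Im (g T)"
      have y: "0 < y" using Im_loewner_solution_pos[OF g UT _ \<zeta>0] T by (simp add: y_def)
      have Img: "y \<le> Im (g s)" if "s \<in> {0..T}" for s
        unfolding y_def by (rule Im_loewner_solution_mono[OF g UT that \<zeta>0 a0])
      obtain j0 where j0: "bz < real j0" "2 / y < real j0"
        using reals_Archimedean2[of "max bz (2 / y)"] by auto
      have "\<omega> \<in> Aj j" if j: "j0 \<le> j" for j
      proof -
        have "bz < real j" "2 / y < real j" using j0 j by (auto intro: less_le_trans)
        have \<delta>j: "2 * \<delta> j \<le> y"
        proof -
          have "2 < y * real j" using \<open>2 / y < real j\<close> y by (simp add: field_simps)
          then have "2 \<le> y * (real j + 1)" using y by (simp add: algebra_simps)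
          then show ?thesis by (simp add: \<delta>_def field_simps)
        qed
        have "\<exists>h'>0. \<forall>h\<in>{0<..h'}. \<exists>k. real k * h \<le> T \<and> (\<forall>n\<ge>k.
          euler_chain a h (euler_box (X j) (\<delta> j) (X j) (\<eta> j) r0) (\<zeta>, r0) (\<lambda>i. U (real (Suc i) * h) \<omega> - U (real i * h) \<omega>) n
            \<in> success_region (X j) (\<delta> j) (X j) (\<eta> j))"
        proof (rule euler_chain_success[OF a0 T UT U0 g _ \<eta>(1) _ _ _ _ r])
          show "0 < \<delta> j" by (simp add: \<delta>_def)
          show "\<eta> j \<le> r0" using \<eta>(2)[of j] r0 by simp
          fix s assume s: "s \<in> {0..T}"
          have "\<bar>Re (g s - of_real (U s \<omega>))\<bar> \<le> bz" "\<bar>Im (g s - of_real (U s \<omega>))\<bar> \<le> bz"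
            using bz[OF s] abs_Re_le_cmod abs_Im_le_cmod order_trans by blast+
          then show "\<bar>Re (g s - of_real (U s \<omega>))\<bar> + 1 \<le> X j" "Im (g s) + 1 \<le> X j"
            using \<open>bz < real j\<close> by (auto simp: X_def)
          show "2 * \<delta> j \<le> Im (g s)" using \<delta>j Img[OF s] by simp
        qed
        then obtain h' where h': "0 < h'" and succ: "\<forall>h\<in>{0<..h'}. \<exists>k. real k * h \<le> T \<and> (\<forall>n\<ge>k.
          euler_chain a h (euler_box (X j) (\<delta> j) (X j) (\<eta> j) r0) (\<zeta>, r0) (\<lambda>i. U (real (Suc i) * h) \<omega> - U (real i * h) \<omega>) n
            \<in> success_region (X j) (\<delta> j) (X j) (\<eta> j))"
          by (elim exE conjE)
        have "\<forall>\<^sub>F i in sequentially. h i < min h' (h0 j)"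
          using order_tendstoD(2)[OF h_lim, of "min h' (h0 j)"] h' h0[of j] by simp
        moreover have "\<forall>\<^sub>F i in sequentially. T \<le> real i"
          using filterlim_real_sequentially by (simp add: filterlim_at_top)
        ultimately have "\<forall>\<^sub>F i in sequentially. \<omega> \<in> B j i"
        proof eventually_elim
          case (elim i)
          obtain k where k: "real k * h i \<le> T" and S: "\<And>n. k \<le> n \<Longrightarrow>
            euler_chain a (h i) (euler_box (X j) (\<delta> j) (X j) (\<eta> j) r0) (\<zeta>, r0) (\<lambda>k. U (real (Suc k) * h i) \<omega> - U (real k * h i) \<omega>) n
            \<in> success_region (X j) (\<delta> j) (X j) (\<eta> j)"
          proof -
            have "h i \<in> {0<..h'}" using elim h[of i] by simp
            from bspec[OF succ this] that show ?thesis by blast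
          qed
          have "real k \<le> T * (real i + 1)" using k by (simp add: h_def field_simps)
          also have "\<dots> \<le> (real i + 1) * (real i + 1)" using elim by (intro mult_right_mono) auto
          also have "\<dots> = real (Suc i * Suc i)" by (simp add: algebra_simps)
          finally have "k \<le> Suc i * Suc i" by (simp only: of_nat_le_iff)
          from S[OF this] show ?case using elim \<omega> by (simp add: B_def E_def)
        qed
        then show ?thesis using \<omega> by (simp add: Aj_def)
      qed
      then show ?thesis using \<omega> by (auto simp: A_def eventually_sequentially)
    qed
    show ?thesis
      using A mem unfolding b_def by (intro bexI[of _ A]) auto
  qed
  then show ?thesis by (intro exI[of _ C] conjI) (auto simp: C_def)
qed

section \<open>The one-point estimate and the limit\<close>

lemma infdist_lessD:
  assumes "S \<noteq> {}" "infdist z S < e" shows "\<exists>w\<in>S. dist z w < e"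
  using cInf_lessD[of "dist z ` S" e] assms by (auto simp: infdist_notempty)

lemma ball_infdist_frontier_subset:
  fixes z :: "'a::real_normed_vector"
  assumes "z \<in> D" shows "ball z (infdist z (frontier D)) \<subseteq> D"
proof (rule ccontr)
  assume n: "\<not> ?thesis"
  then have "0 < infdist z (frontier D)" by (metis ball_empty empty_subsetI not_le)
  then have "z \<in> ball z (infdist z (frontier D))" by simp
  then have "ball z (infdist z (frontier D)) \<inter> D \<noteq> {}" using assms by blast
  then obtain p where "p \<in> ball z (infdist z (frontier D))" "p \<in> frontier D"
    using connected_Int_frontier[of "ball z (infdist z (frontier D))" D] n by auto
  then show False using infdist_le[of p "frontier D" z] by simp
qed

lemma sin_Arg_powr:
  assumes "0 < Im z" shows "sin (Arg z) powr (2 * m) = sin_sq (Re z) (Im z) powr m" "0 < sin (Arg z)"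
proof -
  have z: "0 < cmod z" using assms by auto
  have "Im z = cmod z * sin (Arg z)"
    by (metis Im_rcis rcis_cmod_Arg)
  then have s: "sin (Arg z) = Im z / cmod z" using z by (simp add: field_simps)
  then show pos: "0 < sin (Arg z)" using assms z by simp
  have "sin (Arg z) powr (2 * m) = (sin (Arg z) powr 2) powr m" by (simp add: powr_powr)
  also have "sin (Arg z) powr 2 = (sin (Arg z))\<^sup>2" using pos by (simp add: powr_numeral)
  also have "\<dots> = sin_sq (Re z) (Im z)" unfolding s sin_sq_def by (simp add: power_divide cmod_power2)
  finally show "sin (Arg z) powr (2 * m) = sin_sq (Re z) (Im z) powr m" .
qed

lemma Upsilon_le_infdist_frontier:
  assumes D: "simply_connected_domain D" and F: "conformal_map upper_half_plane D F" and z: "z \<in> D"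
  shows "0 < infdist z (frontier D)" "Upsilon D z \<le> 24 * infdist z (frontier D)"
proof -
  have o: "open D" and ne: "D \<noteq> {}" "D \<noteq> UNIV" using D by (auto simp: simply_connected_domain_def)
  have fne: "frontier D \<noteq> {}" using ne frontier_eq_empty by blast
  have disj: "D \<inter> frontier D = {}" using o frontier_disjoint_eq by blast
  obtain p where p: "p \<in> frontier D" "infdist z (frontier D) = dist z p"
    using infdist_attains_inf[OF frontier_closed fne] by metis
  then have "p \<notin> D" using disj by blast
  then show "Upsilon D z \<le> 24 * infdist z (frontier D)"
    using Upsilon_le_dist[OF F z] p by (simp add: dist_norm)
  show "0 < infdist z (frontier D)" using p z \<open>p \<notin> D\<close> by auto
qed

lemma SLE_Green_pos:
  assumes F: "conformal_map upper_half_plane D F"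
    and w: "filtermap F half_plane_zero = w1" "filtermap F half_plane_infinity = w2" and z: "z \<in> D"
  shows "0 < SLE_Green \<kappa> D w1 w2 z"
proof -
  obtain \<zeta> where \<zeta>: "\<zeta> \<in> upper_half_plane" "F \<zeta> = z" using F z by (rule conformal_map_obtain)
  have "sin_arg D w1 w2 z = sin (Arg \<zeta>)" using sin_arg_conformal[OF F w \<zeta>(1)] \<zeta>(2) by simp
  then have "0 < sin_arg D w1 w2 z" using sin_Arg_powr(2) \<zeta>(1) by (simp add: upper_half_plane_def)
  then show ?thesis using Upsilon_pos[OF F z] by (simp add: SLE_Green_def)
qed

text \<open>A path within \<open>\<epsilon>\<close> of \<open>z\<close> makes the conformal radius of the
  slit half-plane seen from the preimage of \<open>z\<close> drop by a factor of order \<open>\<epsilon> / dist(z, \<partial>D)\<close>, and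
  the probability of this is controlled by the Loewner flow.\<close>

lemma trace_probability_bound:
  assumes \<kappa>: "0 < \<kappa>" "\<kappa> < 8" and D: "simply_connected_domain D"
    and sle: "chordal_SLE \<kappa> M \<gamma>" and F: "conformal_map upper_half_plane D F"
    and w: "filtermap F half_plane_zero = w1" "filtermap F half_plane_infinity = w2"
  shows "\<exists>C>0. \<exists>\<theta>>0. \<forall>z\<in>D. \<forall>\<epsilon>>0. \<epsilon> \<le> \<theta> * infdist z (frontier D) \<longrightarrow>
    (\<forall>E\<in>sets M. E \<subseteq> {\<omega> \<in> space M. within_dist z (image_trace F (\<lambda>t. \<gamma> t \<omega>)) \<epsilon>} \<longrightarrow>
      emeasure M E \<le> ennreal (C * SLE_Green \<kappa> D w1 w2 z * \<epsilon> powr (2 - sle_dim \<kappa>)))"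
proof -
  define a where "a = sle_a \<kappa>"
  define m where "m = (4 * a - 1) / 2"
  define q where "q = 2 - sle_dim \<kappa>"
  have a: "1 / 4 < a" "0 < a" using \<kappa> by (auto simp: a_def sle_a_def field_simps)
  have m: "0 < m" using a by (simp add: m_def)
  \<comment> \<open>A factor in the conformal radius becomes clock time through 2 a, so the decay
    rate m turns into the exponent m / (2 a) = 2 - d.\<close>
  have q: "m / (2 * a) = q" "0 < q" using \<kappa> by (auto simp: m_def q_def a_def sle_a_def sle_dim_def field_simps)
  obtain C0 where C0: "0 < C0" and flow: "\<And>(M :: 'a measure) U \<zeta> r0. standard_brownian_motion M U \<Longrightarrow> \<zeta> \<in> upper_half_plane \<Longrightarrow> 1 \<le> r0 \<Longrightarrow>
    (\<exists>A\<in>sets M. emeasure M A \<le> ennreal (C0 * exp (- m * r0) * sin_sq (Re \<zeta>) (Im \<zeta>) powr m) \<and>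
      (\<forall>\<omega>\<in>space M. U 0 \<omega> = 0 \<longrightarrow> continuous_on {0..} (\<lambda>t. U t \<omega>) \<longrightarrow>
        (\<exists>T\<ge>0. \<exists>g. loewner_solution a (\<lambda>t. U t \<omega>) \<zeta> T g \<and>
          r0 \<le> integral {0..T} (\<lambda>s. radial_speed (g s - of_real (U s \<omega>)))) \<longrightarrow> \<omega> \<in> A))"
    using loewner_flow_estimate[OF a(1) m_def, where 'a = 'a] by blast
  obtain U where bm: "standard_brownian_motion M U"
    and ae: "AE \<omega> in M. \<gamma> 0 \<omega> = 0 \<and> filterlim (\<lambda>t. \<gamma> t \<omega>) at_infinity at_top \<and>
           (\<forall>t\<ge>0. loewner_domain a (\<lambda>s. U s \<omega>) t \<in> components (upper_half_plane - (\<lambda>s. \<gamma> s \<omega>) ` {0<..t}) \<and>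
              \<not> bounded (loewner_domain a (\<lambda>s. U s \<omega>) t))"
    using sle unfolding chordal_SLE_def a_def by blast
  have \<gamma>c: "continuous_on {0..} (\<lambda>t. \<gamma> t \<omega>)" "\<And>t. 0 \<le> t \<Longrightarrow> \<gamma> t \<omega> \<in> closure upper_half_plane"
    if "\<omega> \<in> space M" for \<omega> using sle that unfolding chordal_SLE_def by blast+
  have aeU: "AE \<omega> in M. U 0 \<omega> = 0 \<and> continuous_on {0..} (\<lambda>t. U t \<omega>)"
    using bm by (simp add: standard_brownian_motion_def)
  \<comment> \<open>The bound 1/16 leaves room for the distortion estimate and puts the half-plane
    radius below Im \<zeta>; the other bound gives x \<le> exp (- 2 a), that is r0 \<ge> 1.\<close>
  define \<theta> where "\<theta> = min (1 / 16) (exp (- (2 * a)) / 384)"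
  have \<theta>: "0 < \<theta>" "\<theta> \<le> 1 / 16" "\<theta> \<le> exp (- (2 * a)) / 384" by (auto simp: \<theta>_def)
  define C where "C = C0 * (384 * 24) powr q"
  have C: "0 < C" using C0 by (simp add: C_def)
  have main: "emeasure M E \<le> ennreal (C * SLE_Green \<kappa> D w1 w2 z * \<epsilon> powr q)"
    if z: "z \<in> D" and \<epsilon>: "0 < \<epsilon>" "\<epsilon> \<le> \<theta> * infdist z (frontier D)" and E: "E \<in> sets M"
      "E \<subseteq> {\<omega> \<in> space M. within_dist z (image_trace F (\<lambda>t. \<gamma> t \<omega>)) \<epsilon>}" for z \<epsilon> E
  proof -
    define d where "d = infdist z (frontier D)"
    have d: "0 < d" "Upsilon D z \<le> 24 * d" using Upsilon_le_infdist_frontier[OF D F z] by (auto simp: d_def)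
    have dD: "ball z d \<subseteq> D" unfolding d_def using z by (rule ball_infdist_frontier_subset)
    obtain \<zeta> where \<zeta>: "\<zeta> \<in> upper_half_plane" "F \<zeta> = z" using F z by (rule conformal_map_obtain)
    have Im\<zeta>: "0 < Im \<zeta>" using \<zeta> by (simp add: upper_half_plane_def)
    \<comment> \<open>384 = 48 * 8: the curve comes within 8 (\<epsilon> / d) Im \<zeta> of the
      preimage, and the conformal radius is at most 48 times that distance.\<close>
    define x where "x = 384 * (\<epsilon> / d)"
    have ed: "\<epsilon> / d \<le> \<theta>" using \<epsilon>(2) d by (simp add: d_def[symmetric] field_simps)
    have ed': "\<epsilon> / d \<le> 1 / 16" "\<epsilon> / d \<le> exp (- (2 * a)) / 384" "0 < \<epsilon> / d"
      by (rule order_trans[OF ed \<theta>(2)], rule order_trans[OF ed \<theta>(3)], rule divide_pos_pos[OF \<epsilon>(1) d(1)])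
    have "16 * \<epsilon> \<le> d" using ed'(1) d(1) by (simp add: field_simps)
    moreover have "x \<le> exp (- (2 * a))" using ed'(2) unfolding x_def by linarith
    moreover have "0 < x" using ed'(3) by (simp add: x_def)
    ultimately have x: "0 < x" "x \<le> exp (- (2 * a))" "16 * \<epsilon> \<le> d" by auto
    \<comment> \<open>The clock time at which the conformal radius has dropped by the factor x, that
      is exp (- 2 a r0) = x.\<close>
    define r0 where "r0 = - ln x / (2 * a)"
    have "ln x \<le> - (2 * a)" using x by (metis ln_exp ln_le_cancel_iff exp_gt_zero)
    then have r0: "1 \<le> r0" using a by (simp add: r0_def field_simps)
    obtain A where A: "A \<in> sets M" "emeasure M A \<le> ennreal (C0 * exp (- m * r0) * sin_sq (Re \<zeta>) (Im \<zeta>) powr m)"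
      and mem: "\<And>\<omega>. \<omega> \<in> space M \<Longrightarrow> U 0 \<omega> = 0 \<Longrightarrow> continuous_on {0..} (\<lambda>t. U t \<omega>) \<Longrightarrow>
        (\<exists>T\<ge>0. \<exists>g. loewner_solution a (\<lambda>t. U t \<omega>) \<zeta> T g \<and>
          r0 \<le> integral {0..T} (\<lambda>s. radial_speed (g s - of_real (U s \<omega>)))) \<Longrightarrow> \<omega> \<in> A"
      using flow[OF bm \<zeta>(1) r0] by blast
    have "AE \<omega> in M. \<omega> \<in> E \<longrightarrow> \<omega> \<in> A"
      using ae aeU AE_space
    proof eventually_elim
      case (elim \<omega>)
      show ?case
      proof
        assume "\<omega> \<in> E"
        then have wd: "within_dist z (image_trace F (\<lambda>t. \<gamma> t \<omega>)) \<epsilon>" using E(2) by blast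
        have comp: "\<And>t. 0 \<le> t \<Longrightarrow> loewner_domain a (\<lambda>s. U s \<omega>) t \<in> components (upper_half_plane - (\<lambda>s. \<gamma> s \<omega>) ` {0<..t})"
          using elim by blast
        \<comment> \<open>The infimum need not be attained, so \<epsilon> is doubled. Such a point
          still lies in D, hence it is the image of an interior point of the curve.\<close>
        obtain p where p: "p \<in> image_trace F (\<lambda>t. \<gamma> t \<omega>)" "dist z p < 2 * \<epsilon>"
          using infdist_lessD[of "image_trace F (\<lambda>t. \<gamma> t \<omega>)" z "2 * \<epsilon>"] wd \<epsilon> by (auto simp: within_dist_def)
        then have pD: "p \<in> D" using dD x \<epsilon> by (intro subsetD[OF dD]) auto
        obtain t where t: "0 \<le> t" "\<gamma> t \<omega> \<in> upper_half_plane" "F (\<gamma> t \<omega>) = p"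
          using image_trace_inter_domain[OF F pD, of "\<lambda>t. \<gamma> t \<omega>"] \<gamma>c(2)[OF elim(3)] p(1) by blast
        define r where "r = 8 * (\<epsilon> / d) * Im \<zeta>"
        have "cmod (\<gamma> t \<omega> - \<zeta>) \<le> 4 * (2 * \<epsilon> / d) * Im \<zeta>"
          using dD p(2) t(3) x \<epsilon> d \<zeta>(2)
          by (intro conformal_map_preimage_close[OF F \<zeta>(1) t(2)]) (auto simp: dist_norm norm_minus_commute)
        then have close: "cmod (\<gamma> t \<omega> - \<zeta>) \<le> r" by (simp add: r_def)
        have "8 * (\<epsilon> / d) < 1" using x \<epsilon> d by (simp add: field_simps)
        then have "r < 1 * Im \<zeta>" unfolding r_def using Im\<zeta> by (rule mult_strict_right_mono)
        then have r: "0 < r" "r < Im \<zeta>" using \<epsilon> d Im\<zeta> by (auto simp: r_def)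
        obtain T g where T: "0 \<le> T" "loewner_solution a (\<lambda>t. U t \<omega>) \<zeta> T g"
          and le: "Im \<zeta> * exp (- 2 * a * integral {0..T} (\<lambda>s. radial_speed (g s - of_real (U s \<omega>)))) \<le> 48 * r"
          using curve_approach_loewner[OF a(2) _ \<gamma>c(1)[OF elim(3)] _ comp \<zeta>(1) r t(1) close] elim by blast
        have "48 * r = Im \<zeta> * x" by (simp add: r_def x_def)
        then have "exp (- 2 * a * integral {0..T} (\<lambda>s. radial_speed (g s - of_real (U s \<omega>)))) \<le> x"
          using le Im\<zeta> by simp
        then have "- 2 * a * integral {0..T} (\<lambda>s. radial_speed (g s - of_real (U s \<omega>))) \<le> ln x"
          using x by (simp add: ln_ge_iff)
        then have "r0 \<le> integral {0..T} (\<lambda>s. radial_speed (g s - of_real (U s \<omega>)))"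
          using a by (simp add: r0_def field_simps)
        then show "\<omega> \<in> A" using mem[OF elim(3)] elim T by blast
      qed
    qed
    then have "emeasure M E \<le> emeasure M A" using A(1) by (rule emeasure_mono_AE)
    also note A(2)
    also have "C0 * exp (- m * r0) * sin_sq (Re \<zeta>) (Im \<zeta>) powr m \<le> C * SLE_Green \<kappa> D w1 w2 z * \<epsilon> powr q"
    proof -
      define \<Upsilon> where "\<Upsilon> = Upsilon D z"
      have \<Upsilon>: "0 < \<Upsilon>" "\<Upsilon> \<le> 24 * d" using Upsilon_pos[OF F z] d by (auto simp: \<Upsilon>_def)
      have "- m * r0 = q * ln x" using a q by (simp add: r0_def flip: q(1))
      then have "exp (- m * r0) = x powr q" using x by (simp add: powr_def)
      also have "\<dots> \<le> (384 * 24 * \<epsilon> / \<Upsilon>) powr q"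
      proof (intro powr_mono2)
        \<comment> \<open>The Koebe-type bound replaces the distance to the boundary by the
          conformal radius, which is what the Green's function contains.\<close>
        have "1 / d \<le> 24 / \<Upsilon>" using \<Upsilon> d by (simp add: field_simps)
        then have "384 * \<epsilon> * (1 / d) \<le> 384 * \<epsilon> * (24 / \<Upsilon>)" using \<epsilon> by (intro mult_left_mono) auto
        then show "x \<le> 384 * 24 * \<epsilon> / \<Upsilon>" by (simp add: x_def)
      qed (use x q in auto)
      also have "\<dots> = (384 * 24) powr q * \<epsilon> powr q * \<Upsilon> powr (- q)"
        using \<epsilon> \<Upsilon> by (simp add: powr_mult powr_divide powr_minus_divide)
      finally have 1: "exp (- m * r0) \<le> \<dots>" .
      have "sin_arg D w1 w2 z = sin (Arg \<zeta>)" using sin_arg_conformal[OF F w \<zeta>(1)] \<zeta>(2) by simp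
      moreover have "2 * m = 4 * sle_a \<kappa> - 1" by (simp add: m_def a_def)
      ultimately have 2: "sin_arg D w1 w2 z powr (4 * sle_a \<kappa> - 1) = sin_sq (Re \<zeta>) (Im \<zeta>) powr m"
        using sin_Arg_powr(1)[OF Im\<zeta>, of m] by simp
      have "C0 * exp (- m * r0) * sin_sq (Re \<zeta>) (Im \<zeta>) powr m
        \<le> C0 * ((384 * 24) powr q * \<epsilon> powr q * \<Upsilon> powr (- q)) * sin_sq (Re \<zeta>) (Im \<zeta>) powr m"
        using C0 by (intro mult_right_mono mult_left_mono 1) auto
      also have "\<dots> = C * SLE_Green \<kappa> D w1 w2 z * \<epsilon> powr q"
        unfolding SLE_Green_def 2 \<Upsilon>_def[symmetric] C_def by (simp add: q_def mult_ac)
      finally show ?thesis .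
    qed
    finally show ?thesis by (simp add: ennreal_leI)
  qed
  show ?thesis
    using C \<theta>(1) main unfolding q_def by (intro exI[of _ C] conjI exI[of _ \<theta>]) auto
qed

text \<open>Rational times suffice, so the event is a countable combination of measurable ones.\<close>

lemma within_dist_image_trace_iff:
  assumes F: "conformal_map upper_half_plane D F" and z: "z \<in> D"
    and d: "ball z d \<subseteq> D" "\<epsilon> < d"
    and \<eta>: "continuous_on {0..} \<eta>" "\<And>t. 0 \<le> t \<Longrightarrow> \<eta> t \<in> closure upper_half_plane"
  shows "within_dist z (image_trace F \<eta>) \<epsilon> \<longleftrightarrow>
    (\<forall>n::nat. \<exists>q\<in>\<rat> \<inter> {0..}. \<eta> q \<in> upper_half_plane \<and> cmod (F (\<eta> q) - z) < \<epsilon> + 1 / (real n + 1))"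
proof
  assume wd: "within_dist z (image_trace F \<eta>) \<epsilon>"
  show "\<forall>n::nat. \<exists>q\<in>\<rat> \<inter> {0..}. \<eta> q \<in> upper_half_plane \<and> cmod (F (\<eta> q) - z) < \<epsilon> + 1 / (real n + 1)"
  proof
    fix n :: nat
    \<comment> \<open>Capping at d keeps the witness inside D, where trace points come from interior
      points of the curve.\<close>
    define e where "e = min (\<epsilon> + 1 / (real n + 1)) d"
    have e: "\<epsilon> < e" "e \<le> d" "e \<le> \<epsilon> + 1 / (real n + 1)" using d by (auto simp: e_def)
    obtain w where w: "w \<in> image_trace F \<eta>" "dist z w < e"
      using infdist_lessD[of "image_trace F \<eta>" z e] wd e by (auto simp: within_dist_def)
    have wD: "w \<in> D" using w e d by (intro subsetD[OF d(1)]) auto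
    obtain t where t: "0 \<le> t" "\<eta> t \<in> upper_half_plane" "F (\<eta> t) = w"
      using iffD1[OF image_trace_inter_domain[OF F wD, of \<eta>, OF \<eta>(2)] w(1)] by blast
    have Fc: "continuous_on upper_half_plane F"
      using F by (auto simp: conformal_map_def intro: holomorphic_on_imp_continuous_on)
    define V where "V = {v \<in> upper_half_plane. F v \<in> ball z e}"
    have "V = upper_half_plane \<inter> F -` ball z e" by (auto simp: V_def)
    then have "open V" using continuous_open_preimage[OF Fc open_upper_half_plane open_ball] by simp
    moreover have "\<eta> t \<in> V" using t w by (simp add: V_def)
    \<comment> \<open>Being in V is an open condition and the curve is continuous, so the time may
      be moved to a nearby rational one.\<close>
    ultimately obtain r where r: "0 < r" "ball (\<eta> t) r \<subseteq> V" using open_contains_ball by blast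
    obtain s where s: "0 < s" "\<And>t'. 0 \<le> t' \<Longrightarrow> \<bar>t' - t\<bar> < s \<Longrightarrow> dist (\<eta> t') (\<eta> t) < r"
      using \<eta>(1) t(1) r(1) unfolding continuous_on_iff dist_real_def by (metis atLeast_iff)
    obtain q where q: "q \<in> \<rat>" "t < q" "q < t + s" using Rats_dense_in_real[of t "t + s"] s by auto
    have "\<eta> q \<in> V" using s(2)[of q] q t r by (auto simp: dist_commute)
    then show "\<exists>q\<in>\<rat> \<inter> {0..}. \<eta> q \<in> upper_half_plane \<and> cmod (F (\<eta> q) - z) < \<epsilon> + 1 / (real n + 1)"
      using q t e by (intro bexI[of _ q]) (auto simp: V_def dist_norm norm_minus_commute)
  qed
next
  assume q: "\<forall>n::nat. \<exists>q\<in>\<rat> \<inter> {0..}. \<eta> q \<in> upper_half_plane \<and> cmod (F (\<eta> q) - z) < \<epsilon> + 1 / (real n + 1)"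
  have ex: "\<exists>w\<in>image_trace F \<eta>. dist z w < \<epsilon> + 1 / (real n + 1)" for n :: nat
  proof -
    obtain q where q: "0 \<le> q" "\<eta> q \<in> upper_half_plane" "cmod (F (\<eta> q) - z) < \<epsilon> + 1 / (real n + 1)" using q by force
    have "\<exists>t\<ge>0. \<eta> t \<in> upper_half_plane \<and> F (\<eta> t) = F (\<eta> q)" using q by blast
    moreover have "F (\<eta> q) \<in> image_trace F \<eta> \<longleftrightarrow> (\<exists>t\<ge>0. \<eta> t \<in> upper_half_plane \<and> F (\<eta> t) = F (\<eta> q))"
      by (rule image_trace_inter_domain[OF F conformal_map_mem[OF F q(2)] \<eta>(2)])
    ultimately have "F (\<eta> q) \<in> image_trace F \<eta>" by (simp only:)
    then show ?thesis using q(3) by (intro bexI[of _ "F (\<eta> q)"]) (auto simp: dist_norm norm_minus_commute)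
  qed
  have "infdist z (image_trace F \<eta>) \<le> \<epsilon> + inverse (real (Suc n))" for n
  proof -
    obtain w where w: "w \<in> image_trace F \<eta>" "dist z w < \<epsilon> + 1 / (real n + 1)" using ex[of n] by blast
    then have "infdist z (image_trace F \<eta>) \<le> \<epsilon> + 1 / (real n + 1)" by (intro infdist_le2[OF w(1)]) simp
    then show ?thesis by (simp add: inverse_eq_divide add.commute)
  qed
  moreover have "(\<lambda>n. \<epsilon> + inverse (real (Suc n))) \<longlonglongrightarrow> \<epsilon> + 0"
    by (intro tendsto_add tendsto_const LIMSEQ_inverse_real_of_nat)
  ultimately have "infdist z (image_trace F \<eta>) \<le> \<epsilon>"
    using LIMSEQ_le_const[of "\<lambda>n. \<epsilon> + inverse (real (Suc n))" "\<epsilon> + 0"] by auto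
  moreover have "image_trace F \<eta> \<noteq> {}" using ex[of 0] by blast
  ultimately show "within_dist z (image_trace F \<eta>) \<epsilon>" by (simp add: within_dist_def)
qed

text \<open>The event in its countable form, jointly in the point and the sample, as Fubini
  requires. It describes the true event when \<epsilon> < \<delta>, since the disk of radius
  \<delta> about z then lies in D.\<close>

definition near_trace_set ::
  "complex set \<Rightarrow> (complex \<Rightarrow> complex) \<Rightarrow> (real \<Rightarrow> 'a \<Rightarrow> complex) \<Rightarrow> real \<Rightarrow> real \<Rightarrow> (complex \<times> 'a) set" where
  "near_trace_set D F \<gamma> \<delta> \<epsilon> = {(z, \<omega>). z \<in> D \<and> \<delta> \<le> infdist z (frontier D) \<and>
    (\<forall>n::nat. \<exists>q\<in>\<rat> \<inter> {0..}. \<gamma> q \<omega> \<in> upper_half_plane \<and> cmod (F (\<gamma> q \<omega>) - z) < \<epsilon> + 1 / (real n + 1))}"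

lemma near_trace_set_measurable:
  assumes D: "open D" and F: "conformal_map upper_half_plane D F" and \<gamma>: "\<And>t. 0 \<le> t \<Longrightarrow> \<gamma> t \<in> borel_measurable M"
  shows "{p \<in> space (lborel \<Otimes>\<^sub>M M). p \<in> near_trace_set D F \<gamma> \<delta> \<epsilon>} \<in> sets (lborel \<Otimes>\<^sub>M M)"
proof -
  let ?P = "(lborel :: complex measure) \<Otimes>\<^sub>M M"
  \<comment> \<open>F is unconstrained off the half-plane; cutting it off makes it Borel measurable
    without changing the event.\<close>
  define G where "G v = (if v \<in> upper_half_plane then F v else 0)" for v
  have H: "upper_half_plane \<in> sets borel" using open_upper_half_plane by simp
  have G: "G \<in> borel_measurable borel"
    unfolding G_def[abs_def] using F
    by (intro borel_measurable_continuous_on_if H) (auto simp: conformal_map_def intro: holomorphic_on_imp_continuous_on)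
  define A where "A q n = {p \<in> space ?P. \<gamma> q (snd p) \<in> upper_half_plane \<and> cmod (G (\<gamma> q (snd p)) - fst p) < \<epsilon> + 1 / (real n + 1)}"
    for q and n :: nat
  have A: "A q n \<in> sets ?P" if "0 \<le> q" for q n
  proof -
    have [measurable]: "(\<lambda>p. \<gamma> q (snd p)) \<in> borel_measurable ?P"
      by (rule measurable_compose[OF measurable_snd \<gamma>[OF that]])
    have [measurable]: "(\<lambda>p. G (\<gamma> q (snd p))) \<in> borel_measurable ?P"
      by (rule measurable_compose[OF \<open>(\<lambda>p. \<gamma> q (snd p)) \<in> borel_measurable ?P\<close> G])
    have [measurable]: "(\<lambda>p. fst p) \<in> borel_measurable ?P" by measurable
    note [measurable] = H
    show ?thesis unfolding A_def by measurable
  qed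
  have D': "{p \<in> space ?P. fst p \<in> D \<and> \<delta> \<le> infdist (fst p) (frontier D)} \<in> sets ?P"
  proof -
    have [measurable]: "D \<in> sets borel" using D by simp
    have [measurable]: "(\<lambda>p. fst p) \<in> borel_measurable ?P" by measurable
    have "(\<lambda>z::complex. infdist z (frontier D)) \<in> borel_measurable borel"
      by (intro borel_measurable_continuous_onI continuous_intros)
    from measurable_compose[OF \<open>(\<lambda>p. fst p) \<in> borel_measurable ?P\<close> this]
    have [measurable]: "(\<lambda>p. infdist (fst p) (frontier D)) \<in> borel_measurable ?P" .
    show ?thesis by measurable
  qed
  have "(\<Union>q\<in>\<rat> \<inter> {0..}. A q n) \<in> sets ?P" for n
    using A by (intro sets.countable_UN'' countable_Int1 countable_rat) auto
  then have "(\<Inter>n. \<Union>q\<in>\<rat> \<inter> {0..}. A q n) \<in> sets ?P"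
    by (intro sets.countable_INT) auto
  then have "{p \<in> space ?P. fst p \<in> D \<and> \<delta> \<le> infdist (fst p) (frontier D)} \<inter> (\<Inter>n. \<Union>q\<in>\<rat> \<inter> {0..}. A q n) \<in> sets ?P"
    by (rule sets.Int[OF D'])
  moreover have iff: "p \<in> near_trace_set D F \<gamma> \<delta> \<epsilon> \<longleftrightarrow> fst p \<in> D \<and> \<delta> \<le> infdist (fst p) (frontier D) \<and>
      (\<forall>n. \<exists>q\<in>\<rat> \<inter> {0..}. p \<in> A q n)" if "p \<in> space ?P" for p
  proof -
    have "p \<in> A q n \<longleftrightarrow> \<gamma> q (snd p) \<in> upper_half_plane \<and> cmod (F (\<gamma> q (snd p)) - fst p) < \<epsilon> + 1 / (real n + 1)" for q n
      using that by (cases "\<gamma> q (snd p) \<in> upper_half_plane") (simp_all add: A_def G_def)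
    then show ?thesis by (simp only: near_trace_set_def case_prod_beta mem_Collect_eq)
  qed
  have "{p \<in> space ?P. p \<in> near_trace_set D F \<gamma> \<delta> \<epsilon>} =
    {p \<in> space ?P. fst p \<in> D \<and> \<delta> \<le> infdist (fst p) (frontier D)} \<inter> (\<Inter>n. \<Union>q\<in>\<rat> \<inter> {0..}. A q n)"
  proof (rule set_eqI)
    fix p show "p \<in> {p \<in> space ?P. p \<in> near_trace_set D F \<gamma> \<delta> \<epsilon>} \<longleftrightarrow>
      p \<in> {p \<in> space ?P. fst p \<in> D \<and> \<delta> \<le> infdist (fst p) (frontier D)} \<inter> (\<Inter>n. \<Union>q\<in>\<rat> \<inter> {0..}. A q n)"
    proof (cases "p \<in> space ?P")
      case True
      show ?thesis unfolding mem_Collect_eq iff[OF True] Int_iff INT_iff UN_iff using True by simp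
    qed simp
  qed
  ultimately show ?thesis by (simp only:)
qed

theorem corollary2p4:
  fixes \<kappa> chat :: real
    and f :: "real \<Rightarrow> real"
    and D :: "complex set"
    and w1 w2 :: "complex filter"
    and M :: "'a measure"
    and \<Gamma> :: "'a \<Rightarrow> complex set"
  assumes "0 < \<kappa>" "\<kappa> < 8"
    and "SLE_Green_constant TYPE('a) \<kappa> chat"
    and "\<And>r. 0 < r \<Longrightarrow> 0 < f r"
    and "(f \<longlongrightarrow> 0) (at_right 0)"
    and "((\<lambda>r. r / f r) \<longlongrightarrow> 0) (at_right 0)"
    and "simply_connected_domain D"
    and "w1 \<in> prime_ends D" "w2 \<in> prime_ends D" "w1 \<noteq> w2"
    and "chordal_SLE_trace \<kappa> D w1 w2 M \<Gamma>"
  shows "((\<lambda>\<epsilon>. ennreal (\<epsilon> powr (sle_dim \<kappa> - 2)) * (\<integral>\<^sup>+\<omega>. Y_area D f (\<Gamma> \<omega>) \<epsilon> \<partial>M))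
           \<longlongrightarrow> ennreal chat * (\<integral>\<^sup>+z\<in>D. ennreal (SLE_Green \<kappa> D w1 w2 z) \<partial>lborel)) (at_right 0)"
proof -
  let ?G = "SLE_Green \<kappa> D w1 w2"
  define q where "q = 2 - sle_dim \<kappa>"
  note D = assms(7)
  have oD: "open D" using D by (simp add: simply_connected_domain_def)
  obtain \<gamma> F where sle: "chordal_SLE \<kappa> M \<gamma>" and F: "conformal_map upper_half_plane D F"
    and w: "filtermap F half_plane_zero = w1" "filtermap F half_plane_infinity = w2"
    and \<Gamma>: "\<And>\<omega>. \<omega> \<in> space M \<Longrightarrow> \<Gamma> \<omega> = image_trace F (\<lambda>t. \<gamma> t \<omega>)"
    using assms(11) unfolding chordal_SLE_trace_def by blast
  have \<gamma>m: "\<And>t. 0 \<le> t \<Longrightarrow> \<gamma> t \<in> borel_measurable M"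
    and \<gamma>c: "\<And>\<omega>. \<omega> \<in> space M \<Longrightarrow> continuous_on {0..} (\<lambda>t. \<gamma> t \<omega>)"
      "\<And>\<omega> t. \<omega> \<in> space M \<Longrightarrow> 0 \<le> t \<Longrightarrow> \<gamma> t \<omega> \<in> closure upper_half_plane"
    using sle unfolding chordal_SLE_def by blast+
  interpret prob_space M
    using sle unfolding chordal_SLE_def standard_brownian_motion_def by blast
  interpret P: pair_sigma_finite "lborel :: complex measure" M ..
  have c: "0 < chat" using assms(3) by (simp add: SLE_Green_constant_def)
  have Gpos: "0 < ?G z" if "z \<in> D" for z using SLE_Green_pos[OF F w that] .
  define Ev where "Ev z \<epsilon> = {\<omega> \<in> space M. within_dist z (\<Gamma> \<omega>) \<epsilon>}" for z \<epsilon>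
  define N where "N \<epsilon> = {p \<in> space (lborel \<Otimes>\<^sub>M M). p \<in> near_trace_set D F \<gamma> (f \<epsilon>) \<epsilon>}" for \<epsilon>
  have N: "N \<epsilon> \<in> sets (lborel \<Otimes>\<^sub>M M)" for \<epsilon>
    unfolding N_def by (rule near_trace_set_measurable[OF oD F \<gamma>m])
  have N_iff: "(z, \<omega>) \<in> N \<epsilon> \<longleftrightarrow> z \<in> D \<and> f \<epsilon> \<le> infdist z (frontier D) \<and> within_dist z (\<Gamma> \<omega>) \<epsilon>"
    if "\<epsilon> < f \<epsilon>" "\<omega> \<in> space M" for z \<omega> \<epsilon>
  proof (cases "z \<in> D \<and> f \<epsilon> \<le> infdist z (frontier D)")
    case True
    have "within_dist z (image_trace F (\<lambda>t. \<gamma> t \<omega>)) \<epsilon> \<longleftrightarrow>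
      (\<forall>n::nat. \<exists>q\<in>\<rat> \<inter> {0..}. \<gamma> q \<omega> \<in> upper_half_plane \<and> cmod (F (\<gamma> q \<omega>) - z) < \<epsilon> + 1 / (real n + 1))"
      using True that \<gamma>c[OF that(2)] ball_infdist_frontier_subset[of z D]
      by (intro within_dist_image_trace_iff[OF F, of z "infdist z (frontier D)"]) auto
    then show ?thesis using True that(2) by (simp add: N_def near_trace_set_def \<Gamma> space_pair_measure)
  qed (auto simp: N_def near_trace_set_def)
  \<comment> \<open>The rescaled hitting probability, defined through slices of the measurable set
    \<open>N\<close>, so that it is measurable in z for every \<epsilon>, including those with f
    \<epsilon> \<le> \<epsilon>.\<close>
  define H where "H \<epsilon> z = ennreal (\<epsilon> powr (- q)) * emeasure M (Pair z -` N \<epsilon>)" for \<epsilon> z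
  have H_meas: "H \<epsilon> \<in> borel_measurable lborel" for \<epsilon>
    unfolding H_def[abs_def] by (rule borel_measurable_times_ennreal[OF measurable_const measurable_emeasure_Pair[OF N]]) simp
  have slice: "Pair z -` N \<epsilon> = (if z \<in> D \<and> f \<epsilon> \<le> infdist z (frontier D) then Ev z \<epsilon> else {})" if "\<epsilon> < f \<epsilon>" for z \<epsilon>
  proof (rule set_eqI)
    fix \<omega> show "\<omega> \<in> Pair z -` N \<epsilon> \<longleftrightarrow> \<omega> \<in> (if z \<in> D \<and> f \<epsilon> \<le> infdist z (frontier D) then Ev z \<epsilon> else {})"
    proof (cases "\<omega> \<in> space M")
      case True then show ?thesis using N_iff[OF that True, of z] by (auto simp: Ev_def)
    qed (auto simp: N_def space_pair_measure Ev_def)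
  qed
  have slice_sets: "Pair z -` N \<epsilon> \<in> sets M" for z \<epsilon> by (rule sets_Pair1[OF N])
  have lhs: "ennreal (\<epsilon> powr (sle_dim \<kappa> - 2)) * (\<integral>\<^sup>+\<omega>. Y_area D f (\<Gamma> \<omega>) \<epsilon> \<partial>M) = (\<integral>\<^sup>+z. H \<epsilon> z \<partial>lborel)"
    if "\<epsilon> < f \<epsilon>" for \<epsilon>
  proof -
    have "(\<integral>\<^sup>+\<omega>. Y_area D f (\<Gamma> \<omega>) \<epsilon> \<partial>M) = (\<integral>\<^sup>+\<omega>. \<integral>\<^sup>+z. indicator (N \<epsilon>) (z, \<omega>) \<partial>lborel \<partial>M)"
    proof (rule nn_integral_cong)
      fix \<omega> assume \<omega>: "\<omega> \<in> space M"
      have eq: "{z \<in> D. f \<epsilon> \<le> infdist z (frontier D) \<and> within_dist z (\<Gamma> \<omega>) \<epsilon>} = (\<lambda>z. (z, \<omega>)) -` N \<epsilon>"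
        using N_iff[OF that \<omega>] by auto
      have "(\<lambda>z. (z, \<omega>)) -` N \<epsilon> \<in> sets lborel" by (rule sets_Pair2[OF N])
      then have "emeasure lborel ((\<lambda>z. (z, \<omega>)) -` N \<epsilon>) = (\<integral>\<^sup>+z. indicator ((\<lambda>z. (z, \<omega>)) -` N \<epsilon>) z \<partial>lborel)"
        by (rule nn_integral_indicator[symmetric])
      then show "Y_area D f (\<Gamma> \<omega>) \<epsilon> = (\<integral>\<^sup>+z. indicator (N \<epsilon>) (z, \<omega>) \<partial>lborel)"
        unfolding Y_area_def eq by (simp add: indicator_def)
    qed
    also have "\<dots> = (\<integral>\<^sup>+z. \<integral>\<^sup>+\<omega>. indicator (N \<epsilon>) (z, \<omega>) \<partial>M \<partial>lborel)"
      by (rule P.Fubini[OF borel_measurable_indicator[OF N]])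
    also have "\<dots> = (\<integral>\<^sup>+z. emeasure M (Pair z -` N \<epsilon>) \<partial>lborel)"
    proof (rule nn_integral_cong)
      fix z :: complex
      have "(\<integral>\<^sup>+\<omega>. indicator (N \<epsilon>) (z, \<omega>) \<partial>M) = (\<integral>\<^sup>+\<omega>. indicator (Pair z -` N \<epsilon>) \<omega> \<partial>M)"
        by (simp add: indicator_def)
      also have "\<dots> = emeasure M (Pair z -` N \<epsilon>)" using slice_sets by (rule nn_integral_indicator)
      finally show "(\<integral>\<^sup>+\<omega>. indicator (N \<epsilon>) (z, \<omega>) \<partial>M) = emeasure M (Pair z -` N \<epsilon>)" .
    qed
    finally show ?thesis unfolding H_def q_def by (simp add: nn_integral_cmult[OF measurable_emeasure_Pair[OF N]])
  qed
  obtain C \<theta> where C: "0 < C" and \<theta>: "0 < \<theta>" and all_bound: "\<forall>z\<in>D. \<forall>\<epsilon>>0. \<epsilon> \<le> \<theta> * infdist z (frontier D) \<longrightarrow>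
    (\<forall>E\<in>sets M. E \<subseteq> {\<omega> \<in> space M. within_dist z (image_trace F (\<lambda>t. \<gamma> t \<omega>)) \<epsilon>} \<longrightarrow>
      emeasure M E \<le> ennreal (C * ?G z * \<epsilon> powr q))"
    using trace_probability_bound[OF assms(1,2) D sle F w, folded q_def] by (elim exE conjE)
  note bound = all_bound[rule_format]
  have powr_cancel: "\<epsilon> powr (- q) * (x * \<epsilon> powr q) = x" if "0 < \<epsilon>" for \<epsilon> x :: real
    using that by (simp add: powr_minus field_simps)
  \<comment> \<open>Points that count satisfy dist(z, \<partial>D) \<ge> f \<epsilon>, so \<epsilon>
    \<le> \<theta> f \<epsilon> places them in the range of the uniform bound; at all others the
    integrand is 0.\<close>
  have dominated: "H \<epsilon> z \<le> ennreal C * (ennreal (?G z) * indicator D z)"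
    if \<epsilon>: "0 < \<epsilon>" "\<epsilon> < f \<epsilon>" "\<epsilon> \<le> \<theta> * f \<epsilon>" for \<epsilon> z
  proof (cases "z \<in> D \<and> f \<epsilon> \<le> infdist z (frontier D)")
    case True
    have "\<theta> * f \<epsilon> \<le> \<theta> * infdist z (frontier D)" using True \<theta> by (intro mult_left_mono) auto
    then have "emeasure M (Pair z -` N \<epsilon>) \<le> ennreal (C * ?G z * \<epsilon> powr q)"
      using True \<epsilon> slice_sets[of z \<epsilon>] unfolding slice[OF \<epsilon>(2)] by (intro bound) (auto simp: Ev_def \<Gamma>)
    then have "H \<epsilon> z \<le> ennreal (\<epsilon> powr (- q)) * ennreal (C * ?G z * \<epsilon> powr q)"
      unfolding H_def by (rule mult_left_mono) simp
    also have "\<dots> = ennreal (C * ?G z)"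
      by (subst ennreal_mult'[symmetric]) (simp_all add: powr_cancel[OF \<epsilon>(1)])
    finally show ?thesis using True C Gpos[of z] by (simp add: ennreal_mult)
  qed (auto simp: H_def slice[OF \<epsilon>(2)])
  define L where "L z = ennreal chat * (ennreal (?G z) * indicator D z)" for z
  have pointwise: "((\<lambda>\<epsilon>. H \<epsilon> z) \<longlongrightarrow> L z) (at_right 0)" for z
  proof (cases "z \<in> D")
    case True
    have ev1: "\<forall>\<^sub>F \<epsilon> in at_right 0. \<epsilon> < f \<epsilon>"
    proof -
      have "\<forall>\<^sub>F \<epsilon> in at_right 0. \<epsilon> / f \<epsilon> < 1" using order_tendstoD(2)[OF assms(6), of 1] by simp
      moreover have "\<forall>\<^sub>F \<epsilon> in at_right (0::real). 0 < \<epsilon>" by (rule eventually_at_right_less)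
      ultimately show ?thesis
        by eventually_elim (use assms(4) in \<open>simp add: divide_less_eq\<close>)
    qed
    have ev2: "\<forall>\<^sub>F \<epsilon> in at_right 0. f \<epsilon> \<le> infdist z (frontier D)"
      using order_tendstoD(2)[OF assms(5) Upsilon_le_infdist_frontier(1)[OF D F True]]
      by (rule eventually_mono) simp
    \<comment> \<open>The defining property of \<open>chat\<close> for the given path. As the
      Green's function is positive, the exceptional 0 / 0 clause of asymptotic equivalence does not
      occur for \<epsilon> > 0.\<close>
    have "(\<lambda>\<epsilon>. measure M (Ev z \<epsilon>)) \<sim>[at_right 0] (\<lambda>\<epsilon>. chat * ?G z * \<epsilon> powr q)"
      using assms(3,7-11) True unfolding SLE_Green_constant_def Ev_def q_def by blast
    then have "((\<lambda>\<epsilon>. if measure M (Ev z \<epsilon>) = 0 \<and> chat * ?G z * \<epsilon> powr q = 0 then 1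
        else measure M (Ev z \<epsilon>) / (chat * ?G z * \<epsilon> powr q)) \<longlongrightarrow> 1) (at_right 0)"
      by (rule asymp_equivD)
    from tendsto_mult[OF this tendsto_const[of "chat * ?G z"]]
    have "((\<lambda>\<epsilon>. (if measure M (Ev z \<epsilon>) = 0 \<and> chat * ?G z * \<epsilon> powr q = 0 then 1
        else measure M (Ev z \<epsilon>) / (chat * ?G z * \<epsilon> powr q)) * (chat * ?G z)) \<longlongrightarrow> 1 * (chat * ?G z)) (at_right 0)" .
    moreover have "\<forall>\<^sub>F \<epsilon> in at_right 0. (if measure M (Ev z \<epsilon>) = 0 \<and> chat * ?G z * \<epsilon> powr q = 0 then 1
        else measure M (Ev z \<epsilon>) / (chat * ?G z * \<epsilon> powr q)) * (chat * ?G z) = \<epsilon> powr (- q) * measure M (Ev z \<epsilon>)"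
      using eventually_at_right_less[of "0::real"]
    proof eventually_elim
      case (elim \<epsilon>)
      then show ?case using c Gpos[OF True] by (simp add: powr_minus field_simps)
    qed
    ultimately have "((\<lambda>\<epsilon>. \<epsilon> powr (- q) * measure M (Ev z \<epsilon>)) \<longlongrightarrow> 1 * (chat * ?G z)) (at_right 0)"
      by (rule Lim_transform_eventually)
    then have "((\<lambda>\<epsilon>. ennreal (\<epsilon> powr (- q) * measure M (Ev z \<epsilon>))) \<longlongrightarrow> ennreal (1 * (chat * ?G z))) (at_right 0)"
      by (rule tendsto_ennrealI)
    moreover have "\<forall>\<^sub>F \<epsilon> in at_right 0. ennreal (\<epsilon> powr (- q) * measure M (Ev z \<epsilon>)) = H \<epsilon> z"
      using ev1 ev2
    proof eventually_elim
      case (elim \<epsilon>)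
      have "Pair z -` N \<epsilon> = Ev z \<epsilon>" unfolding slice[OF elim(1)] using elim True by simp
      then show ?case by (simp add: H_def ennreal_mult emeasure_eq_measure)
    qed
    ultimately have "((\<lambda>\<epsilon>. H \<epsilon> z) \<longlongrightarrow> ennreal (1 * (chat * ?G z))) (at_right 0)"
      by (rule Lim_transform_eventually)
    moreover have "ennreal (1 * (chat * ?G z)) = L z" using True c Gpos[OF True] by (simp add: L_def ennreal_mult)
    ultimately show ?thesis by simp
  next
    case False
    then have "Pair z -` N \<epsilon> = {}" for \<epsilon> by (auto simp: N_def near_trace_set_def)
    then show ?thesis using False by (simp add: H_def L_def)
  qed
  have good: "\<forall>\<^sub>F \<epsilon> in at_right 0. 0 < \<epsilon> \<and> \<epsilon> < f \<epsilon> \<and> \<epsilon> \<le> \<theta> * f \<epsilon>"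
  proof -
    have "\<forall>\<^sub>F \<epsilon> in at_right 0. \<epsilon> / f \<epsilon> < min 1 \<theta>" using order_tendstoD(2)[OF assms(6), of "min 1 \<theta>"] \<theta> by simp
    then show ?thesis using eventually_at_right_less[of "0::real"]
    proof eventually_elim
      case (elim \<epsilon>)
      then have "0 < f \<epsilon>" using assms(4) by simp
      moreover have "\<epsilon> / f \<epsilon> < 1" "\<epsilon> / f \<epsilon> < \<theta>" using elim by auto
      ultimately show ?case using elim by (auto simp: divide_less_eq)
    qed
  qed
  show ?thesis
    unfolding tendsto_at_iff_sequentially
  proof (intro allI impI)
    fix X :: "nat \<Rightarrow> real" assume X: "\<forall>i. X i \<in> {0<..} - {0}" "X \<longlonglongrightarrow> 0"
    have "0 < X i" for i using X(1) by auto
    then have Xf: "filterlim X (at_right 0) sequentially"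
      unfolding filterlim_at using X(2) by (simp add: less_imp_neq[symmetric])
    \<comment> \<open>Finitely many terms of the sequence may be too large for the identities and
      the bound; they are removed by a shift.\<close>
    obtain n0 where n0: "\<And>n. n0 \<le> n \<Longrightarrow> 0 < X n \<and> X n < f (X n) \<and> X n \<le> \<theta> * f (X n)"
      using eventually_compose_filterlim[OF good Xf] unfolding eventually_sequentially by blast
    define u where "u n z = H (X (n + n0)) z" for n z
    have u_meas: "u n \<in> borel_measurable lborel" for n unfolding u_def[abs_def] by (rule H_meas)
    have u_lim: "(\<lambda>n. u n z) \<longlonglongrightarrow> L z" for z
      using LIMSEQ_ignore_initial_segment[OF filterlim_compose[OF pointwise Xf], of n0 z] by (simp add: u_def)
    \<comment> \<open>Measurability of the Green's function comes for free, since it is up to the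
      factor \<open>chat\<close> a pointwise limit of measurable functions on D.\<close>
    have L_meas: "L \<in> borel_measurable lborel"
      by (rule borel_measurable_LIMSEQ_order[OF u_lim u_meas])
    define I where "I z = ennreal (?G z) * indicator D z" for z
    have I_eq: "I z = ennreal (1 / chat) * L z" for z
      using c unfolding I_def L_def by (simp flip: mult.assoc ennreal_mult)
    have I_meas: "I \<in> borel_measurable lborel"
      unfolding I_eq[abs_def] by (rule borel_measurable_times_ennreal[OF measurable_const L_meas]) simp
    have L_int: "(\<integral>\<^sup>+z. L z \<partial>lborel) = ennreal chat * (\<integral>\<^sup>+z. I z \<partial>lborel)"
      unfolding L_def I_def[symmetric] by (rule nn_integral_cmult[OF I_meas])
    have "(\<lambda>n. \<integral>\<^sup>+z. u n z \<partial>lborel) \<longlonglongrightarrow> (\<integral>\<^sup>+z. L z \<partial>lborel)"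
    proof (cases "(\<integral>\<^sup>+z. I z \<partial>lborel) = \<infinity>")
      case True
      have "(\<integral>\<^sup>+z. L z \<partial>lborel) = \<infinity>" using True c unfolding L_int by (simp add: ennreal_mult_top)
      moreover have "(\<integral>\<^sup>+z. L z \<partial>lborel) \<le> liminf (\<lambda>n. \<integral>\<^sup>+z. u n z \<partial>lborel)"
      proof -
        have "(\<integral>\<^sup>+z. L z \<partial>lborel) = (\<integral>\<^sup>+z. liminf (\<lambda>n. u n z) \<partial>lborel)"
          using lim_imp_Liminf[OF sequentially_bot u_lim] by simp
        also have "\<dots> \<le> liminf (\<lambda>n. \<integral>\<^sup>+z. u n z \<partial>lborel)" by (rule nn_integral_liminf[OF u_meas])
        finally show ?thesis .
      qed
      ultimately have inf: "liminf (\<lambda>n. \<integral>\<^sup>+z. u n z \<partial>lborel) = \<infinity>" by (simp add: top_unique)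
      moreover have "limsup (\<lambda>n. \<integral>\<^sup>+z. u n z \<partial>lborel) = \<infinity>"
        using Liminf_le_Limsup[OF sequentially_bot, of "\<lambda>n. \<integral>\<^sup>+z. u n z \<partial>lborel"] inf by (simp add: top_unique)
      ultimately show ?thesis
        unfolding \<open>(\<integral>\<^sup>+z. L z \<partial>lborel) = \<infinity>\<close> by (rule Liminf_eq_Limsup[OF sequentially_bot])
    next
      case False
      show ?thesis
      proof (rule nn_integral_dominated_convergence[where w = "\<lambda>z. ennreal C * I z"])
        show "AE z in lborel. u n z \<le> ennreal C * I z" for n
          using dominated[of "X (n + n0)"] n0[of "n + n0"] by (simp add: u_def I_def)
        show "(\<integral>\<^sup>+z. ennreal C * I z \<partial>lborel) < \<infinity>"
          using False by (simp add: nn_integral_cmult[OF I_meas] ennreal_mult_less_top less_top)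
      next
        show "u n \<in> borel_measurable lborel" for n by (rule u_meas)
        show "L \<in> borel_measurable lborel" by (rule L_meas)
        show "(\<lambda>z. ennreal C * I z) \<in> borel_measurable lborel"
          by (rule borel_measurable_times_ennreal[OF measurable_const I_meas]) simp
        show "AE z in lborel. (\<lambda>n. u n z) \<longlonglongrightarrow> L z" using u_lim by simp
      qed
    qed
    moreover have "((\<lambda>\<epsilon>. ennreal (\<epsilon> powr (sle_dim \<kappa> - 2)) * (\<integral>\<^sup>+\<omega>. Y_area D f (\<Gamma> \<omega>) \<epsilon> \<partial>M)) \<circ> X) (n + n0)
        = (\<integral>\<^sup>+z. u n z \<partial>lborel)" for n
      using lhs[of "X (n + n0)"] n0[of "n + n0"] by (simp add: u_def)
    ultimately have "(\<lambda>n. ((\<lambda>\<epsilon>. ennreal (\<epsilon> powr (sle_dim \<kappa> - 2)) * (\<integral>\<^sup>+\<omega>. Y_area D f (\<Gamma> \<omega>) \<epsilon> \<partial>M)) \<circ> X) (n + n0))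
        \<longlonglongrightarrow> ennreal chat * (\<integral>\<^sup>+z\<in>D. ennreal (?G z) \<partial>lborel)"
      unfolding L_int I_def by simp
    then show "((\<lambda>\<epsilon>. ennreal (\<epsilon> powr (sle_dim \<kappa> - 2)) * (\<integral>\<^sup>+\<omega>. Y_area D f (\<Gamma> \<omega>) \<epsilon> \<partial>M)) \<circ> X)
        \<longlonglongrightarrow> ennreal chat * (\<integral>\<^sup>+z\<in>D. ennreal (?G z) \<partial>lborel)"
      by (rule LIMSEQ_offset)
  qed
qed

end
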